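(* Let $p\neq\ell$ be primes, $q=p^f$, $\epsilon\in\{\pm1\}$, $G=\mathrm{GL}_n(\epsilon q)$, $X=\mathrm{SL}_n(\epsilon q)$, and assume that $\ell\nmid\gcd(n,q-\epsilon)$. Let $(R,\varphi)$ be an $\ell$-weight of $G$ and $S=R\cap X$. Then $(S,\psi)$ is an $\ell$-weight of $X$ for every $\psi\in\mathrm{Irr}(N_X(S)\mid\varphi)$. Conversely, let $(S,\psi)$ be an $\ell$-weight of $X$ and $R=S\,\mathcal O_\ell(Z(G))$. Then there exists $\varphi\in\mathrm{Irr}(N_G(R)\mid\psi)$ such that $(R,\varphi)$ is an $\ell$-weight of $G$.
   Context: $\mathrm{GL}_n(-q)$ denotes $\mathrm{GU}_n(q)=\{A\in\mathrm{GL}_n(q^2)\mid F_q(A)^{tr}A=I\}$ ($F_q$ raises entries to the $q$-th power) and $\mathrm{SL}_n(-q)=\mathrm{SU}_n(q)=\mathrm{GU}_n(q)\cap\mathrm{SL}_n(q^2)$. An $\ell$-weight of a finite group $H$ is a pair $(R,\varphi)$ with $R$ an $\ell$-subgroup of $H$ and $\varphi\in\mathrm{Irr}(N_H(R))$ with $R\subseteq\ker\varphi$ and of $\ell$-defect zero viewed as a character of $N_H(R)/R$. $\mathrm{Irr}(N_X(S)\mid\varphi)$ is the set of irreducible constituents of the restriction of $\varphi$ to $N_X(S)$ (here $N_X(S)=N_G(R)\cap X$), and $\mathrm{Irr}(N_G(R)\mid\psi)$ the set of irreducible characters of $N_G(R)$ lying over $\psi$. *)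

theory Defs
  imports
    "HOL-Algebra.Group_Action"
    "HOL-Algebra.Generated_Groups"
    "HOL-Computational_Algebra.Primes"
    "Jordan_Normal_Form.VS_Connect"
begin

subsection \<open>Linear and unitary groups\<close>

definition GL :: "'a::field itself \<Rightarrow> nat \<Rightarrow> 'a mat monoid" where
  "GL ty n = units_of (ring_mat ty n ())"

text \<open>\<^term>\<open>GU ty n q\<close> is meant for a field with \<open>q\<^sup>2\<close> elements, so that \<open>x \<mapsto> x\<^sup>q\<close> is its
  involutory automorphism.\<close>

definition GU :: "'a::field itself \<Rightarrow> nat \<Rightarrow> nat \<Rightarrow> 'a mat monoid" where
  "GU ty n q = (GL ty n)\<lparr>carrier :=
     {A \<in> carrier (GL ty n). transpose_mat (map_mat (\<lambda>x. x ^ q) A) * A = 1\<^sub>m n}\<rparr>"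

text \<open>\<open>GL\<^sub>n(\<epsilon>q)\<close> and \<open>SL\<^sub>n(\<epsilon>q)\<close> for \<open>\<epsilon> = \<plusminus>1\<close>. The coefficient field must have \<open>q\<close> elements if
  \<open>\<epsilon> = 1\<close> and \<open>q\<^sup>2\<close> elements if \<open>\<epsilon> = -1\<close>.\<close>

definition GL_eps :: "'a::field itself \<Rightarrow> nat \<Rightarrow> int \<Rightarrow> nat \<Rightarrow> 'a mat monoid" where
  "GL_eps ty n \<epsilon> q = (if \<epsilon> = 1 then GL ty n else GU ty n q)"

definition SL_eps :: "'a::field itself \<Rightarrow> nat \<Rightarrow> int \<Rightarrow> nat \<Rightarrow> 'a mat monoid" where
  "SL_eps ty n \<epsilon> q =
     (GL_eps ty n \<epsilon> q)\<lparr>carrier := {A \<in> carrier (GL_eps ty n \<epsilon> q). det A = 1}\<rparr>"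


subsection \<open>Subgroups of a finite group\<close>

definition prime_power_subgroup :: "nat \<Rightarrow> ('g, 'b) monoid_scheme \<Rightarrow> 'g set \<Rightarrow> bool" where
  "prime_power_subgroup l H R \<longleftrightarrow> subgroup R H \<and> (\<exists>k. card R = l ^ k)"

definition center :: "('g, 'b) monoid_scheme \<Rightarrow> 'g set" where
  "center H = {z \<in> carrier H. \<forall>g\<in>carrier H. z \<otimes>\<^bsub>H\<^esub> g = g \<otimes>\<^bsub>H\<^esub> z}"

text \<open>\<open>O\<^sub>l(H)\<close>, the largest normal \<open>l\<close>-subgroup.\<close>

definition l_core :: "nat \<Rightarrow> ('g, 'b) monoid_scheme \<Rightarrow> 'g set" where
  "l_core l H = generate H (\<Union>{N. N \<lhd> H \<and> prime_power_subgroup l H N})"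

abbreviation normalizer_group ::
  "('g, 'b) monoid_scheme \<Rightarrow> 'g set \<Rightarrow> ('g, 'b) monoid_scheme" where
  "normalizer_group H R \<equiv> H\<lparr>carrier := normalizer H R\<rparr>"


subsection \<open>Ordinary characters of a finite group\<close>

definition mat_trace :: "'a::comm_monoid_add mat \<Rightarrow> 'a" where
  "mat_trace A = (\<Sum>i<dim_row A. A $$ (i, i))"

definition irreducible_rep ::
  "('g, 'b) monoid_scheme \<Rightarrow> nat \<Rightarrow> ('g \<Rightarrow> complex mat) \<Rightarrow> bool" where
  "irreducible_rep H d \<rho> \<longleftrightarrow> \<rho> \<in> hom H (GL TYPE(complex) d) \<and> 0 < d \<and>
     (\<forall>W. subspace class_ring W (module_vec TYPE(complex) d) \<longrightarrow>
          (\<forall>g\<in>carrier H. \<forall>w\<in>W. \<rho> g *\<^sub>v w \<in> W) \<longrightarrow>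
          W = {0\<^sub>v d} \<or> W = carrier_vec d)"

text \<open>A character of \<open>H\<close> is normalised to be \<^const>\<open>undefined\<close> off \<^term>\<open>carrier H\<close>, so that two
  characters are equal iff they agree on the group.\<close>

definition Irr :: "('g, 'b) monoid_scheme \<Rightarrow> ('g \<Rightarrow> complex) set" where
  "Irr H = {restrict (\<lambda>g. mat_trace (\<rho> g)) (carrier H) |d \<rho>. irreducible_rep H d \<rho>}"

definition char_inner ::
  "('g, 'b) monoid_scheme \<Rightarrow> ('g \<Rightarrow> complex) \<Rightarrow> ('g \<Rightarrow> complex) \<Rightarrow> complex" where
  "char_inner H \<theta> \<chi> = (\<Sum>g\<in>carrier H. \<theta> g * cnj (\<chi> g)) / of_nat (Coset.order H)"

text \<open>\<open>Irr(K | \<phi>)\<close> for a character \<open>\<phi>\<close> of a group containing \<open>K\<close>: the irreducible constituents of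
  the restriction of \<open>\<phi>\<close> to \<open>K\<close>.\<close>

definition Irr_below :: "('g, 'b) monoid_scheme \<Rightarrow> ('g \<Rightarrow> complex) \<Rightarrow> ('g \<Rightarrow> complex) set" where
  "Irr_below K \<phi> = {\<psi> \<in> Irr K. char_inner K (restrict \<phi> (carrier K)) \<psi> \<noteq> 0}"

text \<open>\<open>Irr(H | \<psi>)\<close> for an irreducible character \<open>\<psi>\<close> of a subgroup \<open>K\<close> of \<open>H\<close>: the irreducible
  characters of \<open>H\<close> lying over \<open>\<psi>\<close>.\<close>

definition Irr_over :: "('g, 'b) monoid_scheme \<Rightarrow> ('g, 'c) monoid_scheme \<Rightarrow> ('g \<Rightarrow> complex) \<Rightarrow>
    ('g \<Rightarrow> complex) set" where
  "Irr_over H K \<psi> = {\<phi> \<in> Irr H. \<psi> \<in> Irr_below K \<phi>}"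

definition char_ker :: "('g, 'b) monoid_scheme \<Rightarrow> ('g \<Rightarrow> complex) \<Rightarrow> 'g set" where
  "char_ker H \<chi> = {g \<in> carrier H. \<chi> g = \<chi> \<one>\<^bsub>H\<^esub>}"

text \<open>A character with the normal subgroup \<open>R\<close> in its kernel, viewed as a character of \<^term>\<open>H Mod R\<close>;
  it is constant on each coset of \<open>R\<close>.\<close>

definition deflate ::
  "('g, 'b) monoid_scheme \<Rightarrow> 'g set \<Rightarrow> ('g \<Rightarrow> complex) \<Rightarrow> 'g set \<Rightarrow> complex" where
  "deflate H R \<chi> = restrict (\<lambda>C. the_elem (\<chi> ` C)) (carrier (H Mod R))"

text \<open>\<open>l\<close>-defect zero: \<open>\<chi>(1)\<close> and \<open>|H|\<close> have the same \<open>l\<close>-part.\<close>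

definition defect_zero :: "nat \<Rightarrow> ('g, 'b) monoid_scheme \<Rightarrow> ('g \<Rightarrow> complex) \<Rightarrow> bool" where
  "defect_zero l H \<chi> \<longleftrightarrow> \<chi> \<in> Irr H \<and>
     (\<exists>d. \<chi> \<one>\<^bsub>H\<^esub> = of_nat d \<and> multiplicity l d = multiplicity l (Coset.order H))"

definition l_weight ::
  "nat \<Rightarrow> ('g, 'b) monoid_scheme \<Rightarrow> 'g set \<Rightarrow> ('g \<Rightarrow> complex) \<Rightarrow> bool" where
  "l_weight l H R \<phi> \<longleftrightarrow> prime_power_subgroup l H R \<and>
     \<phi> \<in> Irr (normalizer_group H R) \<and>
     R \<subseteq> char_ker (normalizer_group H R) \<phi> \<and>
     defect_zero l (normalizer_group H R Mod R) (deflate (normalizer_group H R) R \<phi>)"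

end

theory Submission
  imports Defs "Jordan_Normal_Form.Spectral_Radius" "HOL-Algebra.Multiplicative_Group" "HOL-Algebra.Zassenhaus"
    "HOL-Number_Theory.Residues"
begin

text \<open>Put \<open>e = q - \<epsilon>\<close> and \<open>Z = O\<^sub>l(Z(G))\<close>. The centre of \<open>G\<close> consists of the scalar matrices \<open>c I\<close> with
  \<open>c\<^sup>e = 1\<close>, and every determinant is an \<open>e\<close>-th root of unity. Because \<open>l\<close> does not divide
  \<open>gcd(n, e)\<close>, the determinant \<open>c\<^sup>n\<close> of a scalar of \<open>l\<close>-power order is \<open>1\<close> only for \<open>c = 1\<close>, and every
  \<open>e\<close>-th root of unity of \<open>l\<close>-power order is the determinant of such a scalar. So \<open>X \<inter> Z = 1\<close>,
  and \<open>X Z\<close> is the kernel of a linear character \<open>\<nu>\<close> of \<open>G\<close> whose order is prime to \<open>l\<close>: a power of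
  the determinant followed by a faithful character of the multiplicative group of the field
  (\<open>central_l_extension_SL\<close>). The statement about weights holds for every finite group with such
  \<open>X\<close>, \<open>Z\<close> and \<open>\<nu>\<close> (locale \<open>central_l_extension\<close>).

  In that setting let \<open>(R, \<phi>)\<close> be an \<open>l\<close>-weight and \<open>N\<close> the normaliser of \<open>R\<close>. First, \<open>Z \<subseteq> R\<close>. Indeed \<open>R Z\<close>
  acts by scalars in a representation that affords \<open>\<phi>\<close>, so \<open>\<phi>(1)\<close> divides \<open>|N : R Z|\<close>
  (\<open>degree_dvd_index\<close>), whereas \<open>\<phi>(1)\<close> and \<open>|N : R|\<close> have the same \<open>l\<close>-part by defect zero. Secondly, \<open>R\<close>
  lies in the kernel \<open>X Z\<close> of \<open>\<nu>\<close>. Hence \<open>R = S Z\<close> with \<open>S = R \<inter> X\<close>, and \<open>R\<close> and \<open>S\<close> have the same normaliser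
  \<open>N\<close>. With \<open>M = N \<inter> X\<close>, the group \<open>N / M Z\<close> is cyclic of order prime to \<open>l\<close>, so \<open>|N : R|\<close> and \<open>|M : S|\<close>
  have the same \<open>l\<close>-part.

  Both halves then rest on the following fact (\<open>multiplicity_degree_eq\<close>): if \<open>\<phi> \<in> Irr(N)\<close> is trivial on \<open>Z\<close>
  and lies over \<open>\<psi> \<in> Irr(M)\<close>, then \<open>\<phi>(1)\<close> and \<open>\<psi>(1)\<close> have the same \<open>l\<close>-part. By Clifford's theorem
  \<open>\<phi>\<close> restricts to \<open>M\<close> with \<open>t\<close> constituents of the degree of \<open>\<psi>\<close>, each of multiplicity \<open>s\<close>, and it must be
  seen that \<open>l\<close> divides neither \<open>s\<close> nor \<open>t\<close>. The norm of the restriction to \<open>M Z\<close> is \<open>s\<^sup>2 t\<close>; averaging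
  over the twists of \<open>\<phi>\<close> by the powers of \<open>\<nu>\<close> expresses the same norm by numbers prime to \<open>l\<close>
  (\<open>norm_on_lin_ker\<close>). So defect zero passes from \<open>\<phi>\<close> to \<open>\<psi>\<close> and back. For the converse half a
  character \<open>\<phi>\<close> over \<open>\<psi>\<close> that is trivial on \<open>Z\<close> has to be found: the function \<open>k z \<mapsto> \<psi>(k\<inverse>)\<close> on \<open>M Z\<close> does
  not vanish at the identity, hence is not orthogonal to all of \<open>Irr(N)\<close> (\<open>exists_Irr_sum_nonzero\<close>).

  The character theory behind this is developed from Schur's lemma for matrix representations.\<close>

section \<open>Traces and idempotent matrices\<close>

lemma mat_trace_mult_comm:
  fixes A :: "'a::comm_semiring_0 mat"
  assumes "A \<in> carrier_mat m n" "B \<in> carrier_mat n m"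
  shows "mat_trace (A * B) = mat_trace (B * A)"
proof -
  have "mat_trace (A * B) = (\<Sum>i<m. \<Sum>j<n. A $$ (i, j) * B $$ (j, i))"
    using assms by (auto simp: mat_trace_def scalar_prod_def atLeast0LessThan intro!: sum.cong)
  also have "\<dots> = (\<Sum>j<n. \<Sum>i<m. B $$ (j, i) * A $$ (i, j))"
    by (subst sum.swap) (simp add: mult.commute)
  also have "\<dots> = mat_trace (B * A)"
    using assms by (auto simp: mat_trace_def scalar_prod_def atLeast0LessThan intro!: sum.cong)
  finally show ?thesis .
qed

lemma mat_trace_one: "mat_trace (1\<^sub>m d) = (of_nat d :: 'a::semiring_1)"
  by (simp add: mat_trace_def)

lemma mat_trace_minus:
  fixes A :: "'a::ring_1 mat"
  assumes "A \<in> carrier_mat d d" "B \<in> carrier_mat d d"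
  shows "mat_trace (A - B) = mat_trace A - mat_trace B"
  using assms by (auto simp: mat_trace_def sum_subtractf)

lemma mat_trace_smult:
  fixes A :: "'a::ring_1 mat"
  assumes "A \<in> carrier_mat d d"
  shows "mat_trace (c \<cdot>\<^sub>m A) = c * mat_trace A"
  using assms by (auto simp: mat_trace_def sum_distrib_left)

lemma zero_mat_mult_vec:
  fixes v :: "'a::semiring_0 vec"
  assumes "v \<in> carrier_vec n"
  shows "0\<^sub>m m n *\<^sub>v v = 0\<^sub>v m"
  using assms by (intro eq_vecI) (auto simp: scalar_prod_def)

lemma mat_mult_zero_vec:
  fixes A :: "'a::semiring_0 mat"
  assumes "A \<in> carrier_mat m n"
  shows "A *\<^sub>v 0\<^sub>v n = 0\<^sub>v m"
  using assms by (intro eq_vecI) (auto simp: scalar_prod_def)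

lemma mat_mult_entry:
  fixes A :: "'a::semiring_0 mat"
  assumes "A \<in> carrier_mat m n" "B \<in> carrier_mat n k" "i < m" "j < k"
  shows "(A * B) $$ (i, j) = (\<Sum>x\<in>{0..<n}. A $$ (i, x) * B $$ (x, j))"
  using assms by (simp add: scalar_prod_def)

lemma mat_mult_unit_vec:
  fixes A :: "'a::semiring_1 mat"
  assumes "A \<in> carrier_mat m n" "i < n"
  shows "A *\<^sub>v unit_vec n i = col A i"
  using assms by (intro eq_vecI) auto

lemma eq_matI_mult_vec:
  fixes A :: "'a::semiring_1 mat"
  assumes "A \<in> carrier_mat m n" "B \<in> carrier_mat m n"
    and "\<And>v. v \<in> carrier_vec n \<Longrightarrow> A *\<^sub>v v = B *\<^sub>v v"
  shows "A = B"
proof (rule mat_col_eqI)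
  show "col A i = col B i" if "i < dim_col B" for i
    using assms(3)[of "unit_vec n i"] that assms(1,2) by (auto simp: mat_mult_unit_vec)
qed (use assms in auto)

text \<open>Subspaces in elementwise form, as an alternative to the locale-based notion in the definition of
  irreducibility.\<close>

definition linear_subspace :: "nat \<Rightarrow> 'a::field vec set \<Rightarrow> bool" where
  "linear_subspace d W \<longleftrightarrow> W \<subseteq> carrier_vec d \<and> 0\<^sub>v d \<in> W \<and>
     (\<forall>v\<in>W. \<forall>w\<in>W. v + w \<in> W) \<and> (\<forall>c. \<forall>v\<in>W. c \<cdot>\<^sub>v v \<in> W)"

lemma subspace_iff_linear_subspace:
  "VectorSpace.subspace class_ring W (module_vec TYPE('a::field) d) \<longleftrightarrow> linear_subspace d W"
proof -
  interpret vec_space "TYPE('a)" d .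
  show ?thesis
    unfolding VectorSpace.subspace_def LinearCombinations.submodule_def linear_subspace_def
    using vectorspace_axioms module_axioms
    by (auto simp: module_vec_simps class_field_def)
qed

lemma right_inverse_dim_le:
  fixes B :: "'a::field mat"
  assumes "B \<in> carrier_mat d k" "C \<in> carrier_mat k d" "C * B = 1\<^sub>m k"
  shows "k \<le> d"
proof (rule ccontr)
  assume "\<not> k \<le> d"
  then have dk: "d < k" by simp
  define B' where "B' = mat k k (\<lambda>(i, j). if i < d then B $$ (i, j) else 0)"
  define C' where "C' = mat k k (\<lambda>(i, j). if j < d then C $$ (i, j) else 0)"
  have c: "B' \<in> carrier_mat k k" "C' \<in> carrier_mat k k" by (auto simp: B'_def C'_def)
  have "C' * B' = 1\<^sub>m k"
  proof (rule eq_matI)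
    fix i j assume ij: "i < dim_row (1\<^sub>m k)" "j < dim_col (1\<^sub>m k)"
    have "(C' * B') $$ (i, j) = (\<Sum>a\<in>{0..<k}. if a < d then C $$ (i, a) * B $$ (a, j) else 0)"
      using ij c by (auto simp: scalar_prod_def B'_def C'_def intro!: sum.cong)
    also have "\<dots> = (\<Sum>a\<in>{0..<d}. C $$ (i, a) * B $$ (a, j))"
      using dk by (intro sum.mono_neutral_cong_right) auto
    also have "\<dots> = (C * B) $$ (i, j)"
      using ij assms(1,2) by (auto simp: scalar_prod_def)
    finally show "(C' * B') $$ (i, j) = 1\<^sub>m k $$ (i, j)" using assms by simp
  qed (use c in auto)
  moreover have "det C' = 0"
    unfolding det_0_iff_vec_prod_zero[OF c(2)]
  proof (intro exI[of _ "unit_vec k (k - 1)"] conjI)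
    show "C' *\<^sub>v unit_vec k (k - 1) = 0\<^sub>v k"
      using c dk by (subst mat_mult_unit_vec) (auto simp: C'_def)
    show "unit_vec k (k - 1) \<noteq> (0\<^sub>v k :: 'a vec)"
      using dk by (intro unit_vec_nonzero) auto
  qed auto
  ultimately show False
    using det_mult[OF c(2,1)] by simp
qed

text \<open>A projection onto \<open>W\<close>, written as \<open>B * C\<close> with \<open>C * B\<close> the identity, takes the place of a basis of
  \<open>W\<close>: the columns of \<open>B\<close> are a basis and \<open>C\<close> reads off coordinates. Such a pair with a largest possible
  number \<open>k\<close> of columns exists because \<open>k \<le> d\<close>, and it captures all of \<open>W\<close>, since a vector of \<open>W\<close>
  that it misses would supply one more column.\<close>

lemma linear_subspace_factorization:
  fixes W :: "'a::field vec set"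
  assumes W: "linear_subspace d W"
  obtains k B C where "B \<in> carrier_mat d k" "C \<in> carrier_mat k d" "C * B = 1\<^sub>m k"
    "\<And>v. v \<in> carrier_vec k \<Longrightarrow> B *\<^sub>v v \<in> W" "\<And>w. w \<in> W \<Longrightarrow> (B * C) *\<^sub>v w = w"
proof -
  define P where "P k \<longleftrightarrow> (\<exists>B C. B \<in> carrier_mat d k \<and> C \<in> carrier_mat k d \<and> C * B = 1\<^sub>m k \<and>
    (\<forall>v\<in>carrier_vec k. B *\<^sub>v v \<in> W))" for k
  have "P 0"
    unfolding P_def
  proof (intro exI conjI ballI)
    show "0\<^sub>m 0 d * 0\<^sub>m d 0 = 1\<^sub>m 0" by (intro eq_matI) auto
    show "0\<^sub>m d 0 *\<^sub>v v \<in> W" if "v \<in> carrier_vec 0" for v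
    proof -
      have "0\<^sub>m d 0 *\<^sub>v v = 0\<^sub>v d" using that by (rule zero_mat_mult_vec)
      then show ?thesis using W by (simp add: linear_subspace_def)
    qed
  qed auto
  moreover have "\<And>k. P k \<Longrightarrow> k \<le> d"
    unfolding P_def using right_inverse_dim_le by blast
  ultimately obtain k where k: "P k" "\<And>k'. P k' \<Longrightarrow> k' \<le> k"
    by (metis GreatestI_nat Greatest_le_nat)
  then obtain B C where BC: "B \<in> carrier_mat d k" "C \<in> carrier_mat k d" "C * B = 1\<^sub>m k"
    "\<And>v. v \<in> carrier_vec k \<Longrightarrow> B *\<^sub>v v \<in> W" unfolding P_def by blast
  have "(B * C) *\<^sub>v w = w" if w: "w \<in> W" for w
  proof (rule ccontr)
    assume neq: "(B * C) *\<^sub>v w \<noteq> w"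
    have wc: "w \<in> carrier_vec d" using w W by (auto simp: linear_subspace_def)
    define D where "D = 1\<^sub>m d - B * C"
    have D: "D \<in> carrier_mat d d" using BC by (auto simp: D_def)
    define u where "u = D *\<^sub>v w"
    have uc: "u \<in> carrier_vec d" using D wc by (auto simp: u_def)
    have DB: "D * B = 0\<^sub>m d k"
      using BC by (simp add: D_def minus_mult_distrib_mat[of _ d d])
    have CD: "C * D = 0\<^sub>m k d"
    proof -
      have "C * D = C * 1\<^sub>m d - C * (B * C)"
        unfolding D_def using BC(1,2) by (intro mult_minus_distrib_mat) auto
      also have "C * (B * C) = C"
        using BC(1-3) by (metis assoc_mult_mat left_mult_one_mat)
      finally show ?thesis using BC(2) by simp
    qed
    have u: "u = w - (B * C) *\<^sub>v w"
      using BC(1,2) wc by (simp add: u_def D_def minus_mult_distrib_mat_vec[of _ d d])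
    have "u = w + (-1) \<cdot>\<^sub>v (B *\<^sub>v (C *\<^sub>v w))"
      unfolding u using BC wc by (intro eq_vecI) auto
    moreover have "B *\<^sub>v (C *\<^sub>v w) \<in> W" using BC wc by (intro BC(4)) auto
    ultimately have uW: "u \<in> W" using W w by (auto simp: linear_subspace_def)
    have Cu: "C *\<^sub>v u = 0\<^sub>v k"
      using CD BC(1,2) D wc zero_mat_mult_vec[of w d k]
      by (simp add: u_def assoc_mult_mat_vec[symmetric, of C k d D d])
    have Du: "D *\<^sub>v u = u"
    proof -
      have "(B * C) *\<^sub>v u = 0\<^sub>v d"
        using BC(1,2) uc Cu by (simp add: assoc_mult_mat_vec[of B d k C d] mat_mult_zero_vec)
      then show ?thesis
        using BC(1,2) uc by (simp add: D_def minus_mult_distrib_mat_vec[of _ d d])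
    qed
    have "u \<noteq> 0\<^sub>v d"
    proof
      assume "u = 0\<^sub>v d"
      then have "w = (B * C) *\<^sub>v w"
        using u BC wc by (intro eq_vecI) (auto simp: vec_eq_iff)
      then show False using neq by simp
    qed
    then obtain a where a: "a < d" "u $ a \<noteq> 0"
      using uc by (metis carrier_vecD eq_vecI index_zero_vec(1) index_zero_vec(2))
    \<comment> \<open>The new row of \<open>C'\<close> is the functional that is \<open>1\<close> on \<open>u\<close> and \<open>0\<close> on the columns of \<open>B\<close>.\<close>
    define B' where "B' = mat d (Suc k) (\<lambda>(i, j). if j < k then B $$ (i, j) else u $ i)"
    define C' where "C' = mat (Suc k) d (\<lambda>(i, j). if i < k then C $$ (i, j) else D $$ (a, j) / u $ a)"
    have c: "B' \<in> carrier_mat d (Suc k)" "C' \<in> carrier_mat (Suc k) d" by (auto simp: B'_def C'_def)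
    have "C' * B' = 1\<^sub>m (Suc k)"
    proof (rule eq_matI)
      fix i j assume ij: "i < dim_row (1\<^sub>m (Suc k))" "j < dim_col (1\<^sub>m (Suc k))"
      have *: "(C' * B') $$ (i, j) = (\<Sum>b\<in>{0..<d}. C' $$ (i, b) * B' $$ (b, j))"
        using ij c by (auto simp: scalar_prod_def)
      consider "i < k" "j < k" | "i < k" "j = k" | "i = k" "j < k" | "i = k" "j = k"
        using ij by fastforce
      then show "(C' * B') $$ (i, j) = 1\<^sub>m (Suc k) $$ (i, j)"
      proof cases
        case 1
        then have "(C' * B') $$ (i, j) = (C * B) $$ (i, j)"
          unfolding * using BC(1,2) by (auto simp: scalar_prod_def B'_def C'_def)
        then show ?thesis using 1 BC(3) by simp
      next
        case 2
        then have "(C' * B') $$ (i, j) = (C *\<^sub>v u) $ i"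
          unfolding * using BC(1,2) uc by (auto simp: scalar_prod_def B'_def C'_def)
        then show ?thesis using 2 Cu by simp
      next
        case 3
        then have "(C' * B') $$ (i, j) = (D * B) $$ (a, j) / u $ a"
          unfolding * using BC(1,2) D a by (auto simp: scalar_prod_def B'_def C'_def sum_divide_distrib)
        then show ?thesis using 3 DB a by simp
      next
        case 4
        then have "(C' * B') $$ (i, j) = (D *\<^sub>v u) $ a / u $ a"
          unfolding * using D a uc by (auto simp: scalar_prod_def B'_def C'_def sum_divide_distrib)
        then show ?thesis using 4 Du a by simp
      qed
    qed (use c in auto)
    moreover have "B' *\<^sub>v v \<in> W" if v: "v \<in> carrier_vec (Suc k)" for v
    proof -
      have "B' *\<^sub>v v = B *\<^sub>v vec k (\<lambda>i. v $ i) + (v $ k) \<cdot>\<^sub>v u"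
        using v BC uc c by (intro eq_vecI) (auto simp: B'_def scalar_prod_def)
      moreover have "B *\<^sub>v vec k (\<lambda>i. v $ i) \<in> W" by (intro BC(4)) auto
      ultimately show ?thesis using W uW by (auto simp: linear_subspace_def)
    qed
    ultimately have "P (Suc k)" unfolding P_def using c by blast
    then show False using k(2) by fastforce
  qed
  then show ?thesis using that BC by blast
qed

text \<open>The trace of an idempotent is its rank; this is how dimensions become accessible to character
  values.\<close>

lemma idempotent_factorization:
  fixes Q :: "'a::field mat"
  assumes Q: "Q \<in> carrier_mat d d" and QQ: "Q * Q = Q"
  obtains k B C where "B \<in> carrier_mat d k" "C \<in> carrier_mat k d" "C * B = 1\<^sub>m k" "B * C = Q"
    "mat_trace Q = of_nat k" "k \<le> d"
proof -
  define W where "W = (\<lambda>v. Q *\<^sub>v v) ` carrier_vec d"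
  have W: "linear_subspace d W"
    unfolding linear_subspace_def
  proof (intro conjI ballI allI)
    show "0\<^sub>v d \<in> W"
      unfolding W_def using Q by (intro image_eqI[of _ _ "0\<^sub>v d"]) (auto simp: mat_mult_zero_vec)
    show "v + w \<in> W" if "v \<in> W" "w \<in> W" for v w
    proof -
      obtain v' w' where "v' \<in> carrier_vec d" "w' \<in> carrier_vec d" "v = Q *\<^sub>v v'" "w = Q *\<^sub>v w'"
        using \<open>v \<in> W\<close> \<open>w \<in> W\<close> unfolding W_def by blast
      then show ?thesis
        unfolding W_def using Q
        by (intro image_eqI[of _ _ "v' + w'"]) (auto simp: mult_add_distrib_mat_vec)
    qed
    show "c \<cdot>\<^sub>v v \<in> W" if "v \<in> W" for c v
    proof -
      obtain v' where "v' \<in> carrier_vec d" "v = Q *\<^sub>v v'"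
        using \<open>v \<in> W\<close> unfolding W_def by blast
      then show ?thesis
        unfolding W_def using Q by (intro image_eqI[of _ _ "c \<cdot>\<^sub>v v'"]) (auto simp: mult_mat_vec)
    qed
  qed (use Q in \<open>auto simp: W_def\<close>)
  obtain k B C where BC: "B \<in> carrier_mat d k" "C \<in> carrier_mat k d" "C * B = 1\<^sub>m k"
    "\<And>v. v \<in> carrier_vec k \<Longrightarrow> B *\<^sub>v v \<in> W" "\<And>w. w \<in> W \<Longrightarrow> (B * C) *\<^sub>v w = w"
    using linear_subspace_factorization[OF W] by metis
  have QW: "Q *\<^sub>v w = w" if "w \<in> W" for w
  proof -
    obtain v where v: "v \<in> carrier_vec d" "w = Q *\<^sub>v v" using \<open>w \<in> W\<close> unfolding W_def by blast
    then show ?thesis using assoc_mult_mat_vec[OF Q Q v(1), unfolded QQ] by metis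
  qed
  have QB: "Q * B = B"
  proof (rule eq_matI_mult_vec[of _ d k])
    show "Q * B *\<^sub>v v = B *\<^sub>v v" if "v \<in> carrier_vec k" for v
      using that assoc_mult_mat_vec[OF Q BC(1)] QW[OF BC(4)] by simp
  qed (use Q BC in auto)
  have BCQ: "B * C * Q = Q"
  proof (rule eq_matI_mult_vec[of _ d d])
    show "B * C * Q *\<^sub>v v = Q *\<^sub>v v" if "v \<in> carrier_vec d" for v
    proof -
      have "B * C * Q *\<^sub>v v = B * C *\<^sub>v (Q *\<^sub>v v)"
        using that Q BC(1,2) by (intro assoc_mult_mat_vec) auto
      then show ?thesis using BC(5)[of "Q *\<^sub>v v"] that unfolding W_def by force
    qed
  qed (use Q BC in auto)
  show ?thesis
  proof (rule that)
    show B: "B \<in> carrier_mat d k" by fact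
    show C: "C * Q \<in> carrier_mat k d" using BC Q by auto
    show CB: "C * Q * B = 1\<^sub>m k" using assoc_mult_mat[OF BC(2) Q BC(1)] BC(3) QB by metis
    show BC': "B * (C * Q) = Q" using assoc_mult_mat[OF BC(1,2) Q] BCQ by metis
    show "mat_trace Q = of_nat k"
      using mat_trace_mult_comm[OF B C] CB BC' mat_trace_one by metis
    show "k \<le> d" using right_inverse_dim_le[OF B C CB] .
  qed
qed

lemma idempotent_trace_zero:
  fixes Q :: "complex mat"
  assumes Q: "Q \<in> carrier_mat d d" and QQ: "Q * Q = Q" and tr: "mat_trace Q = 0"
  shows "Q = 0\<^sub>m d d"
proof -
  obtain k B C where *: "B \<in> carrier_mat d k" "C \<in> carrier_mat k d" "C * B = 1\<^sub>m k" "B * C = Q"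
    "mat_trace Q = of_nat k" "k \<le> d" by (rule idempotent_factorization[OF Q QQ])
  then have "k = 0" using tr by simp
  then show ?thesis
    unfolding *(4)[symmetric] using *(1,2) by (intro eq_matI) (auto simp: scalar_prod_def)
qed

lemma idempotent_complement:
  fixes Q :: "'a::field mat"
  assumes Q: "Q \<in> carrier_mat d d" and QQ: "Q * Q = Q"
  shows "(1\<^sub>m d - Q) * (1\<^sub>m d - Q) = 1\<^sub>m d - Q"
proof -
  have c: "1\<^sub>m d - Q \<in> carrier_mat d d" using minus_carrier_mat[OF Q] .
  have "(1\<^sub>m d - Q) * (1\<^sub>m d - Q) = (1\<^sub>m d - Q) * 1\<^sub>m d - (1\<^sub>m d - Q) * Q"
    using mult_minus_distrib_mat[OF c one_carrier_mat Q] .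
  also have "(1\<^sub>m d - Q) * 1\<^sub>m d = 1\<^sub>m d - Q"
    using right_mult_one_mat[OF c] .
  also have "(1\<^sub>m d - Q) * Q = 0\<^sub>m d d"
    unfolding minus_mult_distrib_mat[OF one_carrier_mat Q Q] QQ left_mult_one_mat[OF Q]
    using Q by (intro eq_matI) auto
  also have "1\<^sub>m d - Q - 0\<^sub>m d d = 1\<^sub>m d - Q"
    using Q by (intro eq_matI) auto
  finally show ?thesis .
qed

lemma idempotent_full_trace:
  fixes Q :: "complex mat"
  assumes Q: "Q \<in> carrier_mat d d" and QQ: "Q * Q = Q" and tr: "mat_trace Q = of_nat d"
  shows "Q = 1\<^sub>m d"
proof -
  have "mat_trace (1\<^sub>m d - Q) = 0"
    using Q tr by (simp add: mat_trace_minus[of _ d] mat_trace_one)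
  then have eq: "1\<^sub>m d - Q = 0\<^sub>m d d"
    using idempotent_complement[OF Q QQ] Q by (intro idempotent_trace_zero) auto
  have "Q = 1\<^sub>m d - (1\<^sub>m d - Q)"
    using Q by (intro eq_matI) auto
  moreover have "1\<^sub>m d - 0\<^sub>m d d = (1\<^sub>m d :: complex mat)" by (intro eq_matI) auto
  ultimately show ?thesis unfolding eq by (rule trans)
qed

section \<open>Schur's lemma and orthogonality\<close>

text \<open>Sums of matrices of a fixed format; matrices of all formats share one type, which therefore has no
  zero for \<open>sum\<close> to start from.\<close>

definition msum :: "nat \<Rightarrow> nat \<Rightarrow> ('b \<Rightarrow> 'a::comm_monoid_add mat) \<Rightarrow> 'b set \<Rightarrow> 'a mat" where
  "msum m n f S = mat m n (\<lambda>ij. \<Sum>s\<in>S. f s $$ ij)"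

lemma msum_carrier [simp]: "msum m n f S \<in> carrier_mat m n"
  by (simp add: msum_def)

lemma msum_cong: "(\<And>s. s \<in> S \<Longrightarrow> f s = g s) \<Longrightarrow> msum m n f S = msum m n g S"
  unfolding msum_def by (intro cong_mat) (auto intro!: sum.cong)

lemma mult_msum:
  fixes A :: "'a::comm_semiring_0 mat"
  assumes "A \<in> carrier_mat k m" "\<And>s. s \<in> S \<Longrightarrow> f s \<in> carrier_mat m n"
  shows "A * msum m n f S = msum k n (\<lambda>s. A * f s) S"
proof (rule eq_matI)
  fix i j assume "i < dim_row (msum k n (\<lambda>s. A * f s) S)" "j < dim_col (msum k n (\<lambda>s. A * f s) S)"
  then have ij: "i < k" "j < n" by (auto simp: msum_def)
  have "(A * msum m n f S) $$ (i, j) = (\<Sum>a\<in>{0..<m}. \<Sum>s\<in>S. A $$ (i, a) * f s $$ (a, j))"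
    using ij assms(1) by (auto simp: msum_def scalar_prod_def sum_distrib_left)
  also have "\<dots> = (\<Sum>s\<in>S. \<Sum>a\<in>{0..<m}. A $$ (i, a) * f s $$ (a, j))"
    by (rule sum.swap)
  also have "\<dots> = (\<Sum>s\<in>S. (A * f s) $$ (i, j))"
  proof (rule sum.cong)
    fix s assume "s \<in> S"
    then have "f s \<in> carrier_mat m n" by (rule assms(2))
    then show "(\<Sum>a\<in>{0..<m}. A $$ (i, a) * f s $$ (a, j)) = (A * f s) $$ (i, j)"
      using ij assms(1) by (auto simp: scalar_prod_def)
  qed simp
  finally show "(A * msum m n f S) $$ (i, j) = msum k n (\<lambda>s. A * f s) S $$ (i, j)"
    using ij by (simp add: msum_def)
qed (use assms in \<open>auto simp: msum_def\<close>)

lemma msum_mult: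
  fixes A :: "'a::comm_semiring_0 mat"
  assumes "A \<in> carrier_mat n k" "\<And>s. s \<in> S \<Longrightarrow> f s \<in> carrier_mat m n"
  shows "msum m n f S * A = msum m k (\<lambda>s. f s * A) S"
proof (rule eq_matI)
  fix i j assume "i < dim_row (msum m k (\<lambda>s. f s * A) S)" "j < dim_col (msum m k (\<lambda>s. f s * A) S)"
  then have ij: "i < m" "j < k" by (auto simp: msum_def)
  have "(msum m n f S * A) $$ (i, j) = (\<Sum>a\<in>{0..<n}. \<Sum>s\<in>S. f s $$ (i, a) * A $$ (a, j))"
    using ij assms(1) by (auto simp: msum_def scalar_prod_def sum_distrib_right)
  also have "\<dots> = (\<Sum>s\<in>S. \<Sum>a\<in>{0..<n}. f s $$ (i, a) * A $$ (a, j))"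
    by (rule sum.swap)
  also have "\<dots> = (\<Sum>s\<in>S. (f s * A) $$ (i, j))"
  proof (rule sum.cong)
    fix s assume "s \<in> S"
    then have "f s \<in> carrier_mat m n" by (rule assms(2))
    then show "(\<Sum>a\<in>{0..<n}. f s $$ (i, a) * A $$ (a, j)) = (f s * A) $$ (i, j)"
      using ij assms(1) by (auto simp: scalar_prod_def)
  qed simp
  finally show "(msum m n f S * A) $$ (i, j) = msum m k (\<lambda>s. f s * A) S $$ (i, j)"
    using ij by (simp add: msum_def)
qed (use assms in \<open>auto simp: msum_def\<close>)

lemma mat_trace_msum:
  fixes f :: "'b \<Rightarrow> 'a::comm_semiring_0 mat"
  assumes "\<And>s. s \<in> S \<Longrightarrow> f s \<in> carrier_mat d d"
  shows "mat_trace (msum d d f S) = (\<Sum>s\<in>S. mat_trace (f s))"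
proof -
  have "mat_trace (msum d d f S) = (\<Sum>i<d. \<Sum>s\<in>S. f s $$ (i, i))"
    by (simp add: mat_trace_def msum_def)
  also have "\<dots> = (\<Sum>s\<in>S. \<Sum>i<d. f s $$ (i, i))" by (rule sum.swap)
  also have "\<dots> = (\<Sum>s\<in>S. mat_trace (f s))"
    using assms by (auto simp: mat_trace_def intro!: sum.cong)
  finally show ?thesis .
qed

lemma msum_reindex:
  assumes "bij_betw h T S"
  shows "msum m n f S = msum m n (\<lambda>t. f (h t)) T"
  unfolding msum_def by (intro cong_mat) (auto simp: sum.reindex_bij_betw[OF assms, symmetric])

definition representation :: "('g, 'b) monoid_scheme \<Rightarrow> nat \<Rightarrow> ('g \<Rightarrow> complex mat) \<Rightarrow> bool" where
  "representation H d \<rho> \<longleftrightarrow> (\<forall>g\<in>carrier H. \<rho> g \<in> carrier_mat d d) \<and>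
     (\<forall>g\<in>carrier H. \<forall>h\<in>carrier H. \<rho> (g \<otimes>\<^bsub>H\<^esub> h) = \<rho> g * \<rho> h) \<and> \<rho> \<one>\<^bsub>H\<^esub> = 1\<^sub>m d"

lemma representationD:
  assumes "representation H d \<rho>"
  shows "g \<in> carrier H \<Longrightarrow> \<rho> g \<in> carrier_mat d d"
    and "g \<in> carrier H \<Longrightarrow> h \<in> carrier H \<Longrightarrow> \<rho> (g \<otimes>\<^bsub>H\<^esub> h) = \<rho> g * \<rho> h"
    and "\<rho> \<one>\<^bsub>H\<^esub> = 1\<^sub>m d"
  using assms by (auto simp: representation_def)

lemma representation_inv:
  assumes "representation H d \<rho>" "group H" "g \<in> carrier H"
  shows "\<rho> (inv\<^bsub>H\<^esub> g) * \<rho> g = 1\<^sub>m d" "\<rho> g * \<rho> (inv\<^bsub>H\<^esub> g) = 1\<^sub>m d"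
proof -
  interpret group H by fact
  show "\<rho> (inv\<^bsub>H\<^esub> g) * \<rho> g = 1\<^sub>m d"
    using representationD(2)[OF assms(1), of "inv\<^bsub>H\<^esub> g" g] representationD(3)[OF assms(1)] assms(3) by simp
  show "\<rho> g * \<rho> (inv\<^bsub>H\<^esub> g) = 1\<^sub>m d"
    using representationD(2)[OF assms(1), of g "inv\<^bsub>H\<^esub> g"] representationD(3)[OF assms(1)] assms(3) by simp
qed

lemma group_GL: "group (GL TYPE('a::field) d)"
proof -
  interpret ring "ring_mat TYPE('a) d ()" by (rule ring_mat)
  show ?thesis unfolding GL_def by (rule units_group)
qed

lemma GL_simps:
  "carrier (GL TYPE('a::field) d) =
     {A \<in> carrier_mat d d. \<exists>B\<in>carrier_mat d d. B * A = 1\<^sub>m d \<and> A * B = 1\<^sub>m d}"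
  "A \<otimes>\<^bsub>GL TYPE('a) d\<^esub> B = A * B"
  "\<one>\<^bsub>GL TYPE('a) d\<^esub> = 1\<^sub>m d"
  by (auto simp: GL_def units_of_def Units_def ring_mat_def)

lemma representation_iff_hom:
  assumes "group H"
  shows "\<rho> \<in> hom H (GL TYPE(complex) d) \<longleftrightarrow> representation H d \<rho>"
proof
  assume h: "\<rho> \<in> hom H (GL TYPE(complex) d)"
  then show "representation H d \<rho>"
    using hom_one[OF h assms group_GL] unfolding representation_def hom_def
    by (auto simp: GL_simps)
next
  assume r: "representation H d \<rho>"
  interpret group H by fact
  show "\<rho> \<in> hom H (GL TYPE(complex) d)"
  proof (rule homI)
    show "\<rho> g \<in> carrier (GL TYPE(complex) d)" if "g \<in> carrier H" for g
      using representationD(1)[OF r that] representationD(1)[OF r inv_closed[OF that]]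
        representation_inv[OF r assms that] by (auto simp: GL_simps)
  qed (use representationD[OF r] in \<open>simp add: GL_simps\<close>)
qed

definition rep_invariant :: "('g, 'b) monoid_scheme \<Rightarrow> ('g \<Rightarrow> complex mat) \<Rightarrow> complex vec set \<Rightarrow> bool" where
  "rep_invariant H \<rho> W \<longleftrightarrow> (\<forall>g\<in>carrier H. \<forall>w\<in>W. \<rho> g *\<^sub>v w \<in> W)"

lemma irreducible_rep_iff:
  assumes "group H"
  shows "irreducible_rep H d \<rho> \<longleftrightarrow> representation H d \<rho> \<and> 0 < d \<and>
     (\<forall>W. linear_subspace d W \<longrightarrow> rep_invariant H \<rho> W \<longrightarrow> W = {0\<^sub>v d} \<or> W = carrier_vec d)"
  unfolding irreducible_rep_def representation_iff_hom[OF assms] rep_invariant_def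
    subspace_iff_linear_subspace ..

locale fin_group = group H for H (structure) +
  assumes fin: "finite (carrier H)"
begin

lemma order_pos: "0 < Coset.order H"
  using fin by (simp add: order_gt_0_iff_finite)

lemma irreducible_repD:
  assumes "irreducible_rep H d \<rho>"
  shows "representation H d \<rho>" "0 < d"
    "linear_subspace d W \<Longrightarrow> rep_invariant H \<rho> W \<Longrightarrow> W = {0\<^sub>v d} \<or> W = carrier_vec d"
  using assms unfolding irreducible_rep_iff[OF group_axioms] by auto

lemma IrrE:
  assumes "\<chi> \<in> Irr H"
  obtains d \<rho> where "irreducible_rep H d \<rho>" "\<And>g. g \<in> carrier H \<Longrightarrow> \<chi> g = mat_trace (\<rho> g)"
    "\<chi> \<one> = of_nat d" "0 < d"
proof -
  obtain d \<rho> where *: "irreducible_rep H d \<rho>" "\<chi> = restrict (\<lambda>g. mat_trace (\<rho> g)) (carrier H)"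
    using assms unfolding Irr_def by blast
  have "\<chi> \<one> = of_nat d"
    using representationD(3)[OF irreducible_repD(1)[OF *(1)]] * by (simp add: mat_trace_one)
  then show ?thesis using that[OF *(1)] * irreducible_repD(2)[OF *(1)] by auto
qed

lemma Irr_eqI:
  assumes "\<chi> \<in> Irr H" "\<psi> \<in> Irr H" "\<And>g. g \<in> carrier H \<Longrightarrow> \<chi> g = \<psi> g"
  shows "\<chi> = \<psi>"
proof -
  have "\<chi> \<in> extensional (carrier H)" "\<psi> \<in> extensional (carrier H)"
    using assms(1,2) unfolding Irr_def by auto
  then show ?thesis using assms(3) by (rule extensionalityI)
qed

text \<open>Schur's lemma: kernel and image of a nonzero intertwiner \<open>B\<close> are invariant, so \<open>B\<close> is bijective and
  the two representations are similar. Only the equality of the characters is kept.\<close>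

lemma schur_nonzero_intertwiner:
  assumes \<rho>: "irreducible_rep H d \<rho>" and \<sigma>: "irreducible_rep H e \<sigma>"
    and B: "B \<in> carrier_mat d e" "B \<noteq> 0\<^sub>m d e"
    and comm: "\<And>g. g \<in> carrier H \<Longrightarrow> \<rho> g * B = B * \<sigma> g"
    and g: "g \<in> carrier H"
  shows "mat_trace (\<rho> g) = mat_trace (\<sigma> g)"
proof -
  note \<rho>r = irreducible_repD(1)[OF \<rho>] and \<sigma>r = irreducible_repD(1)[OF \<sigma>]
  have comm_vec: "\<rho> h *\<^sub>v (B *\<^sub>v v) = B *\<^sub>v (\<sigma> h *\<^sub>v v)" if "h \<in> carrier H" "v \<in> carrier_vec e" for h v
    using assoc_mult_mat_vec[OF representationD(1)[OF \<rho>r that(1)] B(1) that(2)]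
      assoc_mult_mat_vec[OF B(1) representationD(1)[OF \<sigma>r that(1)] that(2)] comm[OF that(1)] by metis
  define K where "K = {v \<in> carrier_vec e. B *\<^sub>v v = 0\<^sub>v d}"
  have "linear_subspace e K"
    unfolding linear_subspace_def K_def using B(1)
    by (auto simp: mat_mult_zero_vec mult_add_distrib_mat_vec mult_mat_vec)
  moreover have "rep_invariant H \<sigma> K"
    unfolding rep_invariant_def K_def
  proof clarsimp
    fix h v assume h: "h \<in> carrier H" and v: "v \<in> carrier_vec e" "B *\<^sub>v v = 0\<^sub>v d"
    then show "\<sigma> h *\<^sub>v v \<in> carrier_vec e \<and> B *\<^sub>v (\<sigma> h *\<^sub>v v) = 0\<^sub>v d"
      using comm_vec[OF h v(1)] representationD(1)[OF \<sigma>r h] representationD(1)[OF \<rho>r h]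
        mat_mult_zero_vec[OF representationD(1)[OF \<rho>r h]] by auto
  qed
  ultimately consider "K = {0\<^sub>v e}" | "K = carrier_vec e"
    using irreducible_repD(3)[OF \<sigma>] by blast
  then have K: "K = {0\<^sub>v e}"
  proof cases
    case 2
    have "B = 0\<^sub>m d e"
    proof (rule eq_matI_mult_vec[OF B(1)])
      show "B *\<^sub>v v = 0\<^sub>m d e *\<^sub>v v" if "v \<in> carrier_vec e" for v
        using 2 that unfolding K_def by (auto simp: zero_mat_mult_vec[OF that])
    qed auto
    then show ?thesis using B by simp
  qed
  define I where "I = (\<lambda>v. B *\<^sub>v v) ` carrier_vec e"
  have "linear_subspace d I"
    unfolding linear_subspace_def
  proof (intro conjI ballI allI)
    show "0\<^sub>v d \<in> I"
      unfolding I_def using B(1) mat_mult_zero_vec[OF B(1)] by (intro image_eqI[of _ _ "0\<^sub>v e"]) auto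
    show "v + w \<in> I" if "v \<in> I" "w \<in> I" for v w
    proof -
      obtain v' w' where "v' \<in> carrier_vec e" "w' \<in> carrier_vec e" "v = B *\<^sub>v v'" "w = B *\<^sub>v w'"
        using \<open>v \<in> I\<close> \<open>w \<in> I\<close> unfolding I_def by blast
      then show ?thesis
        unfolding I_def using B
        by (intro image_eqI[of _ _ "v' + w'"]) (auto simp: mult_add_distrib_mat_vec)
    qed
    show "c \<cdot>\<^sub>v v \<in> I" if "v \<in> I" for c v
    proof -
      obtain v' where "v' \<in> carrier_vec e" "v = B *\<^sub>v v'"
        using \<open>v \<in> I\<close> unfolding I_def by blast
      then show ?thesis
        unfolding I_def using B by (intro image_eqI[of _ _ "c \<cdot>\<^sub>v v'"]) (auto simp: mult_mat_vec)
    qed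
  qed (use B(1) in \<open>auto simp: I_def\<close>)
  moreover have "rep_invariant H \<rho> I"
    unfolding rep_invariant_def
  proof (intro ballI)
    fix h w assume h: "h \<in> carrier H" and w: "w \<in> I"
    then obtain v where v: "v \<in> carrier_vec e" "w = B *\<^sub>v v" by (auto simp: I_def)
    then show "\<rho> h *\<^sub>v w \<in> I"
      using comm_vec[OF h v(1)] representationD(1)[OF \<sigma>r h] by (auto simp: I_def)
  qed
  ultimately consider "I = {0\<^sub>v d}" | "I = carrier_vec d"
    using irreducible_repD(3)[OF \<rho>] by blast
  then have I: "I = carrier_vec d"
  proof cases
    case 1
    have "B = 0\<^sub>m d e"
    proof (rule eq_matI_mult_vec[OF B(1)])
      show "B *\<^sub>v v = 0\<^sub>m d e *\<^sub>v v" if "v \<in> carrier_vec e" for v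
        using 1 that unfolding I_def by (auto simp: zero_mat_mult_vec[OF that])
    qed auto
    then show ?thesis using B by simp
  qed
  have "\<exists>c\<in>carrier_vec e. B *\<^sub>v c = unit_vec d j" for j
  proof -
    have "unit_vec d j \<in> I" unfolding I by simp
    then show ?thesis unfolding I_def by force
  qed
  then obtain c where c: "c j \<in> carrier_vec e" "B *\<^sub>v c j = unit_vec d j" for j by metis
  define C where "C = mat e d (\<lambda>(i, j). c j $ i)"
  have C: "C \<in> carrier_mat e d" by (simp add: C_def)
  have BC: "B * C = 1\<^sub>m d"
  proof (rule mat_col_eqI)
    fix j assume "j < dim_col (1\<^sub>m d)"
    then have j: "j < d" by simp
    have "col C j = c j" using j c(1)[of j] by (intro eq_vecI) (auto simp: C_def)
    then show "col (B * C) j = col (1\<^sub>m d) j"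
      using j c(2) by (simp add: col_mult2[OF B(1) C])
  qed (use B C in auto)
  have CB: "C * B = 1\<^sub>m e"
  proof (rule eq_matI_mult_vec)
    fix v :: "complex vec" assume v: "v \<in> carrier_vec e"
    define u where "u = C *\<^sub>v (B *\<^sub>v v)"
    have u: "u \<in> carrier_vec e"
      unfolding u_def using mult_mat_vec_carrier[OF C mult_mat_vec_carrier[OF B(1) v]] .
    have "B *\<^sub>v u = B *\<^sub>v v"
      using assoc_mult_mat_vec[OF B(1) C, of "B *\<^sub>v v"] B(1) v BC by (simp add: u_def)
    then have "B *\<^sub>v (u - v) = 0\<^sub>v d"
      using mult_minus_distrib_mat_vec[OF B(1) u v] B(1) v by simp
    then have "u - v \<in> K" using u v by (simp add: K_def)
    then have uv: "u - v = 0\<^sub>v e" using K by simp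
    have "u $ i = v $ i" if "i < e" for i
      using arg_cong[OF uv, of "\<lambda>x. x $ i"] that u v by simp
    then have "u = v" using u v by (intro eq_vecI) auto
    then show "C * B *\<^sub>v v = 1\<^sub>m e *\<^sub>v v"
      using assoc_mult_mat_vec[OF C B(1) v] v by (simp add: u_def)
  qed (use B C in auto)
  note \<rho>g = representationD(1)[OF \<rho>r g] and \<sigma>g = representationD(1)[OF \<sigma>r g]
  have "mat_trace (\<rho> g) = mat_trace (\<rho> g * (B * C))"
    unfolding BC using right_mult_one_mat[OF \<rho>g] by simp
  also have "\<rho> g * (B * C) = B * (\<sigma> g * C)"
    using assoc_mult_mat[OF \<rho>g B(1) C] assoc_mult_mat[OF B(1) \<sigma>g C] comm[OF g] by metis
  also have "mat_trace \<dots> = mat_trace ((\<sigma> g * C) * B)"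
    using \<sigma>g C B(1) by (intro mat_trace_mult_comm) auto
  also have "(\<sigma> g * C) * B = \<sigma> g"
    using assoc_mult_mat[OF \<sigma>g C B(1)] CB right_mult_one_mat[OF \<sigma>g] by metis
  finally show ?thesis .
qed

text \<open>An endomorphism \<open>B\<close> has an eigenvalue \<open>c\<close>, and the eigenspace is invariant and nonzero, hence everything.\<close>

lemma schur_scalar:
  assumes \<rho>: "irreducible_rep H d \<rho>" and B: "B \<in> carrier_mat d d"
    and comm: "\<And>g. g \<in> carrier H \<Longrightarrow> \<rho> g * B = B * \<rho> g"
  obtains c where "B = c \<cdot>\<^sub>m 1\<^sub>m d"
proof -
  note \<rho>r = irreducible_repD(1)[OF \<rho>]
  obtain c where "eigenvalue B c"
    using spectrum_non_empty[OF B irreducible_repD(2)[OF \<rho>]] unfolding spectrum_def by auto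
  then obtain v0 where v0: "v0 \<in> carrier_vec d" "v0 \<noteq> 0\<^sub>v d" "B *\<^sub>v v0 = c \<cdot>\<^sub>v v0"
    using B unfolding eigenvalue_def eigenvector_def by auto
  define W where "W = {v \<in> carrier_vec d. B *\<^sub>v v = c \<cdot>\<^sub>v v}"
  have "linear_subspace d W"
    unfolding linear_subspace_def W_def
  proof (intro conjI ballI allI)
    have "c \<cdot>\<^sub>v 0\<^sub>v d = 0\<^sub>v d" by (intro eq_vecI) auto
    then show "0\<^sub>v d \<in> {v \<in> carrier_vec d. B *\<^sub>v v = c \<cdot>\<^sub>v v}"
      using mat_mult_zero_vec[OF B] by simp
    show "v + w \<in> {v \<in> carrier_vec d. B *\<^sub>v v = c \<cdot>\<^sub>v v}"
      if "v \<in> {v \<in> carrier_vec d. B *\<^sub>v v = c \<cdot>\<^sub>v v}" "w \<in> {v \<in> carrier_vec d. B *\<^sub>v v = c \<cdot>\<^sub>v v}" for v w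
      using that B smult_add_distrib_vec[of v d w c] by (simp add: mult_add_distrib_mat_vec)
    show "a \<cdot>\<^sub>v v \<in> {v \<in> carrier_vec d. B *\<^sub>v v = c \<cdot>\<^sub>v v}"
      if "v \<in> {v \<in> carrier_vec d. B *\<^sub>v v = c \<cdot>\<^sub>v v}" for a v
      using that mult_mat_vec[OF B, of v a] by (simp add: smult_smult_assoc mult.commute)
  qed auto
  moreover have "rep_invariant H \<rho> W"
    unfolding rep_invariant_def W_def
  proof (intro ballI; clarsimp)
    fix h v assume h: "h \<in> carrier H" and v: "v \<in> carrier_vec d" "B *\<^sub>v v = c \<cdot>\<^sub>v v"
    note \<rho>h = representationD(1)[OF \<rho>r h]
    have "B *\<^sub>v (\<rho> h *\<^sub>v v) = \<rho> h *\<^sub>v (B *\<^sub>v v)"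
      using assoc_mult_mat_vec[OF B \<rho>h v(1)] assoc_mult_mat_vec[OF \<rho>h B v(1)] comm[OF h] by metis
    also have "\<dots> = c \<cdot>\<^sub>v (\<rho> h *\<^sub>v v)" using v mult_mat_vec[OF \<rho>h v(1)] by simp
    finally show "\<rho> h *\<^sub>v v \<in> carrier_vec d \<and> B *\<^sub>v (\<rho> h *\<^sub>v v) = c \<cdot>\<^sub>v (\<rho> h *\<^sub>v v)"
      using mult_mat_vec_carrier[OF \<rho>h v(1)] by simp
  qed
  ultimately have "W = carrier_vec d"
    using irreducible_repD(3)[OF \<rho>, of W] v0 unfolding W_def by blast
  have "B = c \<cdot>\<^sub>m 1\<^sub>m d"
  proof (rule eq_matI_mult_vec[OF B])
    show "B *\<^sub>v v = c \<cdot>\<^sub>m 1\<^sub>m d *\<^sub>v v" if v: "v \<in> carrier_vec d" for v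
    proof -
      have "B *\<^sub>v v = c \<cdot>\<^sub>v v" using v \<open>W = carrier_vec d\<close> unfolding W_def by blast
      also have "\<dots> = c \<cdot>\<^sub>m 1\<^sub>m d *\<^sub>v v"
        using v by (intro eq_vecI) (auto simp: scalar_prod_def if_distrib if_distribR sum.delta cong: if_cong)
      finally show ?thesis .
    qed
  qed simp
  then show ?thesis by (rule that)
qed

end

context fin_group
begin

lemma bij_betw_mult_left: "g \<in> carrier H \<Longrightarrow> bij_betw (\<lambda>h. g \<otimes> h) (carrier H) (carrier H)"
  by (rule bij_betw_byWitness[of _ "\<lambda>h. inv g \<otimes> h"]) (auto simp: m_assoc[symmetric])

lemma bij_betw_mult_right: "g \<in> carrier H \<Longrightarrow> bij_betw (\<lambda>h. h \<otimes> g) (carrier H) (carrier H)"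
  by (rule bij_betw_byWitness[of _ "\<lambda>h. h \<otimes> inv g"]) (auto simp: m_assoc)

lemma bij_betw_inv: "bij_betw (\<lambda>h. inv h) (carrier H) (carrier H)"
  by (rule bij_betw_byWitness[of _ "\<lambda>h. inv h"]) auto

text \<open>Averaging turns any matrix into an intertwiner. Applied to matrix units, this converts Schur's lemma
  into relations between the matrix coefficients of irreducible representations.\<close>

lemma average_intertwines:
  assumes \<rho>: "representation H d \<rho>" and \<sigma>: "representation H e \<sigma>"
    and A: "A \<in> carrier_mat d e" and g: "g \<in> carrier H"
  defines "B \<equiv> msum d e (\<lambda>h. \<rho> h * A * \<sigma> (inv h)) (carrier H)"
  shows "\<rho> g * B = B * \<sigma> g"
proof -
  note \<rho>g = representationD(1)[OF \<rho> g] and \<sigma>g = representationD(1)[OF \<sigma> g]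
  have c: "\<rho> h * A * \<sigma> (inv h) \<in> carrier_mat d e" if "h \<in> carrier H" for h
    using representationD(1)[OF \<rho> that] representationD(1)[OF \<sigma> inv_closed[OF that]] A by auto
  have "B * \<sigma> g = msum d e (\<lambda>h. \<rho> h * A * \<sigma> (inv h) * \<sigma> g) (carrier H)"
    unfolding B_def by (rule msum_mult[OF \<sigma>g c])
  also have "\<dots> = msum d e (\<lambda>h. \<rho> (g \<otimes> h) * A * \<sigma> (inv (g \<otimes> h)) * \<sigma> g) (carrier H)"
    by (rule msum_reindex[OF bij_betw_mult_left[OF g]])
  also have "\<dots> = msum d e (\<lambda>h. \<rho> g * (\<rho> h * A * \<sigma> (inv h))) (carrier H)"
  proof (rule msum_cong)
    fix h assume h: "h \<in> carrier H"
    note \<rho>h = representationD(1)[OF \<rho> h] and \<sigma>h = representationD(1)[OF \<sigma> inv_closed[OF h]]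
    have "\<sigma> (inv (g \<otimes> h)) * \<sigma> g = \<sigma> (inv h)"
      using representationD(2)[OF \<sigma>, of "inv (g \<otimes> h)" g] g h
      by (simp add: inv_mult_group m_assoc)
    moreover have "\<rho> (g \<otimes> h) * A * \<sigma> (inv (g \<otimes> h)) * \<sigma> g = \<rho> (g \<otimes> h) * A * (\<sigma> (inv (g \<otimes> h)) * \<sigma> g)"
      using representationD(1)[OF \<rho>, of "g \<otimes> h"] representationD(1)[OF \<sigma>, of "inv (g \<otimes> h)"] A g h \<sigma>g
      by (intro assoc_mult_mat[of _ d e _ e]) auto
    moreover have "\<rho> (g \<otimes> h) * A * \<sigma> (inv h) = \<rho> g * (\<rho> h * A * \<sigma> (inv h))"
      using representationD(2)[OF \<rho> g h] assoc_mult_mat[OF \<rho>g \<rho>h A]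
        assoc_mult_mat[OF \<rho>g mult_carrier_mat[OF \<rho>h A] \<sigma>h] by metis
    ultimately show "\<rho> (g \<otimes> h) * A * \<sigma> (inv (g \<otimes> h)) * \<sigma> g = \<rho> g * (\<rho> h * A * \<sigma> (inv h))"
      by metis
  qed
  also have "\<dots> = \<rho> g * B"
    unfolding B_def by (rule mult_msum[OF \<rho>g c, symmetric])
  finally show ?thesis ..
qed

lemma average_scalar:
  assumes \<rho>: "irreducible_rep H d \<rho>" and A: "A \<in> carrier_mat d d"
  shows "msum d d (\<lambda>h. \<rho> h * A * \<rho> (inv h)) (carrier H) =
    (of_nat (Coset.order H) / of_nat d * mat_trace A) \<cdot>\<^sub>m 1\<^sub>m d"
proof -
  note \<rho>r = irreducible_repD(1)[OF \<rho>]
  define B where "B = msum d d (\<lambda>h. \<rho> h * A * \<rho> (inv h)) (carrier H)"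
  obtain c where c: "B = c \<cdot>\<^sub>m 1\<^sub>m d"
    using schur_scalar[OF \<rho>, of B] average_intertwines[OF \<rho>r \<rho>r A] unfolding B_def by auto
  have "mat_trace (\<rho> h * A * \<rho> (inv h)) = mat_trace A" if h: "h \<in> carrier H" for h
  proof -
    note \<rho>h = representationD(1)[OF \<rho>r h] and \<rho>i = representationD(1)[OF \<rho>r inv_closed[OF h]]
    have "mat_trace (\<rho> h * A * \<rho> (inv h)) = mat_trace (\<rho> (inv h) * (\<rho> h * A))"
      using \<rho>h \<rho>i A by (intro mat_trace_mult_comm) auto
    also have "\<rho> (inv h) * (\<rho> h * A) = A"
      using assoc_mult_mat[OF \<rho>i \<rho>h A] representation_inv(1)[OF \<rho>r group_axioms h] left_mult_one_mat[OF A]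
      by metis
    finally show ?thesis .
  qed
  moreover have "mat_trace B = (\<Sum>h\<in>carrier H. mat_trace (\<rho> h * A * \<rho> (inv h)))"
    unfolding B_def using representationD(1)[OF \<rho>r] A
    by (intro mat_trace_msum) (meson inv_closed mult_carrier_mat)
  ultimately have "mat_trace B = of_nat (Coset.order H) * mat_trace A"
    by (simp add: Coset.order_def)
  moreover have "mat_trace B = c * of_nat d"
    unfolding c by (simp add: mat_trace_smult[of _ d] mat_trace_one)
  ultimately have "c = of_nat (Coset.order H) / of_nat d * mat_trace A"
    using irreducible_repD(2)[OF \<rho>] by (simp add: field_simps)
  then show ?thesis using c unfolding B_def by simp
qed

definition matrix_unit :: "nat \<Rightarrow> nat \<Rightarrow> nat \<Rightarrow> nat \<Rightarrow> complex mat" where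
  "matrix_unit d e i j = mat d e (\<lambda>(x, y). if x = i \<and> y = j then 1 else 0)"

lemma matrix_unit_carrier [simp]: "matrix_unit d e i j \<in> carrier_mat d e"
  by (simp add: matrix_unit_def)

lemma mult_matrix_unit_mult:
  assumes X: "X \<in> carrier_mat d d" and Y: "Y \<in> carrier_mat e e"
    and "a < d" "i < d" "j < e" "b < e"
  shows "(X * matrix_unit d e i j * Y) $$ (a, b) = X $$ (a, i) * Y $$ (j, b)"
proof -
  have *: "(X * matrix_unit d e i j) $$ (a, y) = (if y = j then X $$ (a, i) else 0)" if "y < e" for y
  proof -
    have "(X * matrix_unit d e i j) $$ (a, y) = (\<Sum>x\<in>{0..<d}. X $$ (a, x) * matrix_unit d e i j $$ (x, y))"
      using mat_mult_entry[OF X matrix_unit_carrier \<open>a < d\<close> that] .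
    also have "\<dots> = (\<Sum>x\<in>{0..<d}. if x = i then (if y = j then X $$ (a, x) else 0) else 0)"
      using that by (intro sum.cong) (auto simp: matrix_unit_def)
    finally show ?thesis using assms by simp
  qed
  have "(X * matrix_unit d e i j * Y) $$ (a, b) =
      (\<Sum>y\<in>{0..<e}. (X * matrix_unit d e i j) $$ (a, y) * Y $$ (y, b))"
    using mult_carrier_mat[OF X matrix_unit_carrier] Y \<open>a < d\<close> \<open>b < e\<close> by (rule mat_mult_entry)
  also have "\<dots> = (\<Sum>y\<in>{0..<e}. if y = j then X $$ (a, i) * Y $$ (y, b) else 0)"
    by (intro sum.cong) (auto simp: *)
  finally show ?thesis using assms by simp
qed

lemma entry_average_matrix_unit:
  assumes \<rho>: "representation H d \<rho>" and \<sigma>: "representation H e \<sigma>"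
    and "a < d" "i < d" "j < e" "b < e"
  shows "msum d e (\<lambda>h. \<rho> h * matrix_unit d e i j * \<sigma> (inv h)) (carrier H) $$ (a, b) =
    (\<Sum>h\<in>carrier H. \<rho> h $$ (a, i) * \<sigma> (inv h) $$ (j, b))"
  unfolding msum_def using assms(3-6) representationD(1)[OF \<rho>] representationD(1)[OF \<sigma>]
  by (auto simp: mult_matrix_unit_mult simp del: index_mult_mat(1) intro!: sum.cong)

lemma orthogonality_distinct:
  assumes \<rho>: "irreducible_rep H d \<rho>" and \<sigma>: "irreducible_rep H e \<sigma>"
    and ne: "g \<in> carrier H" "mat_trace (\<rho> g) \<noteq> mat_trace (\<sigma> g)"
    and ind: "a < d" "i < d" "j < e" "b < e"
  shows "(\<Sum>h\<in>carrier H. \<rho> h $$ (a, i) * \<sigma> (inv h) $$ (j, b)) = 0"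
proof -
  note \<rho>r = irreducible_repD(1)[OF \<rho>] and \<sigma>r = irreducible_repD(1)[OF \<sigma>]
  have "msum d e (\<lambda>h. \<rho> h * matrix_unit d e i j * \<sigma> (inv h)) (carrier H) = 0\<^sub>m d e"
    (is "?B = _")
  proof (rule ccontr)
    assume "?B \<noteq> 0\<^sub>m d e"
    then have "mat_trace (\<rho> g) = mat_trace (\<sigma> g)"
      using schur_nonzero_intertwiner[OF \<rho> \<sigma> msum_carrier _ average_intertwines[OF \<rho>r \<sigma>r matrix_unit_carrier] ne(1)]
      by simp
    then show False using ne(2) by simp
  qed
  then show ?thesis
    using entry_average_matrix_unit[OF \<rho>r \<sigma>r ind] ind by simp
qed

lemma orthogonality_same:
  assumes \<rho>: "irreducible_rep H d \<rho>" and ind: "a < d" "i < d" "j < d" "b < d"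
  shows "(\<Sum>h\<in>carrier H. \<rho> h $$ (a, i) * \<rho> (inv h) $$ (j, b)) =
    (if a = b \<and> i = j then of_nat (Coset.order H) / of_nat d else 0)"
proof -
  note \<rho>r = irreducible_repD(1)[OF \<rho>]
  have "mat_trace (matrix_unit d d i j) = (\<Sum>x<d. if x = i then (if i = j then 1 else 0) else 0)"
    unfolding mat_trace_def matrix_unit_def by (auto intro!: sum.cong)
  then have "mat_trace (matrix_unit d d i j) = (if i = j then 1 else 0)" using ind by simp
  then show ?thesis
    unfolding entry_average_matrix_unit[OF \<rho>r \<rho>r ind, symmetric]
    using ind by (simp add: average_scalar[OF \<rho>])
qed

lemma trace_convolution_expand:
  assumes \<rho>: "representation H d \<rho>" and \<sigma>: "representation H e \<sigma>" and x: "x \<in> carrier H"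
  shows "(\<Sum>k\<in>carrier H. mat_trace (\<sigma> (inv k)) * mat_trace (\<rho> (k \<otimes> x))) =
    (\<Sum>b<e. \<Sum>a<d. \<Sum>i<d. \<rho> x $$ (i, a) * (\<Sum>k\<in>carrier H. \<rho> k $$ (a, i) * \<sigma> (inv k) $$ (b, b)))"
proof -
  have "mat_trace (\<sigma> (inv k)) * mat_trace (\<rho> (k \<otimes> x)) =
      (\<Sum>b<e. \<Sum>a<d. \<Sum>i<d. \<rho> x $$ (i, a) * (\<rho> k $$ (a, i) * \<sigma> (inv k) $$ (b, b)))"
    if k: "k \<in> carrier H" for k
  proof -
    have "mat_trace (\<rho> (k \<otimes> x)) = (\<Sum>a<d. \<Sum>i<d. \<rho> k $$ (a, i) * \<rho> x $$ (i, a))"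
      using representationD(1)[OF \<rho> k] representationD(1)[OF \<rho> x] representationD(2)[OF \<rho> k x]
      by (auto simp: mat_trace_def scalar_prod_def atLeast0LessThan intro!: sum.cong)
    moreover have "mat_trace (\<sigma> (inv k)) = (\<Sum>b<e. \<sigma> (inv k) $$ (b, b))"
      using representationD(1)[OF \<sigma> inv_closed[OF k]] by (simp add: mat_trace_def)
    ultimately have "mat_trace (\<sigma> (inv k)) * mat_trace (\<rho> (k \<otimes> x)) =
        (\<Sum>b<e. \<sigma> (inv k) $$ (b, b) * (\<Sum>a<d. \<Sum>i<d. \<rho> k $$ (a, i) * \<rho> x $$ (i, a)))"
      by (simp only: sum_distrib_right)
    also have "\<dots> = (\<Sum>b<e. \<Sum>a<d. \<Sum>i<d. \<sigma> (inv k) $$ (b, b) * (\<rho> k $$ (a, i) * \<rho> x $$ (i, a)))"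
      by (simp only: sum_distrib_left)
    finally show ?thesis by (simp only: mult_ac)
  qed
  then have "(\<Sum>k\<in>carrier H. mat_trace (\<sigma> (inv k)) * mat_trace (\<rho> (k \<otimes> x))) =
    (\<Sum>k\<in>carrier H. \<Sum>b<e. \<Sum>a<d. \<Sum>i<d. \<rho> x $$ (i, a) * (\<rho> k $$ (a, i) * \<sigma> (inv k) $$ (b, b)))"
    by (intro sum.cong) auto
  also have "\<dots> = (\<Sum>b<e. \<Sum>a<d. \<Sum>i<d. \<Sum>k\<in>carrier H. \<rho> x $$ (i, a) * (\<rho> k $$ (a, i) * \<sigma> (inv k) $$ (b, b)))"
    by (subst sum.swap, rule sum.cong[OF refl], subst sum.swap, rule sum.cong[OF refl], subst sum.swap, rule refl)
  finally show ?thesis by (simp only: sum_distrib_left)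
qed

text \<open>The convolution form of the orthogonality relations. It contains the ordinary ones at \<open>x = \<one>\<close>, and for
  \<open>\<chi> = \<psi>\<close> it says that the central idempotent of \<open>\<chi>\<close> reproduces \<open>\<chi>\<close>.\<close>

theorem Irr_convolution:
  assumes \<chi>: "\<chi> \<in> Irr H" and \<psi>: "\<psi> \<in> Irr H" and x: "x \<in> carrier H"
  shows "(\<Sum>k\<in>carrier H. \<psi> (inv k) * \<chi> (k \<otimes> x)) =
    (if \<chi> = \<psi> then of_nat (Coset.order H) / \<psi> \<one> * \<psi> x else 0)"
proof -
  obtain e \<sigma> where \<sigma>: "irreducible_rep H e \<sigma>" "\<And>g. g \<in> carrier H \<Longrightarrow> \<psi> g = mat_trace (\<sigma> g)"
    "\<psi> \<one> = of_nat e" "0 < e" using IrrE[OF \<psi>] by metis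
  note \<sigma>r = irreducible_repD(1)[OF \<sigma>(1)]
  show ?thesis
  proof (cases "\<chi> = \<psi>")
    case True
    have "(\<Sum>k\<in>carrier H. \<psi> (inv k) * \<chi> (k \<otimes> x)) =
      (\<Sum>k\<in>carrier H. mat_trace (\<sigma> (inv k)) * mat_trace (\<sigma> (k \<otimes> x)))"
      using True \<sigma>(2) x by (intro sum.cong) auto
    also have "\<dots> = (\<Sum>b<e. \<Sum>a<e. \<Sum>i<e. \<sigma> x $$ (i, a) *
        (if a = b \<and> i = b then of_nat (Coset.order H) / of_nat e else 0))"
      unfolding trace_convolution_expand[OF \<sigma>r \<sigma>r x]
      by (intro sum.cong refl) (simp add: orthogonality_same[OF \<sigma>(1)])
    also have "\<dots> = (\<Sum>b<e. \<sigma> x $$ (b, b) * (of_nat (Coset.order H) / of_nat e))"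
    proof (intro sum.cong refl)
      fix b assume "b \<in> {..<e}"
      then have b: "b < e" by simp
      have "(\<Sum>i<e. \<sigma> x $$ (i, a) * (if a = b \<and> i = b then c else 0)) = (if a = b then \<sigma> x $$ (b, b) * c else 0)"
        for a c using b by (cases "a = b") (simp_all add: if_distrib[of "(*) _"] cong: if_cong)
      then show "(\<Sum>a<e. \<Sum>i<e. \<sigma> x $$ (i, a) *
          (if a = b \<and> i = b then of_nat (Coset.order H) / of_nat e else 0)) =
          \<sigma> x $$ (b, b) * (of_nat (Coset.order H) / of_nat e)"
        using b by simp
    qed
    also have "\<dots> = of_nat (Coset.order H) / of_nat e * mat_trace (\<sigma> x)"
      using representationD(1)[OF \<sigma>r x] by (simp add: mat_trace_def sum_distrib_left mult_ac)
    finally show ?thesis using True \<sigma> x by simp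
  next
    case False
    obtain d \<rho> where \<rho>: "irreducible_rep H d \<rho>" "\<And>g. g \<in> carrier H \<Longrightarrow> \<chi> g = mat_trace (\<rho> g)"
      using IrrE[OF \<chi>] by metis
    note \<rho>r = irreducible_repD(1)[OF \<rho>(1)]
    obtain g where g: "g \<in> carrier H" "\<chi> g \<noteq> \<psi> g" using Irr_eqI[OF \<chi> \<psi>] False by blast
    then have g': "mat_trace (\<rho> g) \<noteq> mat_trace (\<sigma> g)" using \<rho>(2) \<sigma>(2) by metis
    have "(\<Sum>k\<in>carrier H. \<psi> (inv k) * \<chi> (k \<otimes> x)) =
      (\<Sum>k\<in>carrier H. mat_trace (\<sigma> (inv k)) * mat_trace (\<rho> (k \<otimes> x)))"
      using \<rho>(2) \<sigma>(2) x by (intro sum.cong) auto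
    also have "\<dots> = 0"
      unfolding trace_convolution_expand[OF \<rho>r \<sigma>r x]
      by (intro sum.neutral ballI) (simp add: orthogonality_distinct[OF \<rho>(1) \<sigma>(1) g(1) g'])
    finally show ?thesis using False by simp
  qed
qed

lemma Irr_one_nonzero: "\<chi> \<in> Irr H \<Longrightarrow> \<chi> \<one> \<noteq> 0"
  by (metis IrrE bot_nat_0.not_eq_extremum of_nat_eq_0_iff)

corollary Irr_orthonormal:
  assumes \<chi>: "\<chi> \<in> Irr H" and \<psi>: "\<psi> \<in> Irr H"
  shows "(\<Sum>k\<in>carrier H. \<chi> k * \<psi> (inv k)) = (if \<chi> = \<psi> then of_nat (Coset.order H) else 0)"
proof -
  have "(\<Sum>k\<in>carrier H. \<chi> k * \<psi> (inv k)) = (\<Sum>k\<in>carrier H. \<psi> (inv k) * \<chi> (k \<otimes> \<one>))"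
    by (intro sum.cong) (auto simp: mult.commute)
  then show ?thesis using Irr_convolution[OF \<chi> \<psi> one_closed] Irr_one_nonzero[OF \<psi>] by simp
qed

text \<open>A conjugacy class sum acts by a scalar, since averaging \<open>\<rho> g\<close> over conjugation gives an intertwiner;
  the scalar is read off from the trace.\<close>

lemma Irr_class_sum:
  assumes \<chi>: "\<chi> \<in> Irr H" and g: "g \<in> carrier H" and y: "y \<in> carrier H"
  shows "(\<Sum>x\<in>carrier H. \<chi> (x \<otimes> g \<otimes> inv x \<otimes> y)) =
    of_nat (Coset.order H) / \<chi> \<one> * \<chi> g * \<chi> y"
proof -
  obtain d \<rho> where \<rho>: "irreducible_rep H d \<rho>" "\<And>g. g \<in> carrier H \<Longrightarrow> \<chi> g = mat_trace (\<rho> g)"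
    "\<chi> \<one> = of_nat d" using IrrE[OF \<chi>] by metis
  note \<rho>r = irreducible_repD(1)[OF \<rho>(1)]
  note \<rho>c = representationD(1)[OF \<rho>r] and \<rho>m = representationD(2)[OF \<rho>r]
  define B where "B = msum d d (\<lambda>h. \<rho> h * \<rho> g * \<rho> (inv h)) (carrier H)"
  have c: "\<rho> h * \<rho> g * \<rho> (inv h) \<in> carrier_mat d d" if "h \<in> carrier H" for h
    using \<rho>c[OF that] \<rho>c[OF g] \<rho>c[OF inv_closed[OF that]] by auto
  have "B * \<rho> y = msum d d (\<lambda>h. \<rho> h * \<rho> g * \<rho> (inv h) * \<rho> y) (carrier H)"
    unfolding B_def by (rule msum_mult[OF \<rho>c[OF y] c])
  then have "mat_trace (B * \<rho> y) = mat_trace (msum d d (\<lambda>h. \<rho> h * \<rho> g * \<rho> (inv h) * \<rho> y) (carrier H))"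
    by simp
  also have "\<dots> = (\<Sum>h\<in>carrier H. mat_trace (\<rho> h * \<rho> g * \<rho> (inv h) * \<rho> y))"
    using c \<rho>c[OF y] by (intro mat_trace_msum) (meson mult_carrier_mat)
  also have "\<dots> = (\<Sum>x\<in>carrier H. \<chi> (x \<otimes> g \<otimes> inv x \<otimes> y))"
    using g y by (intro sum.cong) (auto simp: \<rho>(2) \<rho>m)
  finally have 1: "mat_trace (B * \<rho> y) = (\<Sum>x\<in>carrier H. \<chi> (x \<otimes> g \<otimes> inv x \<otimes> y))" .
  have "B * \<rho> y = (of_nat (Coset.order H) / of_nat d * mat_trace (\<rho> g)) \<cdot>\<^sub>m \<rho> y"
    unfolding B_def average_scalar[OF \<rho>(1) \<rho>c[OF g]]
    using \<rho>c[OF y] by (simp add: mult_smult_assoc_mat[of _ d d])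
  then show ?thesis
    using 1 \<rho>c[OF y] g y by (simp add: mat_trace_smult[of _ d] \<rho>(2,3))
qed

end

section \<open>Decomposition, duality and kernels\<close>

context fin_group
begin

text \<open>A representation with a proper invariant subspace is block
  triangular, and its character is the sum of the characters of the two diagonal blocks, that is, of the
  subrepresentation \<open>\<rho>1\<close> and the quotient \<open>\<rho>2\<close>.\<close>

lemma representation_character_decomposition:
  assumes "representation H d \<rho>"
  shows "\<exists>D. set_mset D \<subseteq> Irr H \<and> (\<forall>g\<in>carrier H. mat_trace (\<rho> g) = (\<Sum>\<chi>\<in>#D. \<chi> g))"
  using assms
proof (induction d arbitrary: \<rho> rule: less_induct)
  case (less d)
  note \<rho> = less.prems
  note \<rho>c = representationD(1)[OF \<rho>] and \<rho>m = representationD(2)[OF \<rho>] and \<rho>1 = representationD(3)[OF \<rho>]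
  consider "d = 0" | "irreducible_rep H d \<rho>"
    | W where "linear_subspace d W" "rep_invariant H \<rho> W" "W \<noteq> {0\<^sub>v d}" "W \<noteq> carrier_vec d"
    using \<rho> unfolding irreducible_rep_iff[OF group_axioms] by auto
  then show ?case
  proof cases
    case 1
    then have "mat_trace (\<rho> g) = 0" if "g \<in> carrier H" for g
      using \<rho>c[OF that] by (simp add: mat_trace_def)
    then show ?thesis by (intro exI[of _ "{#}"]) auto
  next
    case 2
    then have "restrict (\<lambda>g. mat_trace (\<rho> g)) (carrier H) \<in> Irr H" unfolding Irr_def by blast
    then show ?thesis
      by (intro exI[of _ "{#restrict (\<lambda>g. mat_trace (\<rho> g)) (carrier H)#}"]) auto
  next
    case (3 W)
    obtain B k C where B: "B \<in> carrier_mat d k" and C: "C \<in> carrier_mat k d" and CB: "C * B = 1\<^sub>m k"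
      and BW: "\<And>v. v \<in> carrier_vec k \<Longrightarrow> B *\<^sub>v v \<in> W" and BCW: "\<And>w. w \<in> W \<Longrightarrow> (B * C) *\<^sub>v w = w"
      using linear_subspace_factorization[OF 3(1)] by metis
    have Wc: "w \<in> carrier_vec d" if "w \<in> W" for w using 3(1) that by (auto simp: linear_subspace_def)
    have inv: "\<rho> g *\<^sub>v w \<in> W" if "g \<in> carrier H" "w \<in> W" for g w
      using 3(2) that by (auto simp: rep_invariant_def)
    define P where "P = B * C"
    have P: "P \<in> carrier_mat d d" using B C by (simp add: P_def)
    have PP: "P * P = P"
      unfolding P_def
      using assoc_mult_mat[OF B C mult_carrier_mat[OF B C]] assoc_mult_mat[OF C B C] CB left_mult_one_mat[OF C]
      by metis
    have trP: "mat_trace P = of_nat k"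
      unfolding P_def mat_trace_mult_comm[OF B C] CB by (rule mat_trace_one)
    have P': "1\<^sub>m d - P \<in> carrier_mat d d" by (rule minus_carrier_mat[OF P])
    obtain B' k' C' where B': "B' \<in> carrier_mat d k'" and C': "C' \<in> carrier_mat k' d" and CB': "C' * B' = 1\<^sub>m k'"
      and BC': "B' * C' = 1\<^sub>m d - P" and trP': "mat_trace (1\<^sub>m d - P) = of_nat k'"
      using idempotent_factorization[OF P' idempotent_complement[OF P PP]] by metis
    have "(of_nat d :: complex) = of_nat (k + k')"
      using trP trP' mat_trace_minus[OF one_carrier_mat P] mat_trace_one[of d, where 'a = complex]
      by (simp add: diff_eq_eq add.commute)
    then have d: "d = k + k'" by (simp only: of_nat_eq_iff)
    have k: "0 < k"
    proof (rule ccontr)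
      assume "\<not> 0 < k"
      then have "P = 0\<^sub>m d d" using idempotent_trace_zero[OF P PP] trP by simp
      then have "w = 0\<^sub>v d" if "w \<in> W" for w
        using BCW[OF that] zero_mat_mult_vec[OF Wc[OF that], of d] unfolding P_def by metis
      then show False using 3(1,3) by (auto simp: linear_subspace_def)
    qed
    have k': "0 < k'"
    proof (rule ccontr)
      assume "\<not> 0 < k'"
      then have P1: "P = 1\<^sub>m d" using idempotent_full_trace[OF P PP] trP d by simp
      have "v \<in> W" if v: "v \<in> carrier_vec d" for v
      proof -
        have "v = B *\<^sub>v (C *\<^sub>v v)"
          using P1 one_mult_mat_vec[OF v] assoc_mult_mat_vec[OF B C v] unfolding P_def by metis
        then show ?thesis using BW[OF mult_mat_vec_carrier[OF C v]] by metis
      qed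
      then show False using 3(1,4) by (auto simp: linear_subspace_def)
    qed
    define \<rho>1 where "\<rho>1 = (\<lambda>g. C * (\<rho> g * B))"
    define \<rho>2 where "\<rho>2 = (\<lambda>g. C' * (\<rho> g * B'))"
    have \<rho>1c: "\<rho>1 g \<in> carrier_mat k k" if "g \<in> carrier H" for g
      using \<rho>c[OF that] B C unfolding \<rho>1_def by (intro mult_carrier_mat)
    have \<rho>2c: "\<rho>2 g \<in> carrier_mat k' k'" if "g \<in> carrier H" for g
      using \<rho>c[OF that] B' C' unfolding \<rho>2_def by (intro mult_carrier_mat)
    have \<rho>1v: "\<rho>1 g *\<^sub>v v = C *\<^sub>v (\<rho> g *\<^sub>v (B *\<^sub>v v))" if g: "g \<in> carrier H" and v: "v \<in> carrier_vec k" for g v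
      unfolding \<rho>1_def
      using assoc_mult_mat_vec[OF C mult_carrier_mat[OF \<rho>c[OF g] B] v] assoc_mult_mat_vec[OF \<rho>c[OF g] B v] by metis
    have \<rho>2v: "\<rho>2 g *\<^sub>v v = C' *\<^sub>v (\<rho> g *\<^sub>v (B' *\<^sub>v v))" if g: "g \<in> carrier H" and v: "v \<in> carrier_vec k'" for g v
      unfolding \<rho>2_def
      using assoc_mult_mat_vec[OF C' mult_carrier_mat[OF \<rho>c[OF g] B'] v] assoc_mult_mat_vec[OF \<rho>c[OF g] B' v] by metis
    have \<rho>v: "\<rho> (g \<otimes> h) *\<^sub>v v = \<rho> g *\<^sub>v (\<rho> h *\<^sub>v v)"
      if g: "g \<in> carrier H" and h: "h \<in> carrier H" and v: "v \<in> carrier_vec d" for g h v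
      using assoc_mult_mat_vec[OF \<rho>c[OF g] \<rho>c[OF h] v] \<rho>m[OF g h] by metis
    have BCv: "B *\<^sub>v (C *\<^sub>v w) = w" if w: "w \<in> W" for w
      using BCW[OF w] assoc_mult_mat_vec[OF B C Wc[OF w]] by metis
    have C'W: "C' *\<^sub>v w = 0\<^sub>v k'" if w: "w \<in> W" for w
    proof -
      have "B' *\<^sub>v (C' *\<^sub>v w) = w - P *\<^sub>v w"
        using assoc_mult_mat_vec[OF B' C' Wc[OF w]] BC'
          minus_mult_distrib_mat_vec[OF one_carrier_mat P Wc[OF w]] one_mult_mat_vec[OF Wc[OF w]] by metis
      also have "\<dots> = 0\<^sub>v d" using BCW[OF w] Wc[OF w] unfolding P_def by simp
      finally have "C' *\<^sub>v (B' *\<^sub>v (C' *\<^sub>v w)) = 0\<^sub>v k'" using mat_mult_zero_vec[OF C'] by metis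
      then show ?thesis
        using assoc_mult_mat_vec[OF C' B' mult_mat_vec_carrier[OF C' Wc[OF w]]] CB'
          one_mult_mat_vec[OF mult_mat_vec_carrier[OF C' Wc[OF w]]] by metis
    qed
    have "representation H k \<rho>1"
      unfolding representation_def
    proof (intro conjI ballI)
      fix g h assume g: "g \<in> carrier H" and h: "h \<in> carrier H"
      show "\<rho>1 (g \<otimes> h) = \<rho>1 g * \<rho>1 h"
      proof (rule eq_matI_mult_vec[OF \<rho>1c[OF m_closed[OF g h]] mult_carrier_mat[OF \<rho>1c[OF g] \<rho>1c[OF h]]])
        fix v :: "complex vec" assume v: "v \<in> carrier_vec k"
        have w: "\<rho> h *\<^sub>v (B *\<^sub>v v) \<in> W" by (rule inv[OF h BW[OF v]])
        have "(\<rho>1 g * \<rho>1 h) *\<^sub>v v = C *\<^sub>v (\<rho> g *\<^sub>v (B *\<^sub>v (C *\<^sub>v (\<rho> h *\<^sub>v (B *\<^sub>v v)))))"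
          using assoc_mult_mat_vec[OF \<rho>1c[OF g] \<rho>1c[OF h] v] \<rho>1v[OF h v]
            \<rho>1v[OF g mult_mat_vec_carrier[OF \<rho>1c[OF h] v]] by metis
        also have "\<dots> = \<rho>1 (g \<otimes> h) *\<^sub>v v"
          using \<rho>1v[OF m_closed[OF g h] v] \<rho>v[OF g h Wc[OF BW[OF v]]] BCv[OF w] by metis
        finally show "\<rho>1 (g \<otimes> h) *\<^sub>v v = (\<rho>1 g * \<rho>1 h) *\<^sub>v v" ..
      qed
    next
      show "\<rho>1 \<one> = 1\<^sub>m k" unfolding \<rho>1_def \<rho>1 using CB left_mult_one_mat[OF B] by metis
    qed (rule \<rho>1c)
    moreover have "representation H k' \<rho>2"
      unfolding representation_def
    proof (intro conjI ballI)
      fix g h assume g: "g \<in> carrier H" and h: "h \<in> carrier H"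
      show "\<rho>2 (g \<otimes> h) = \<rho>2 g * \<rho>2 h"
      proof (rule eq_matI_mult_vec[OF \<rho>2c[OF m_closed[OF g h]] mult_carrier_mat[OF \<rho>2c[OF g] \<rho>2c[OF h]]])
        fix v :: "complex vec" assume v: "v \<in> carrier_vec k'"
        define x where "x = \<rho> h *\<^sub>v (B' *\<^sub>v v)"
        have x: "x \<in> carrier_vec d"
          unfolding x_def by (rule mult_mat_vec_carrier[OF \<rho>c[OF h] mult_mat_vec_carrier[OF B' v]])
        have y: "B *\<^sub>v (C *\<^sub>v x) \<in> W" by (rule BW[OF mult_mat_vec_carrier[OF C x]])
        have gx: "\<rho> g *\<^sub>v x \<in> carrier_vec d" by (rule mult_mat_vec_carrier[OF \<rho>c[OF g] x])
        note gy = inv[OF g y]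
        have *: "B' *\<^sub>v (C' *\<^sub>v x) = x - B *\<^sub>v (C *\<^sub>v x)"
          using assoc_mult_mat_vec[OF B' C' x] BC' assoc_mult_mat_vec[OF B C x]
            minus_mult_distrib_mat_vec[OF one_carrier_mat P x] one_mult_mat_vec[OF x] unfolding P_def by metis
        have "(\<rho>2 g * \<rho>2 h) *\<^sub>v v = C' *\<^sub>v (\<rho> g *\<^sub>v (B' *\<^sub>v (C' *\<^sub>v x)))"
          unfolding x_def using assoc_mult_mat_vec[OF \<rho>2c[OF g] \<rho>2c[OF h] v] \<rho>2v[OF h v]
            \<rho>2v[OF g mult_mat_vec_carrier[OF \<rho>2c[OF h] v]] by metis
        also have "\<dots> = C' *\<^sub>v (\<rho> g *\<^sub>v x) - C' *\<^sub>v (\<rho> g *\<^sub>v (B *\<^sub>v (C *\<^sub>v x)))"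
          unfolding * mult_minus_distrib_mat_vec[OF \<rho>c[OF g] x Wc[OF y]]
          by (rule mult_minus_distrib_mat_vec[OF C' gx Wc[OF gy]])
        also have "\<dots> = C' *\<^sub>v (\<rho> g *\<^sub>v x)"
          unfolding C'W[OF gy] using mult_mat_vec_carrier[OF C' gx] by simp
        also have "\<dots> = \<rho>2 (g \<otimes> h) *\<^sub>v v"
          unfolding x_def
          using \<rho>2v[OF m_closed[OF g h] v] \<rho>v[OF g h mult_mat_vec_carrier[OF B' v]] by metis
        finally show "\<rho>2 (g \<otimes> h) *\<^sub>v v = (\<rho>2 g * \<rho>2 h) *\<^sub>v v" ..
      qed
    next
      show "\<rho>2 \<one> = 1\<^sub>m k'" unfolding \<rho>2_def \<rho>1 using CB' left_mult_one_mat[OF B'] by metis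
    qed (rule \<rho>2c)
    ultimately obtain D1 D2 where
      D1: "set_mset D1 \<subseteq> Irr H" "\<And>g. g \<in> carrier H \<Longrightarrow> mat_trace (\<rho>1 g) = (\<Sum>\<chi>\<in>#D1. \<chi> g)" and
      D2: "set_mset D2 \<subseteq> Irr H" "\<And>g. g \<in> carrier H \<Longrightarrow> mat_trace (\<rho>2 g) = (\<Sum>\<chi>\<in>#D2. \<chi> g)"
      using less.IH[of k \<rho>1] less.IH[of k' \<rho>2] d k k' by auto
    have "mat_trace (\<rho> g) = (\<Sum>\<chi>\<in>#D1 + D2. \<chi> g)" if g: "g \<in> carrier H" for g
    proof -
      note \<rho>g = \<rho>c[OF g]
      have 1: "mat_trace (\<rho>1 g) = mat_trace (\<rho> g * P)"
        unfolding \<rho>1_def P_def mat_trace_mult_comm[OF C mult_carrier_mat[OF \<rho>g B]] assoc_mult_mat[OF \<rho>g B C] ..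
      have 2: "mat_trace (\<rho>2 g) = mat_trace (\<rho> g * (1\<^sub>m d - P))"
        unfolding \<rho>2_def BC'[symmetric] mat_trace_mult_comm[OF C' mult_carrier_mat[OF \<rho>g B']]
          assoc_mult_mat[OF \<rho>g B' C'] ..
      have "\<rho> g * (1\<^sub>m d - P) = \<rho> g - \<rho> g * P"
        using mult_minus_distrib_mat[OF \<rho>g one_carrier_mat P] right_mult_one_mat[OF \<rho>g] by metis
      then have "mat_trace (\<rho>1 g) + mat_trace (\<rho>2 g) = mat_trace (\<rho> g)"
        unfolding 1 2 using mat_trace_minus[OF \<rho>g mult_carrier_mat[OF \<rho>g P]] by simp
      then show ?thesis using D1(2)[OF g] D2(2)[OF g] by simp
    qed
    then show ?thesis using D1(1) D2(1) by (intro exI[of _ "D1 + D2"]) auto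
  qed
qed

text \<open>The average of \<open>\<rho>\<close> over \<open>R\<close> is the projection onto the fixed points of \<open>R\<close>. By hypothesis its trace is the full
  dimension, so every vector is fixed.\<close>

lemma representation_trivial_on_subgroup:
  assumes \<rho>: "representation H d \<rho>" and R: "subgroup R H"
    and tr: "\<And>r. r \<in> R \<Longrightarrow> mat_trace (\<rho> r) = of_nat d" and r: "r \<in> R"
  shows "\<rho> r = 1\<^sub>m d"
proof -
  have Rc: "x \<in> carrier H" if "x \<in> R" for x using subgroup.mem_carrier[OF R that] .
  note \<rho>c = representationD(1)[OF \<rho> Rc]
  define n :: complex where "n = of_nat (card R)"
  have "finite R" by (rule finite_subset[OF subgroup.subset[OF R] fin])
  then have n: "n \<noteq> 0" using subgroup.one_closed[OF R] by (auto simp: n_def)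
  define M where "M = msum d d \<rho> R"
  have M: "M \<in> carrier_mat d d" by (simp add: M_def)
  have \<rho>M: "\<rho> x * M = M" if x: "x \<in> R" for x
  proof -
    have "bij_betw (\<lambda>y. x \<otimes> y) R R"
      using x Rc R by (intro bij_betw_byWitness[of _ "\<lambda>y. inv x \<otimes> y"])
        (auto simp: m_assoc[symmetric] subgroup.m_closed subgroup.m_inv_closed)
    then have "M = msum d d (\<lambda>y. \<rho> (x \<otimes> y)) R" unfolding M_def by (rule msum_reindex)
    also have "\<dots> = msum d d (\<lambda>y. \<rho> x * \<rho> y) R"
      using representationD(2)[OF \<rho> Rc Rc] x by (intro msum_cong) auto
    also have "\<dots> = \<rho> x * M" unfolding M_def by (rule mult_msum[OF \<rho>c[OF x] \<rho>c, symmetric])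
    finally show ?thesis ..
  qed
  have "M * M = msum d d (\<lambda>x. \<rho> x * M) R"
    unfolding M_def by (rule msum_mult[OF M[unfolded M_def] \<rho>c])
  also have "\<dots> = msum d d (\<lambda>x. M) R" using \<rho>M by (intro msum_cong) auto
  also have "\<dots> = n \<cdot>\<^sub>m M" using M by (intro eq_matI) (auto simp: msum_def n_def)
  finally have MM: "M * M = n \<cdot>\<^sub>m M" .
  define Q where "Q = (1 / n) \<cdot>\<^sub>m M"
  have Q: "Q \<in> carrier_mat d d" using M by (simp add: Q_def)
  have "Q * Q = (1 / n) \<cdot>\<^sub>m ((1 / n) \<cdot>\<^sub>m (M * M))"
    unfolding Q_def using mult_smult_assoc_mat[OF M smult_carrier_mat[OF M]] mult_smult_distrib[OF M M] by metis
  also have "\<dots> = Q" unfolding MM Q_def using n M by (intro eq_matI) auto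
  finally have QQ: "Q * Q = Q" .
  have "mat_trace M = (\<Sum>x\<in>R. mat_trace (\<rho> x))" unfolding M_def by (rule mat_trace_msum[OF \<rho>c])
  also have "\<dots> = n * of_nat d" using tr by (simp add: n_def)
  finally have "mat_trace Q = of_nat d" unfolding Q_def using n by (simp add: mat_trace_smult[OF M])
  then have Q1: "Q = 1\<^sub>m d" using idempotent_full_trace[OF Q QQ] by simp
  have "\<rho> r * Q = Q"
    unfolding Q_def using mult_smult_distrib[OF \<rho>c[OF r] M] \<rho>M[OF r] by metis
  then show ?thesis unfolding Q1 using right_mult_one_mat[OF \<rho>c[OF r]] by metis
qed

definition adj :: "complex mat \<Rightarrow> complex mat" where
  "adj A = map_mat cnj (transpose_mat A)"

lemma adj_carrier: "A \<in> carrier_mat m n \<Longrightarrow> adj A \<in> carrier_mat n m"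
  by (simp add: adj_def)

lemma adj_mult:
  assumes A: "A \<in> carrier_mat m n" and B: "B \<in> carrier_mat n k"
  shows "adj (A * B) = adj B * adj A"
proof (rule eq_matI)
  fix i j assume "i < dim_row (adj B * adj A)" "j < dim_col (adj B * adj A)"
  then have ij: "i < k" "j < m" using A B by (auto simp: adj_def)
  have "(adj B * adj A) $$ (i, j) = (\<Sum>x\<in>{0..<n}. adj B $$ (i, x) * adj A $$ (x, j))"
    by (rule mat_mult_entry[OF adj_carrier[OF B] adj_carrier[OF A] ij])
  also have "\<dots> = cnj ((A * B) $$ (j, i))"
    unfolding mat_mult_entry[OF A B ij(2,1)] using A B ij
    by (auto simp: adj_def mult.commute intro!: sum.cong)
  finally show "adj (A * B) $$ (i, j) = (adj B * adj A) $$ (i, j)"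
    using A B ij by (simp add: adj_def)
qed (use A B in \<open>auto simp: adj_def\<close>)

lemma trace_adj: "A \<in> carrier_mat d d \<Longrightarrow> mat_trace (adj A) = cnj (mat_trace A)"
  by (auto simp: mat_trace_def adj_def)

text \<open>The positive definite matrix \<open>P = \<Sum>g. (\<rho> g)\<^sup>* (\<rho> g)\<close> is an invariant Hermitian form. Invariance says
  \<open>(\<rho> h)\<^sup>* P = P \<rho>(h\<inverse>)\<close>, so \<open>\<rho>(h\<inverse>)\<close> is similar to \<open>(\<rho> h)\<^sup>*\<close>, and the traces agree.\<close>

lemma trace_inv_eq_cnj:
  assumes \<rho>: "representation H d \<rho>" and h: "h \<in> carrier H"
  shows "mat_trace (\<rho> (inv h)) = cnj (mat_trace (\<rho> h))"
proof -
  note \<rho>c = representationD(1)[OF \<rho>]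
  define P where "P = msum d d (\<lambda>g. adj (\<rho> g) * \<rho> g) (carrier H)"
  have P: "P \<in> carrier_mat d d" by (simp add: P_def)
  have c: "adj (\<rho> g) * \<rho> g \<in> carrier_mat d d" if "g \<in> carrier H" for g
    using \<rho>c[OF that] adj_carrier[OF \<rho>c[OF that]] by simp
  note \<rho>h = \<rho>c[OF h] and ah = adj_carrier[OF \<rho>c[OF h]] and \<rho>i = \<rho>c[OF inv_closed[OF h]]
  have "adj (\<rho> h) * P = msum d d (\<lambda>g. adj (\<rho> h) * (adj (\<rho> g) * \<rho> g)) (carrier H)"
    unfolding P_def by (rule mult_msum[OF ah c])
  also have "\<dots> = msum d d (\<lambda>g. adj (\<rho> (g \<otimes> h)) * \<rho> (g \<otimes> h) * \<rho> (inv h)) (carrier H)"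
  proof (rule msum_cong)
    fix g assume g: "g \<in> carrier H"
    note \<rho>g = \<rho>c[OF g] and ag = adj_carrier[OF \<rho>c[OF g]] and \<rho>gh = \<rho>c[OF m_closed[OF g h]]
    have "\<rho> (g \<otimes> h) * \<rho> (inv h) = \<rho> g"
      using representationD(2)[OF \<rho>, of "g \<otimes> h" "inv h"] g h by (simp add: m_assoc)
    moreover have "adj (\<rho> (g \<otimes> h)) = adj (\<rho> h) * adj (\<rho> g)"
      using representationD(2)[OF \<rho> g h] adj_mult[OF \<rho>g \<rho>h] by simp
    ultimately show "adj (\<rho> h) * (adj (\<rho> g) * \<rho> g) = adj (\<rho> (g \<otimes> h)) * \<rho> (g \<otimes> h) * \<rho> (inv h)"
      using assoc_mult_mat[OF adj_carrier[OF \<rho>gh] \<rho>gh \<rho>i] assoc_mult_mat[OF ah ag \<rho>g] by metis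
  qed
  also have "\<dots> = msum d d (\<lambda>g. adj (\<rho> g) * \<rho> g * \<rho> (inv h)) (carrier H)"
    by (rule msum_reindex[OF bij_betw_mult_right[OF h], symmetric])
  also have "\<dots> = P * \<rho> (inv h)"
    unfolding P_def by (rule msum_mult[OF \<rho>i c, symmetric])
  finally have PI: "adj (\<rho> h) * P = P * \<rho> (inv h)" .
  have "det P \<noteq> 0"
  proof
    assume "det P = 0"
    then obtain v where v: "v \<in> carrier_vec d" "v \<noteq> 0\<^sub>v d" "P *\<^sub>v v = 0\<^sub>v d"
      unfolding det_0_iff_vec_prod_zero[OF P] by auto
    \<comment> \<open>\<open>v\<^sup>* P v\<close> is the sum of the squared norms of the vectors \<open>\<rho> g v\<close>, whose entries are \<open>u g k\<close>; the vector for \<open>g = \<one>\<close> is \<open>v\<close>.\<close>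
    define u where "u g k = (\<Sum>j<d. \<rho> g $$ (k, j) * v $ j)" for g k
    have Pij: "P $$ (i, j) = (\<Sum>p\<in>carrier H \<times> {..<d}. cnj (\<rho> (fst p) $$ (snd p, i)) * \<rho> (fst p) $$ (snd p, j))"
      if "i < d" "j < d" for i j
    proof -
      have "P $$ (i, j) = (\<Sum>g\<in>carrier H. (adj (\<rho> g) * \<rho> g) $$ (i, j))"
        using that by (simp add: P_def msum_def)
      also have "\<dots> = (\<Sum>g\<in>carrier H. \<Sum>k<d. cnj (\<rho> g $$ (k, i)) * \<rho> g $$ (k, j))"
      proof (rule sum.cong[OF refl])
        fix g assume g: "g \<in> carrier H"
        show "(adj (\<rho> g) * \<rho> g) $$ (i, j) = (\<Sum>k<d. cnj (\<rho> g $$ (k, i)) * \<rho> g $$ (k, j))"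
          unfolding mat_mult_entry[OF adj_carrier[OF \<rho>c[OF g]] \<rho>c[OF g] that]
          using \<rho>c[OF g] that by (auto simp: adj_def atLeast0LessThan intro!: sum.cong)
      qed
      finally show ?thesis by (simp add: sum.cartesian_product case_prod_unfold)
    qed
    have "0 = (\<Sum>i<d. cnj (v $ i) * (P *\<^sub>v v) $ i)" using v(3) by simp
    also have "\<dots> = (\<Sum>i<d. cnj (v $ i) * (\<Sum>j<d. P $$ (i, j) * v $ j))"
      using P v(1) by (intro sum.cong) (auto simp: scalar_prod_def atLeast0LessThan)
    also have "\<dots> = (\<Sum>i<d. \<Sum>j<d. \<Sum>p\<in>carrier H \<times> {..<d}.
        cnj (\<rho> (fst p) $$ (snd p, i) * v $ i) * (\<rho> (fst p) $$ (snd p, j) * v $ j))"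
      by (auto simp: Pij sum_distrib_left sum_distrib_right mult_ac intro!: sum.cong)
    also have "\<dots> = (\<Sum>i<d. \<Sum>p\<in>carrier H \<times> {..<d}. \<Sum>j<d.
        cnj (\<rho> (fst p) $$ (snd p, i) * v $ i) * (\<rho> (fst p) $$ (snd p, j) * v $ j))"
      by (intro sum.cong refl sum.swap)
    also have "\<dots> = (\<Sum>p\<in>carrier H \<times> {..<d}. \<Sum>i<d. \<Sum>j<d.
        cnj (\<rho> (fst p) $$ (snd p, i) * v $ i) * (\<rho> (fst p) $$ (snd p, j) * v $ j))"
      by (rule sum.swap)
    also have "\<dots> = (\<Sum>p\<in>carrier H \<times> {..<d}. cnj (u (fst p) (snd p)) * u (fst p) (snd p))"
      unfolding u_def cnj_sum sum_product ..
    also have "\<dots> = of_real (\<Sum>p\<in>carrier H \<times> {..<d}. (cmod (u (fst p) (snd p)))\<^sup>2)"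
      by (simp add: complex_norm_square mult.commute del: of_real_power)
    finally have "(\<Sum>p\<in>carrier H \<times> {..<d}. (cmod (u (fst p) (snd p)))\<^sup>2) = 0"
      by (metis of_real_eq_0_iff)
    then have "\<forall>p\<in>carrier H \<times> {..<d}. (cmod (u (fst p) (snd p)))\<^sup>2 = 0"
      using fin by (subst (asm) sum_nonneg_eq_0_iff) auto
    then have u0: "u \<one> k = 0" if "k < d" for k using that by force
    have "v $ k = 0" if k: "k < d" for k
    proof -
      have "u \<one> k = (\<Sum>j<d. if j = k then v $ j else 0)"
        unfolding u_def representationD(3)[OF \<rho>] using k by (intro sum.cong) auto
      then show ?thesis using u0[OF k] k by simp
    qed
    then have "v = 0\<^sub>v d" using v(1) by (intro eq_vecI) auto
    then show False using v(2) by simp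
  qed
  then have "P \<in> Units (ring_mat TYPE(complex) d ())" by (rule det_non_zero_imp_unit[OF P])
  then have "P \<in> carrier (GL TYPE(complex) d)" by (simp only: GL_def units_of_def partial_object.simps)
  then have "\<exists>P'\<in>carrier_mat d d. P' * P = 1\<^sub>m d \<and> P * P' = 1\<^sub>m d"
    unfolding GL_simps(1) mem_Collect_eq by (rule conjunct2)
  then obtain P' where P': "P' \<in> carrier_mat d d" and "P' * P = 1\<^sub>m d \<and> P * P' = 1\<^sub>m d" ..
  then have P'P: "P' * P = 1\<^sub>m d" and PP': "P * P' = 1\<^sub>m d" by blast+
  have "cnj (mat_trace (\<rho> h)) = mat_trace (adj (\<rho> h))" by (rule trace_adj[OF \<rho>h, symmetric])
  also have "adj (\<rho> h) = adj (\<rho> h) * (P * P')" unfolding PP' by (rule right_mult_one_mat[OF ah, symmetric])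
  also have "\<dots> = P * \<rho> (inv h) * P'" unfolding PI[symmetric] by (rule assoc_mult_mat[OF ah P P', symmetric])
  also have "mat_trace \<dots> = mat_trace (P' * (P * \<rho> (inv h)))"
    by (rule mat_trace_mult_comm[OF mult_carrier_mat[OF P \<rho>i] P'])
  also have "P' * (P * \<rho> (inv h)) = \<rho> (inv h)"
    unfolding assoc_mult_mat[OF P' P \<rho>i, symmetric] P'P by (rule left_mult_one_mat[OF \<rho>i])
  finally show ?thesis ..
qed

lemma Irr_inv: "\<chi> \<in> Irr H \<Longrightarrow> g \<in> carrier H \<Longrightarrow> \<chi> (inv g) = cnj (\<chi> g)"
  by (elim IrrE) (simp add: trace_inv_eq_cnj[OF irreducible_repD(1)])

end

section \<open>Degrees\<close>

text \<open>The operator that sends \<open>v\<close> to the sum of its translates \<open>v \<circ> \<pi> p\<close> has a matrix with entries in the natural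
  numbers, so its eigenvalues are roots of a monic integer polynomial.\<close>

lemma algebraic_int_eigenvalue_of_permutation_sums:
  fixes v :: "'i \<Rightarrow> complex"
  assumes I: "finite I" and P: "finite P" and a: "a \<in> I" "v a \<noteq> 0"
    and \<pi>: "\<And>p i. p \<in> P \<Longrightarrow> i \<in> I \<Longrightarrow> \<pi> p i \<in> I"
    and eig: "\<And>i. i \<in> I \<Longrightarrow> c * v i = (\<Sum>p\<in>P. v (\<pi> p i))"
  shows "algebraic_int c"
proof -
  obtain f where f: "bij_betw f {0..<card I} I" using ex_bij_betw_nat_finite[OF I] by blast
  define n where "n = card I"
  have f: "bij_betw f {0..<n} I" using f by (simp add: n_def)
  have fI: "f i \<in> I" if "i < n" for i using bij_betwE[OF f] that by simp
  define A :: "int mat" where "A = mat n n (\<lambda>(i, j). int (card {p \<in> P. \<pi> p (f i) = f j}))"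
  define B :: "complex mat" where "B = map_mat of_int A"
  have A: "A \<in> carrier_mat n n" by (simp add: A_def)
  have B: "B \<in> carrier_mat n n" using A by (simp add: B_def)
  define x where "x = vec n (\<lambda>i. v (f i))"
  have "B *\<^sub>v x = c \<cdot>\<^sub>v x"
  proof (rule eq_vecI)
    fix i assume "i < dim_vec (c \<cdot>\<^sub>v x)"
    then have i: "i < n" by (simp add: x_def)
    have "(B *\<^sub>v x) $ i = (\<Sum>j\<in>{0..<n}. of_nat (card {p \<in> P. \<pi> p (f i) = f j}) * v (f j))"
      using i by (simp add: B_def A_def x_def scalar_prod_def)
    also have "\<dots> = (\<Sum>j\<in>{0..<n}. \<Sum>p | p \<in> P \<and> \<pi> p (f i) = f j. v (\<pi> p (f i)))"
      by (intro sum.cong) auto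
    also have "\<dots> = (\<Sum>k\<in>I. \<Sum>p | p \<in> P \<and> \<pi> p (f i) = k. v (\<pi> p (f i)))"
      by (rule sum.reindex_bij_betw[OF f])
    also have "\<dots> = (\<Sum>p\<in>P. v (\<pi> p (f i)))"
      using \<pi> fI[OF i] by (intro sum.group P I) auto
    also have "\<dots> = (c \<cdot>\<^sub>v x) $ i" using eig[OF fI[OF i]] i by (simp add: x_def)
    finally show "(B *\<^sub>v x) $ i = (c \<cdot>\<^sub>v x) $ i" .
  qed (use B in \<open>simp add: x_def\<close>)
  moreover have "x \<noteq> 0\<^sub>v n"
  proof
    assume x0: "x = 0\<^sub>v n"
    obtain i where i: "i < n" "f i = a" using f a(1) by (auto simp: bij_betw_def)
    then have "x $ i = v a" by (simp add: x_def)
    then show False using x0 i a(2) by simp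
  qed
  ultimately have "eigenvalue B c"
    unfolding eigenvalue_def eigenvector_def using B by (intro exI[of _ x]) (auto simp: x_def)
  then have root: "poly (char_poly B) c = 0" using eigenvalue_root_char_poly[OF B] by simp
  have cp: "char_poly B = map_poly of_int (char_poly A)"
    unfolding B_def by (rule of_int_hom.char_poly_hom[OF A])
  show ?thesis
  proof (rule algebraic_int.intros[OF _ _ root])
    show "lead_coeff (char_poly B) = 1" using degree_monic_char_poly[OF B] by simp
    show "\<forall>i. Polynomial.coeff (char_poly B) i \<in> \<int>" unfolding cp by (simp add: coeff_map_poly)
  qed
qed

context fin_group
begin

lemma sum_over_rcosets:
  assumes Y: "subgroup Y H"
    and f: "\<And>x y. x \<in> carrier H \<Longrightarrow> y \<in> Y \<Longrightarrow> f (y \<otimes> x) = (f x :: complex)"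
  shows "(\<Sum>x\<in>carrier H. f x) = of_nat (card Y) * (\<Sum>C\<in>rcosets Y. f (SOME x. x \<in> C))"
proof -
  have Ysub: "Y \<subseteq> carrier H" by (rule subgroup.subset[OF Y])
  have C: "finite C" "C \<subseteq> carrier H" if "C \<in> rcosets Y" for C
    using that rcosets_subset_PowG[OF Y] finite_subset[OF _ fin] by auto
  have const: "f x = f (SOME x. x \<in> C)" if CR: "C \<in> rcosets Y" and x: "x \<in> C" for C x
  proof -
    have z: "(SOME x. x \<in> C) \<in> C" using x by (rule someI)
    obtain a where a: "a \<in> carrier H" "C = Y #> a" using CR unfolding RCOSETS_def by blast
    have "f z = f a" if "z \<in> C" for z
      using that f[OF a(1)] unfolding a(2) r_coset_def by auto
    then show ?thesis using x z by metis
  qed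
  have "(\<Sum>x\<in>carrier H. f x) = (\<Sum>x\<in>\<Union>(rcosets Y). f x)" by (simp add: rcosets_part_G[OF Y])
  also have "\<dots> = (\<Sum>C\<in>rcosets Y. \<Sum>x\<in>C. f x)"
    using C rcos_disjoint[OF Y] unfolding pairwise_def disjnt_def
    by (subst sum.Union_disjoint) auto
  also have "\<dots> = (\<Sum>C\<in>rcosets Y. of_nat (card Y) * f (SOME x. x \<in> C))"
  proof (rule sum.cong[OF refl])
    fix C assume CR: "C \<in> rcosets Y"
    have "(\<Sum>x\<in>C. f x) = (\<Sum>x\<in>C. f (SOME x. x \<in> C))"
      by (intro sum.cong refl const[OF CR])
    also have "\<dots> = of_nat (card Y) * f (SOME x. x \<in> C)"
      using card_rcosets_equal[OF CR Ysub] by simp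
    finally show "(\<Sum>x\<in>C. f x) = of_nat (card Y) * f (SOME x. x \<in> C)" .
  qed
  finally show ?thesis by (simp add: sum_distrib_left)
qed

text \<open>Sum first over \<open>x\<close>, a class sum, and then over \<open>g\<close>, a convolution. The formula is used because it brings
  \<open>(|H| / \<chi>(1))\<^sup>2\<close> in front as an eigenvalue.\<close>

lemma sum_commutators:
  assumes \<chi>: "\<chi> \<in> Irr H" and h: "h \<in> carrier H"
  shows "(\<Sum>x\<in>carrier H. \<Sum>g\<in>carrier H. \<chi> (x \<otimes> g \<otimes> inv x \<otimes> (inv g \<otimes> h))) =
    (of_nat (Coset.order H) / \<chi> \<one>)\<^sup>2 * \<chi> h"
proof -
  have "(\<Sum>x\<in>carrier H. \<Sum>g\<in>carrier H. \<chi> (x \<otimes> g \<otimes> inv x \<otimes> (inv g \<otimes> h))) =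
      (\<Sum>g\<in>carrier H. \<Sum>x\<in>carrier H. \<chi> (x \<otimes> g \<otimes> inv x \<otimes> (inv g \<otimes> h)))"
    by (rule sum.swap)
  also have "\<dots> = (\<Sum>g\<in>carrier H. of_nat (Coset.order H) / \<chi> \<one> * \<chi> g * \<chi> (inv g \<otimes> h))"
    using h by (intro sum.cong refl Irr_class_sum[OF \<chi>]) auto
  also have "\<dots> = of_nat (Coset.order H) / \<chi> \<one> * (\<Sum>g\<in>carrier H. \<chi> g * \<chi> (inv g \<otimes> h))"
    by (simp add: sum_distrib_left mult_ac)
  also have "(\<Sum>g\<in>carrier H. \<chi> g * \<chi> (inv g \<otimes> h)) = (\<Sum>g\<in>carrier H. \<chi> (inv g) * \<chi> (g \<otimes> h))"
    by (subst sum.reindex_bij_betw[OF bij_betw_inv, symmetric]) (auto intro!: sum.cong)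
  also have "\<dots> = of_nat (Coset.order H) / \<chi> \<one> * \<chi> h"
    using Irr_convolution[OF \<chi> \<chi> h] by simp
  finally show ?thesis by (simp add: power2_eq_square mult_ac)
qed

text \<open>The degree of an irreducible character divides the index of any subgroup acting by scalars, normal or
  not. Multiplying \<open>x\<close> or \<open>g\<close> by an element of \<open>Y\<close> from the left does not change \<open>\<chi>([x, g] h)\<close>, because the
  scalar and its inverse cancel. Hence the sum over all commutators becomes a sum over pairs of cosets,
  and \<open>(|H : Y| / \<chi>(1))\<^sup>2\<close> is an eigenvalue of an operator as in
  \<open>algebraic_int_eigenvalue_of_permutation_sums\<close>, with eigenvector \<open>\<chi>\<close>. A rational algebraic integer is an
  integer.\<close>

theorem degree_dvd_index:
  assumes \<rho>: "irreducible_rep H d \<rho>" and Y: "subgroup Y H"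
    and scal: "\<And>y. y \<in> Y \<Longrightarrow> \<exists>c. \<rho> y = c \<cdot>\<^sub>m 1\<^sub>m d"
  shows "d dvd card (rcosets Y)"
proof -
  note \<rho>r = irreducible_repD(1)[OF \<rho>]
  note \<rho>c = representationD(1)[OF \<rho>r] and \<rho>m = representationD(2)[OF \<rho>r]
  have Yc: "y \<in> carrier H" if "y \<in> Y" for y using subgroup.mem_carrier[OF Y that] .
  define \<chi> where "\<chi> = restrict (\<lambda>g. mat_trace (\<rho> g)) (carrier H)"
  have \<chi>: "\<chi> \<in> Irr H" using \<rho> unfolding Irr_def \<chi>_def by blast
  have \<chi>1: "\<chi> \<one> = of_nat d" using representationD(3)[OF \<rho>r] by (simp add: \<chi>_def mat_trace_one)
  have d0: "0 < d" by (rule irreducible_repD(2)[OF \<rho>])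
  define m where "m = card (rcosets Y)"
  have lag: "m * card Y = Coset.order H" unfolding m_def by (rule lagrange[OF Y])
  have Y0: "card Y \<noteq> 0" by (metis lag order_pos mult_0_right less_irrefl)
  have pull: "\<chi> (u \<otimes> y \<otimes> v) = c * \<chi> (u \<otimes> v)"
    if y: "y \<in> carrier H" and u: "u \<in> carrier H" and v: "v \<in> carrier H" and c: "\<rho> y = c \<cdot>\<^sub>m 1\<^sub>m d" for u y v c
  proof -
    have "\<rho> (u \<otimes> y \<otimes> v) = \<rho> u * (c \<cdot>\<^sub>m 1\<^sub>m d) * \<rho> v" using y u v c \<rho>m by simp
    also have "\<rho> u * (c \<cdot>\<^sub>m 1\<^sub>m d) = c \<cdot>\<^sub>m \<rho> u"
      using mult_smult_distrib[OF \<rho>c[OF u] one_carrier_mat] right_mult_one_mat[OF \<rho>c[OF u]] by metis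
    also have "c \<cdot>\<^sub>m \<rho> u * \<rho> v = c \<cdot>\<^sub>m \<rho> (u \<otimes> v)"
      using mult_smult_assoc_mat[OF \<rho>c[OF u] \<rho>c[OF v]] \<rho>m[OF u v] by metis
    finally show ?thesis using y u v \<rho>c[OF m_closed[OF u v]] by (simp add: \<chi>_def mat_trace_smult)
  qed
  have cancel: "\<chi> (u \<otimes> y \<otimes> v \<otimes> inv y \<otimes> w) = \<chi> (u \<otimes> v \<otimes> w)"
    if y: "y \<in> Y" and u: "u \<in> carrier H" and v: "v \<in> carrier H" and w: "w \<in> carrier H" for u y v w
  proof -
    note yc = Yc[OF y] and yi = subgroup.m_inv_closed[OF Y y]
    obtain c where c: "\<rho> y = c \<cdot>\<^sub>m 1\<^sub>m d" using scal[OF y] by blast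
    obtain c' where c': "\<rho> (inv y) = c' \<cdot>\<^sub>m 1\<^sub>m d" using scal[OF yi] by blast
    have "\<chi> (\<one> \<otimes> y \<otimes> inv y) = c * (c' * \<chi> \<one>)"
      using pull[OF yc one_closed inv_closed[OF yc] c] pull[OF inv_closed[OF yc] one_closed one_closed c'] yc by simp
    then have cc': "c * c' = 1" using yc \<chi>1 d0 by simp
    have "\<chi> (u \<otimes> y \<otimes> v \<otimes> inv y \<otimes> w) = \<chi> (u \<otimes> y \<otimes> (v \<otimes> inv y \<otimes> w))"
      using yc u v w by (simp add: m_assoc)
    also have "\<dots> = c * \<chi> ((u \<otimes> v) \<otimes> inv y \<otimes> w)"
      using pull[OF yc u _ c, of "v \<otimes> inv y \<otimes> w"] yc u v w by (simp add: m_assoc)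
    also have "\<dots> = c * (c' * \<chi> (u \<otimes> v \<otimes> w))"
      using pull[OF inv_closed[OF yc] m_closed[OF u v] w c'] by simp
    finally show ?thesis using cc' by (simp add: mult.assoc[symmetric])
  qed
  define rep where "rep C = (SOME x. x \<in> C)" for C :: "'a set"
  have rep: "rep C \<in> carrier H" if "C \<in> rcosets Y" for C
  proof -
    have "C \<noteq> {}" using subgroup.rcosets_non_empty[OF Y that] .
    then have "rep C \<in> C" unfolding rep_def by (rule some_in_eq[THEN iffD2])
    then show ?thesis by (rule subsetD[OF subgroup.rcosets_carrier[OF Y is_group that]])
  qed
  define F where "F x g h = \<chi> (x \<otimes> g \<otimes> inv x \<otimes> (inv g \<otimes> h))" for x g h
  have F1: "F (y \<otimes> x) g h = F x g h"
    if "y \<in> Y" "x \<in> carrier H" "g \<in> carrier H" "h \<in> carrier H" for x y g h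
    using cancel[OF that(1) one_closed, of "x \<otimes> g \<otimes> inv x" "inv g \<otimes> h"] that Yc[OF that(1)]
    by (simp add: F_def m_assoc inv_mult_group)
  have F2: "F x (y \<otimes> g) h = F x g h"
    if "y \<in> Y" "x \<in> carrier H" "g \<in> carrier H" "h \<in> carrier H" for x y g h
    using cancel[OF that(1,2), of "g \<otimes> inv x \<otimes> inv g" h] that Yc[OF that(1)]
    by (simp add: F_def m_assoc inv_mult_group)
  define \<pi> where "\<pi> p h = rep (fst p) \<otimes> rep (snd p) \<otimes> inv (rep (fst p)) \<otimes> (inv (rep (snd p)) \<otimes> h)" for p h
  have "(of_nat m / of_nat d)\<^sup>2 * \<chi> h = (\<Sum>C\<in>rcosets Y. \<Sum>D\<in>rcosets Y. F (rep C) (rep D) h)"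
    if h: "h \<in> carrier H" for h
  proof -
    have "(of_nat (Coset.order H) / \<chi> \<one>)\<^sup>2 * \<chi> h = (\<Sum>x\<in>carrier H. \<Sum>g\<in>carrier H. F x g h)"
      unfolding F_def by (rule sum_commutators[OF \<chi> h, symmetric])
    also have "\<dots> = of_nat (card Y) * (\<Sum>C\<in>rcosets Y. \<Sum>g\<in>carrier H. F (rep C) g h)"
      unfolding rep_def
      by (rule sum_over_rcosets[OF Y, where f = "\<lambda>x. \<Sum>g\<in>carrier H. F x g h"])
        (intro sum.cong refl F1 h)
    also have "(\<Sum>C\<in>rcosets Y. \<Sum>g\<in>carrier H. F (rep C) g h) =
        (\<Sum>C\<in>rcosets Y. of_nat (card Y) * (\<Sum>D\<in>rcosets Y. F (rep C) (rep D) h))"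
    proof (rule sum.cong[OF refl])
      fix C assume C: "C \<in> rcosets Y"
      show "(\<Sum>g\<in>carrier H. F (rep C) g h) = of_nat (card Y) * (\<Sum>D\<in>rcosets Y. F (rep C) (rep D) h)"
        unfolding rep_def
        by (rule sum_over_rcosets[OF Y, where f = "\<lambda>g. F (SOME x. x \<in> C) g h"])
          (rule F2[OF _ rep[OF C, unfolded rep_def] _ h])
    qed
    finally have "(of_nat (card Y))\<^sup>2 * ((of_nat m / of_nat d)\<^sup>2 * \<chi> h) =
        (of_nat (card Y))\<^sup>2 * (\<Sum>C\<in>rcosets Y. \<Sum>D\<in>rcosets Y. F (rep C) (rep D) h)"
      unfolding lag[symmetric] \<chi>1
      by (simp add: power2_eq_square sum_distrib_left mult_ac)
    then show ?thesis using Y0 by simp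
  qed
  then have eig: "(of_nat m / of_nat d)\<^sup>2 * \<chi> h = (\<Sum>p\<in>(rcosets Y) \<times> (rcosets Y). \<chi> (\<pi> p h))"
    if "h \<in> carrier H" for h
    using that by (simp add: F_def \<pi>_def sum.cartesian_product case_prod_unfold)
  have fr: "finite (rcosets Y)"
    by (rule finite_subset[OF rcosets_subset_PowG[OF Y]]) (simp add: fin)
  have \<pi>: "\<pi> p h \<in> carrier H" if "p \<in> (rcosets Y) \<times> (rcosets Y)" "h \<in> carrier H" for p h
    using that rep by (auto simp: \<pi>_def)
  have "algebraic_int ((of_nat m / of_nat d :: complex)\<^sup>2)"
  proof (rule algebraic_int_eigenvalue_of_permutation_sums[where v = \<chi> and \<pi> = \<pi> and a = \<one> and
        I = "carrier H" and P = "(rcosets Y) \<times> (rcosets Y)"])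
    show "\<chi> \<one> \<noteq> 0" using \<chi>1 d0 by simp
  qed (use fin fr \<pi> eig in auto)
  then have "(of_nat m / of_nat d :: complex)\<^sup>2 \<in> \<int>"
    by (rule rational_algebraic_int_is_int) (auto intro!: Rats_power Rats_divide)
  then obtain k where "(of_nat m / of_nat d :: complex)\<^sup>2 = of_int k" by (elim Ints_cases)
  then have "(of_nat m :: complex)\<^sup>2 = of_int k * (of_nat d)\<^sup>2" using d0 by (simp add: field_simps)
  then have "(of_int (int m ^ 2) :: complex) = of_int (k * int d ^ 2)" by simp
  then have "int m ^ 2 = k * int d ^ 2" by (simp only: of_int_eq_iff)
  then have "int d ^ 2 dvd int m ^ 2" by simp
  then show ?thesis unfolding m_def[symmetric] by simp
qed

text \<open>A function that is orthogonal to all irreducible characters is orthogonal to the character of the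
  regular representation, hence vanishes at the identity.\<close>

theorem exists_Irr_sum_nonzero:
  assumes c: "c \<one> \<noteq> 0"
  shows "\<exists>\<chi>\<in>Irr H. (\<Sum>g\<in>carrier H. c g * \<chi> g) \<noteq> 0"
proof -
  define n where "n = card (carrier H)"
  obtain f where f: "bij_betw f {0..<n} (carrier H)"
    unfolding n_def using ex_bij_betw_nat_finite[OF fin] by blast
  have fH: "f i \<in> carrier H" if "i < n" for i using bij_betwE[OF f] that by simp
  have inj: "f i = f j \<longleftrightarrow> i = j" if "i < n" "j < n" for i j
    using f that by (auto simp: bij_betw_def inj_on_def)
  define \<rho> :: "'a \<Rightarrow> complex mat" where
    "\<rho> g = mat n n (\<lambda>(i, j). if f i = g \<otimes> f j then 1 else 0)" for g
  have \<rho>c: "\<rho> g \<in> carrier_mat n n" for g by (simp add: \<rho>_def)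
  have "representation H n \<rho>"
    unfolding representation_def
  proof (intro conjI ballI)
    fix g h assume g: "g \<in> carrier H" and h: "h \<in> carrier H"
    show "\<rho> (g \<otimes> h) = \<rho> g * \<rho> h"
    proof (rule eq_matI)
      fix i j assume "i < dim_row (\<rho> g * \<rho> h)" "j < dim_col (\<rho> g * \<rho> h)"
      then have ij: "i < n" "j < n" by (simp_all add: \<rho>_def)
      have "h \<otimes> f j \<in> f ` {0..<n}"
        using m_closed[OF h fH[OF ij(2)]] bij_betw_imp_surj_on[OF f] by simp
      then obtain k where k: "k < n" "f k = h \<otimes> f j" by force
      have "(\<rho> g * \<rho> h) $$ (i, j) = (\<Sum>x\<in>{0..<n}. \<rho> g $$ (i, x) * \<rho> h $$ (x, j))"
        by (rule mat_mult_entry[OF \<rho>c \<rho>c ij])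
      also have "\<dots> = (\<Sum>x\<in>{0..<n}. if x = k then \<rho> g $$ (i, k) else 0)"
        using ij k inj[OF _ k(1)] by (intro sum.cong) (auto simp: \<rho>_def)
      also have "\<dots> = \<rho> (g \<otimes> h) $$ (i, j)"
        using k ij g h fH[OF ij(2)] by (simp add: \<rho>_def m_assoc)
      finally show "\<rho> (g \<otimes> h) $$ (i, j) = (\<rho> g * \<rho> h) $$ (i, j)" ..
    qed (auto simp: \<rho>_def)
  next
    show "\<rho> \<one> = 1\<^sub>m n" using fH inj by (intro eq_matI) (auto simp: \<rho>_def)
  qed (rule \<rho>c)
  then obtain D where D: "set_mset D \<subseteq> Irr H" "\<And>g. g \<in> carrier H \<Longrightarrow> mat_trace (\<rho> g) = (\<Sum>\<chi>\<in>#D. \<chi> g)"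
    using representation_character_decomposition by blast
  have tr: "mat_trace (\<rho> g) = (if g = \<one> then of_nat n else 0)" if g: "g \<in> carrier H" for g
  proof -
    have "f i = g \<otimes> f i \<longleftrightarrow> g = \<one>" if "i < n" for i
      using g fH[OF that] l_cancel_one'[of "f i" g] by simp
    then show ?thesis by (simp add: mat_trace_def \<rho>_def)
  qed
  have "of_nat n * c \<one> = (\<Sum>g\<in>carrier H. if g = \<one> then c g * of_nat n else 0)"
    using fin by simp
  also have "\<dots> = (\<Sum>g\<in>carrier H. c g * mat_trace (\<rho> g))"
    by (intro sum.cong) (auto simp: tr)
  also have "\<dots> = (\<Sum>g\<in>carrier H. \<Sum>\<chi>\<in>#D. c g * \<chi> g)"
    using D(2) by (intro sum.cong refl) (simp add: sum_mset_distrib_left multiset.map_comp o_def)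
  also have "\<dots> = (\<Sum>\<chi>\<in>#D. \<Sum>g\<in>carrier H. c g * \<chi> g)"
    by (induction D) (simp_all add: sum.distrib)
  finally have "of_nat n * c \<one> = (\<Sum>\<chi>\<in>#D. \<Sum>g\<in>carrier H. c g * \<chi> g)" .
  moreover have "of_nat n * c \<one> \<noteq> 0" using c order_pos by (simp add: n_def Coset.order_def)
  ultimately have "(\<Sum>\<chi>\<in>#D. \<Sum>g\<in>carrier H. c g * \<chi> g) \<noteq> 0" by metis
  moreover have "(\<Sum>\<chi>\<in>#D. \<Sum>g\<in>carrier H. c g * \<chi> g) = 0" if "\<forall>\<chi>\<in>set_mset D. (\<Sum>g\<in>carrier H. c g * \<chi> g) = 0"
    using that by (induction D) auto
  ultimately show ?thesis using D(1) by blast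
qed

end

lemma sum_mset_eq_sum_count:
  fixes f :: "'b \<Rightarrow> 'a::comm_semiring_1"
  shows "(\<Sum>x\<in>#D. f x) = (\<Sum>x\<in>set_mset D. of_nat (count D x) * f x)"
proof (induction D)
  case (add y D)
  have "(\<Sum>x\<in>set_mset (add_mset y D). of_nat (count (add_mset y D) x) * f x) =
      (\<Sum>x\<in>insert y (set_mset D). of_nat (count D x) * f x + (if x = y then f y else 0))"
    by (intro sum.cong) (auto simp: algebra_simps)
  also have "\<dots> = (\<Sum>x\<in>insert y (set_mset D). of_nat (count D x) * f x) + f y"
    by (simp add: sum.distrib)
  also have "(\<Sum>x\<in>insert y (set_mset D). of_nat (count D x) * f x) = (\<Sum>x\<in>set_mset D. of_nat (count D x) * f x)"
    by (intro sum.mono_neutral_right) (auto simp: not_in_iff)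
  finally show ?case using add by (simp add: add.commute)
qed simp

section \<open>Clifford theory for a normal subgroup\<close>

context fin_group
begin

lemma Irr_class_function:
  assumes \<chi>: "\<chi> \<in> Irr H" and g: "g \<in> carrier H" and h: "h \<in> carrier H"
  shows "\<chi> (g \<otimes> h) = \<chi> (h \<otimes> g)"
proof -
  obtain d \<rho> where \<rho>: "irreducible_rep H d \<rho>" "\<And>g. g \<in> carrier H \<Longrightarrow> \<chi> g = mat_trace (\<rho> g)"
    using IrrE[OF \<chi>] by metis
  note \<rho>r = irreducible_repD(1)[OF \<rho>(1)]
  have "\<chi> (g \<otimes> h) = mat_trace (\<rho> g * \<rho> h)" using \<rho>(2) representationD(2)[OF \<rho>r g h] g h by simp
  also have "\<dots> = mat_trace (\<rho> h * \<rho> g)"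
    by (rule mat_trace_mult_comm[OF representationD(1)[OF \<rho>r g] representationD(1)[OF \<rho>r h]])
  also have "\<dots> = \<chi> (h \<otimes> g)" using \<rho>(2) representationD(2)[OF \<rho>r h g] g h by simp
  finally show ?thesis .
qed

lemma Irr_conj:
  assumes \<chi>: "\<chi> \<in> Irr H" and g: "g \<in> carrier H" and k: "k \<in> carrier H"
  shows "\<chi> (inv g \<otimes> k \<otimes> g) = \<chi> k"
  using Irr_class_function[OF \<chi>, of "inv g \<otimes> k" g] g k by (simp add: m_assoc[symmetric])

end

text \<open>The conjugate of a character of the normal subgroup \<open>M\<close>, again \<^const>\<open>undefined\<close> off \<open>M\<close> as the members of
  \<^const>\<open>Irr\<close> are.\<close>

definition conj_char :: "('g, 'b) monoid_scheme \<Rightarrow> 'g set \<Rightarrow> ('g \<Rightarrow> complex) \<Rightarrow> 'g \<Rightarrow> 'g \<Rightarrow> complex" where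
  "conj_char H M \<psi> g = restrict (\<lambda>k. \<psi> (g \<otimes>\<^bsub>H\<^esub> k \<otimes>\<^bsub>H\<^esub> inv\<^bsub>H\<^esub> g)) M"

locale fin_normal = fin_group H for H (structure) +
  fixes M
  assumes normal: "M \<lhd> H"
begin

abbreviation K where "K \<equiv> H\<lparr>carrier := M\<rparr>"

lemma sub: "subgroup M H" by (rule normal_imp_subgroup[OF normal])

lemma subM: "k \<in> M \<Longrightarrow> k \<in> carrier H" by (rule subgroup.mem_carrier[OF sub])

lemma M_inv: "k \<in> M \<Longrightarrow> inv k \<in> M" by (rule subgroup.m_inv_closed[OF sub])

lemma finM: "finite M" by (rule finite_subset[OF subgroup.subset[OF sub] fin])

lemma invK: "k \<in> M \<Longrightarrow> inv\<^bsub>K\<^esub> k = inv k" by (rule m_inv_consistent[OF sub])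

lemma fin_group_K: "fin_group K"
  unfolding fin_group_def fin_group_axioms_def
  using subgroup.subgroup_is_group[OF sub is_group] finM by simp

lemma conj_M: "g \<in> carrier H \<Longrightarrow> k \<in> M \<Longrightarrow> g \<otimes> k \<otimes> inv g \<in> M"
  by (rule normal.inv_op_closed2[OF normal])

lemma conj_M': "g \<in> carrier H \<Longrightarrow> k \<in> M \<Longrightarrow> inv g \<otimes> k \<otimes> g \<in> M"
  by (rule normal.inv_op_closed1[OF normal])

lemma bij_conj:
  assumes g: "g \<in> carrier H"
  shows "bij_betw (\<lambda>k. inv g \<otimes> k \<otimes> g) M M"
proof (rule bij_betw_byWitness[of _ "\<lambda>k. g \<otimes> k \<otimes> inv g"])
  show "\<forall>k\<in>M. g \<otimes> (inv g \<otimes> k \<otimes> g) \<otimes> inv g = k"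
    using g subM by (simp add: m_assoc) (simp add: m_assoc[symmetric])
  show "\<forall>k\<in>M. inv g \<otimes> (g \<otimes> k \<otimes> inv g) \<otimes> g = k"
    using g subM by (simp add: m_assoc) (simp add: m_assoc[symmetric])
  show "(\<lambda>k. inv g \<otimes> k \<otimes> g) ` M \<subseteq> M" using conj_M'[OF g] by (rule image_subsetI)
  show "(\<lambda>k. g \<otimes> k \<otimes> inv g) ` M \<subseteq> M" using conj_M[OF g] by (rule image_subsetI)
qed

lemma Irr_K_convolution:
  assumes "\<chi> \<in> Irr K" "\<psi> \<in> Irr K" "x \<in> M"
  shows "(\<Sum>k\<in>M. \<psi> (inv k) * \<chi> (k \<otimes> x)) = (if \<chi> = \<psi> then of_nat (card M) / \<psi> \<one> * \<psi> x else 0)"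
  using fin_group.Irr_convolution[OF fin_group_K assms(1,2), of x] assms(3)
  by (simp add: invK Coset.order_def cong: sum.cong)

lemma Irr_K_orthonormal:
  assumes "\<chi> \<in> Irr K" "\<psi> \<in> Irr K"
  shows "(\<Sum>k\<in>M. \<chi> k * \<psi> (inv k)) = (if \<chi> = \<psi> then of_nat (card M) else 0)"
  using fin_group.Irr_orthonormal[OF fin_group_K assms(1,2)]
  by (simp add: invK Coset.order_def cong: sum.cong)

lemma conj_char_Irr:
  assumes \<psi>: "\<psi> \<in> Irr K" and g: "g \<in> carrier H"
  shows "conj_char H M \<psi> g \<in> Irr K"
proof -
  interpret K: fin_group K by (rule fin_group_K)
  obtain d \<sigma> where \<sigma>: "irreducible_rep K d \<sigma>" "\<And>k. k \<in> carrier K \<Longrightarrow> \<psi> k = mat_trace (\<sigma> k)"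
    using K.IrrE[OF \<psi>] by metis
  have \<sigma>r: "representation K d \<sigma>" and d: "0 < d" using K.irreducible_repD(1,2)[OF \<sigma>(1)] by auto
  define \<tau> where "\<tau> k = \<sigma> (g \<otimes> k \<otimes> inv g)" for k
  have "representation K d \<tau>"
    unfolding representation_def
  proof (intro conjI ballI; simp)
    fix k assume k: "k \<in> M"
    show "\<tau> k \<in> carrier_mat d d"
      using representationD(1)[OF \<sigma>r] conj_M[OF g k] by (simp add: \<tau>_def)
    fix h assume h: "h \<in> M"
    have "g \<otimes> (k \<otimes> h) \<otimes> inv g = (g \<otimes> k \<otimes> inv g) \<otimes> (g \<otimes> h \<otimes> inv g)"
      using subM[OF k] subM[OF h] g by (simp add: m_assoc) (simp add: m_assoc[symmetric])
    then show "\<tau> (k \<otimes> h) = \<tau> k * \<tau> h"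
      using representationD(2)[OF \<sigma>r] conj_M[OF g k] conj_M[OF g h] by (simp add: \<tau>_def)
  next
    show "\<tau> \<one> = 1\<^sub>m d" using g representationD(3)[OF \<sigma>r] by (simp add: \<tau>_def)
  qed
  moreover have "W = {0\<^sub>v d} \<or> W = carrier_vec d" if W: "linear_subspace d W" "rep_invariant K \<tau> W" for W
  proof (rule K.irreducible_repD(3)[OF \<sigma>(1) W(1)])
    show "rep_invariant K \<sigma> W"
      unfolding rep_invariant_def
    proof (intro ballI; simp)
      fix k w assume k: "k \<in> M" and w: "w \<in> W"
      have "\<sigma> k = \<tau> (inv g \<otimes> k \<otimes> g)"
        using g subM[OF k] by (simp add: \<tau>_def m_assoc) (simp add: m_assoc[symmetric])
      then show "\<sigma> k *\<^sub>v w \<in> W" using W(2) conj_M'[OF g k] w by (simp add: rep_invariant_def)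
    qed
  qed
  ultimately have "irreducible_rep K d \<tau>" using d by (simp add: irreducible_rep_iff[OF K.group_axioms])
  moreover have "conj_char H M \<psi> g = restrict (\<lambda>k. mat_trace (\<tau> k)) (carrier K)"
  proof
    show "conj_char H M \<psi> g k = restrict (\<lambda>k. mat_trace (\<tau> k)) (carrier K) k" for k
      using \<sigma>(2)[of "g \<otimes> k \<otimes> inv g"] conj_M[OF g, of k] by (simp add: conj_char_def \<tau>_def)
  qed
  ultimately show ?thesis unfolding Irr_def by blast
qed

lemma restriction_decomposition:
  assumes \<phi>: "\<phi> \<in> Irr H"
  obtains D where "set_mset D \<subseteq> Irr K" "\<And>k. k \<in> M \<Longrightarrow> \<phi> k = (\<Sum>\<chi>\<in>#D. \<chi> k)"
proof -
  interpret K: fin_group K by (rule fin_group_K)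
  obtain d \<rho> where \<rho>: "irreducible_rep H d \<rho>" "\<And>g. g \<in> carrier H \<Longrightarrow> \<phi> g = mat_trace (\<rho> g)"
    using IrrE[OF \<phi>] by metis
  have \<rho>K: "representation K d \<rho>"
    using irreducible_repD(1)[OF \<rho>(1)] subM unfolding representation_def by simp
  obtain D where D: "set_mset D \<subseteq> Irr K" and "\<forall>k\<in>carrier K. mat_trace (\<rho> k) = (\<Sum>\<chi>\<in>#D. \<chi> k)"
    using K.representation_character_decomposition[OF \<rho>K] by (elim exE conjE)
  then have "\<phi> k = (\<Sum>\<chi>\<in>#D. \<chi> k)" if "k \<in> M" for k using that \<rho>(2)[OF subM] by simp
  with D show ?thesis by (rule that)
qed

text \<open>Convolving with \<open>\<psi>\<close> extracts the \<open>\<psi>\<close>-part of the restriction of \<open>\<phi>\<close>, a multiple of \<open>\<psi>\<close>; the multiple is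
  found at \<open>x = \<one>\<close>.\<close>

lemma restriction_convolution:
  assumes \<phi>: "\<phi> \<in> Irr H" and \<psi>: "\<psi> \<in> Irr K" and x: "x \<in> M"
  shows "(\<Sum>k\<in>M. \<psi> (inv k) * \<phi> (k \<otimes> x)) * \<psi> \<one> = (\<Sum>k\<in>M. \<phi> k * \<psi> (inv k)) * \<psi> x"
proof -
  interpret K: fin_group K by (rule fin_group_K)
  obtain D where D: "set_mset D \<subseteq> Irr K" "\<And>k. k \<in> M \<Longrightarrow> \<phi> k = (\<Sum>\<chi>\<in>#D. \<chi> k)"
    using restriction_decomposition[OF \<phi>] by metis
  have "(\<Sum>k\<in>M. \<psi> (inv k) * (\<Sum>\<chi>\<in>#D. \<chi> (k \<otimes> x))) * \<psi> \<one> = (\<Sum>k\<in>M. (\<Sum>\<chi>\<in>#D. \<chi> k) * \<psi> (inv k)) * \<psi> x"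
    using D(1)
  proof (induction D)
    case (add \<chi> D)
    then have \<chi>: "\<chi> \<in> Irr K" by simp
    have "(\<Sum>k\<in>M. \<psi> (inv k) * \<chi> (k \<otimes> x)) * \<psi> \<one> = (\<Sum>k\<in>M. \<chi> k * \<psi> (inv k)) * \<psi> x"
      unfolding Irr_K_convolution[OF \<chi> \<psi> x] Irr_K_orthonormal[OF \<chi> \<psi>]
      using K.Irr_one_nonzero[OF \<psi>] by simp
    with add show ?case by (simp add: distrib_left distrib_right sum.distrib)
  qed simp
  then show ?thesis using D(2) subgroup.m_closed[OF sub _ x] by (simp cong: sum.cong)
qed

lemma conj_back: "g \<in> carrier H \<Longrightarrow> k \<in> M \<Longrightarrow> g \<otimes> inv (inv g \<otimes> k \<otimes> g) \<otimes> inv g = inv k"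
  using subM[of k] by (simp add: inv_mult_group m_assoc) (simp add: m_assoc[symmetric])

lemma inner_conj_char:
  assumes \<phi>: "\<phi> \<in> Irr H" and g: "g \<in> carrier H"
  shows "(\<Sum>k\<in>M. \<phi> k * conj_char H M \<psi> g (inv k)) = (\<Sum>k\<in>M. \<phi> k * \<psi> (inv k))"
proof -
  have "(\<Sum>k\<in>M. \<phi> k * conj_char H M \<psi> g (inv k)) = (\<Sum>k\<in>M. \<phi> k * \<psi> (g \<otimes> inv k \<otimes> inv g))"
    by (intro sum.cong refl) (simp add: conj_char_def M_inv)
  also have "\<dots> = (\<Sum>k\<in>M. \<phi> (inv g \<otimes> k \<otimes> g) * \<psi> (g \<otimes> inv (inv g \<otimes> k \<otimes> g) \<otimes> inv g))"
    by (rule sum.reindex_bij_betw[OF bij_conj[OF g], symmetric])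
  also have "\<dots> = (\<Sum>k\<in>M. \<phi> k * \<psi> (inv k))"
    by (intro sum.cong refl) (simp add: conj_back[OF g] Irr_conj[OF \<phi> g] subM)
  finally show ?thesis .
qed

text \<open>The restriction of \<open>\<phi>\<close> is proportional to the sum of the conjugates of \<open>\<psi>\<close>. Both sides come from
  evaluating the sum over \<open>g\<close> and \<open>k\<close> of \<open>\<psi>(k\<inverse>) \<phi>(g\<inverse> k g x)\<close>: over \<open>g\<close> it is a class sum, and over \<open>k\<close> it is the
  convolution of \<open>\<phi>\<close> with a conjugate of \<open>\<psi>\<close>.\<close>

theorem clifford_average:
  assumes \<phi>: "\<phi> \<in> Irr H" and \<psi>: "\<psi> \<in> Irr K" and over: "(\<Sum>k\<in>M. \<phi> k * \<psi> (inv k)) \<noteq> 0" and x: "x \<in> M"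
  shows "of_nat (Coset.order H) * \<psi> \<one> * \<phi> x = \<phi> \<one> * (\<Sum>g\<in>carrier H. \<psi> (g \<otimes> x \<otimes> inv g))"
proof -
  define I where "I = (\<Sum>k\<in>M. \<phi> k * \<psi> (inv k))"
  define \<psi>' where "\<psi>' g = conj_char H M \<psi> g" for g
  have \<psi>': "\<psi>' g \<in> Irr K" if "g \<in> carrier H" for g unfolding \<psi>'_def by (rule conj_char_Irr[OF \<psi> that])
  have \<psi>'k: "\<psi>' g k = \<psi> (g \<otimes> k \<otimes> inv g)" if "k \<in> M" for g k using that by (simp add: \<psi>'_def conj_char_def)
  have \<psi>'1: "\<psi>' g \<one> = \<psi> \<one>" if "g \<in> carrier H" for g
    using that subgroup.one_closed[OF sub] by (simp add: \<psi>'k)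
  have "(\<Sum>g\<in>carrier H. \<Sum>k\<in>M. \<psi>' g (inv k) * \<phi> (k \<otimes> x)) =
      (\<Sum>g\<in>carrier H. \<Sum>k\<in>M. \<psi> (inv k) * \<phi> (inv g \<otimes> k \<otimes> g \<otimes> x))"
  proof (rule sum.cong[OF refl])
    fix g assume g: "g \<in> carrier H"
    have "(\<Sum>k\<in>M. \<psi>' g (inv k) * \<phi> (k \<otimes> x)) = (\<Sum>k\<in>M. \<psi> (g \<otimes> inv k \<otimes> inv g) * \<phi> (k \<otimes> x))"
      by (intro sum.cong refl) (simp add: \<psi>'k M_inv)
    also have "\<dots> = (\<Sum>k\<in>M. \<psi> (g \<otimes> inv (inv g \<otimes> k \<otimes> g) \<otimes> inv g) * \<phi> (inv g \<otimes> k \<otimes> g \<otimes> x))"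
      by (rule sum.reindex_bij_betw[OF bij_conj[OF g], symmetric])
    also have "\<dots> = (\<Sum>k\<in>M. \<psi> (inv k) * \<phi> (inv g \<otimes> k \<otimes> g \<otimes> x))"
      by (intro sum.cong refl) (simp add: conj_back[OF g])
    finally show "(\<Sum>k\<in>M. \<psi>' g (inv k) * \<phi> (k \<otimes> x)) = (\<Sum>k\<in>M. \<psi> (inv k) * \<phi> (inv g \<otimes> k \<otimes> g \<otimes> x))" .
  qed
  also have "\<dots> = (\<Sum>k\<in>M. \<Sum>g\<in>carrier H. \<psi> (inv k) * \<phi> (inv g \<otimes> k \<otimes> g \<otimes> x))" by (rule sum.swap)
  also have "\<dots> = (\<Sum>k\<in>M. of_nat (Coset.order H) / \<phi> \<one> * \<phi> x * (\<phi> k * \<psi> (inv k)))"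
  proof (rule sum.cong[OF refl])
    fix k assume k: "k \<in> M"
    have "(\<Sum>g\<in>carrier H. \<phi> (inv g \<otimes> k \<otimes> g \<otimes> x)) = (\<Sum>g\<in>carrier H. \<phi> (inv (inv g) \<otimes> k \<otimes> inv g \<otimes> x))"
      by (rule sum.reindex_bij_betw[OF bij_betw_inv, symmetric])
    also have "\<dots> = (\<Sum>g\<in>carrier H. \<phi> (g \<otimes> k \<otimes> inv g \<otimes> x))" by (intro sum.cong refl) simp
    also have "\<dots> = of_nat (Coset.order H) / \<phi> \<one> * \<phi> k * \<phi> x" by (rule Irr_class_sum[OF \<phi> subM[OF k] subM[OF x]])
    finally show "(\<Sum>g\<in>carrier H. \<psi> (inv k) * \<phi> (inv g \<otimes> k \<otimes> g \<otimes> x)) =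
        of_nat (Coset.order H) / \<phi> \<one> * \<phi> x * (\<phi> k * \<psi> (inv k))"
      by (simp add: sum_distrib_left[symmetric] mult_ac)
  qed
  also have "\<dots> = of_nat (Coset.order H) / \<phi> \<one> * \<phi> x * I"
    unfolding sum_distrib_left[symmetric] I_def ..
  finally have 1: "(\<Sum>g\<in>carrier H. \<Sum>k\<in>M. \<psi>' g (inv k) * \<phi> (k \<otimes> x)) = of_nat (Coset.order H) / \<phi> \<one> * \<phi> x * I" .
  have "(\<Sum>k\<in>M. \<psi>' g (inv k) * \<phi> (k \<otimes> x)) * \<psi> \<one> = I * \<psi> (g \<otimes> x \<otimes> inv g)" if g: "g \<in> carrier H" for g
    using restriction_convolution[OF \<phi> \<psi>'[OF g] x] inner_conj_char[OF \<phi> g, of \<psi>] \<psi>'1[OF g] \<psi>'k[OF x]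
    by (simp add: I_def \<psi>'_def)
  then have "(\<Sum>g\<in>carrier H. \<Sum>k\<in>M. \<psi>' g (inv k) * \<phi> (k \<otimes> x)) * \<psi> \<one> = I * (\<Sum>g\<in>carrier H. \<psi> (g \<otimes> x \<otimes> inv g))"
    by (simp add: sum_distrib_left sum_distrib_right)
  then have "I * (of_nat (Coset.order H) / \<phi> \<one> * \<phi> x * \<psi> \<one>) = I * (\<Sum>g\<in>carrier H. \<psi> (g \<otimes> x \<otimes> inv g))"
    unfolding 1 by (simp add: mult_ac)
  then have "of_nat (Coset.order H) / \<phi> \<one> * \<phi> x * \<psi> \<one> = (\<Sum>g\<in>carrier H. \<psi> (g \<otimes> x \<otimes> inv g))"
    by (simp only: mult_left_cancel[OF over[folded I_def]])
  then show ?thesis using Irr_one_nonzero[OF \<phi>] by (simp add: field_simps)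
qed

text \<open>By \<open>clifford_average\<close> the constituents of the restriction are exactly the conjugates of \<open>\<psi>\<close>, and
  conjugate characters occur with equal multiplicity \<open>e\<close>. The second equation counts the norm of the
  restriction, with \<open>t\<close> the number of distinct conjugates.\<close>

theorem clifford:
  assumes \<phi>: "\<phi> \<in> Irr H" and \<psi>: "\<psi> \<in> Irr K" and over: "(\<Sum>k\<in>M. \<phi> k * \<psi> (inv k)) \<noteq> 0"
  obtains e t :: nat where "\<phi> \<one> = of_nat (e * t) * \<psi> \<one>" "(\<Sum>k\<in>M. \<phi> k * \<phi> (inv k)) = of_nat (card M * (e\<^sup>2 * t))"
proof -
  interpret K: fin_group K by (rule fin_group_K)
  obtain D where D: "set_mset D \<subseteq> Irr K" "\<And>k. k \<in> M \<Longrightarrow> \<phi> k = (\<Sum>\<chi>\<in>#D. \<chi> k)"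
    using restriction_decomposition[OF \<phi>] by metis
  define S where "S = set_mset D"
  have S: "finite S" "\<And>\<chi>. \<chi> \<in> S \<Longrightarrow> \<chi> \<in> Irr K" using D(1) by (auto simp: S_def)
  define a :: "('a \<Rightarrow> complex) \<Rightarrow> complex" where "a \<chi> = of_nat (count D \<chi>)" for \<chi>
  have a0: "a \<chi> = 0 \<longleftrightarrow> \<chi> \<notin> S" for \<chi> by (simp add: a_def S_def count_eq_zero_iff)
  have dec: "\<phi> k = (\<Sum>\<chi>\<in>S. a \<chi> * \<chi> k)" if k: "k \<in> M" for k
    unfolding D(2)[OF k] S_def a_def by (rule sum_mset_eq_sum_count)
  have inner: "(\<Sum>k\<in>M. \<phi> k * \<chi> (inv k)) = of_nat (card M) * a \<chi>" if \<chi>: "\<chi> \<in> Irr K" for \<chi>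
  proof -
    have "(\<Sum>k\<in>M. \<phi> k * \<chi> (inv k)) = (\<Sum>k\<in>M. \<Sum>\<theta>\<in>S. a \<theta> * (\<theta> k * \<chi> (inv k)))"
      by (intro sum.cong refl) (simp add: dec sum_distrib_right mult.assoc)
    also have "\<dots> = (\<Sum>\<theta>\<in>S. \<Sum>k\<in>M. a \<theta> * (\<theta> k * \<chi> (inv k)))" by (rule sum.swap)
    also have "\<dots> = (\<Sum>\<theta>\<in>S. a \<theta> * (\<Sum>k\<in>M. \<theta> k * \<chi> (inv k)))" by (simp add: sum_distrib_left)
    also have "\<dots> = (\<Sum>\<theta>\<in>S. if \<theta> = \<chi> then a \<chi> * of_nat (card M) else 0)"
      by (intro sum.cong refl) (simp add: Irr_K_orthonormal[OF S(2) \<chi>])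
    also have "\<dots> = of_nat (card M) * a \<chi>" using S(1) a0[of \<chi>] by simp
    finally show ?thesis .
  qed
  define e where "e = count D \<psi>"
  have ae: "a \<psi> = of_nat e" by (simp add: a_def e_def)
  have M0: "card M \<noteq> 0" using K.order_pos by (simp add: Coset.order_def)
  define \<psi>' where "\<psi>' g = conj_char H M \<psi> g" for g
  have \<psi>': "\<psi>' g \<in> Irr K" if "g \<in> carrier H" for g unfolding \<psi>'_def by (rule conj_char_Irr[OF \<psi> that])
  have \<psi>'k: "\<psi>' g k = \<psi> (g \<otimes> k \<otimes> inv g)" if "k \<in> M" for g k using that by (simp add: \<psi>'_def conj_char_def)
  have \<psi>'1: "\<psi>' g \<one> = \<psi> \<one>" if "g \<in> carrier H" for g
    using that subgroup.one_closed[OF sub] by (simp add: \<psi>'k)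
  have mult_conj: "a (\<psi>' g) = of_nat e" if g: "g \<in> carrier H" for g
    using inner[OF \<psi>'[OF g]] inner[OF \<psi>] inner_conj_char[OF \<phi> g, of \<psi>] M0 ae by (simp add: \<psi>'_def)
  define c where "c = of_nat (Coset.order H) * \<psi> \<one>"
  have c0: "c \<noteq> 0" using order_pos K.Irr_one_nonzero[OF \<psi>] by (simp add: c_def)
  have key: "c * \<phi> x = \<phi> \<one> * (\<Sum>g\<in>carrier H. \<psi>' g x)" if x: "x \<in> M" for x
    unfolding c_def using clifford_average[OF \<phi> \<psi> over x] by (simp add: \<psi>'k[OF x])
  have orbit: "\<exists>g\<in>carrier H. \<chi> = \<psi>' g" if \<chi>: "\<chi> \<in> S" for \<chi>
  proof (rule ccontr)
    assume no: "\<not> (\<exists>g\<in>carrier H. \<chi> = \<psi>' g)"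
    have "c * (of_nat (card M) * a \<chi>) = (\<Sum>k\<in>M. c * \<phi> k * \<chi> (inv k))"
      unfolding inner[OF S(2)[OF \<chi>], symmetric] by (simp add: sum_distrib_left mult_ac)
    also have "\<dots> = (\<Sum>k\<in>M. \<Sum>g\<in>carrier H. \<phi> \<one> * (\<psi>' g k * \<chi> (inv k)))"
      by (intro sum.cong refl) (simp add: key sum_distrib_left sum_distrib_right mult_ac)
    also have "\<dots> = (\<Sum>g\<in>carrier H. \<Sum>k\<in>M. \<phi> \<one> * (\<psi>' g k * \<chi> (inv k)))" by (rule sum.swap)
    also have "\<dots> = (\<Sum>g\<in>carrier H. \<phi> \<one> * (\<Sum>k\<in>M. \<psi>' g k * \<chi> (inv k)))" by (simp add: sum_distrib_left)
    also have "\<dots> = 0"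
      using no by (intro sum.neutral ballI) (auto simp: Irr_K_orthonormal[OF \<psi>' S(2)[OF \<chi>]])
    finally show False using c0 M0 a0[of \<chi>] \<chi> by simp
  qed
  have a_e: "a \<chi> = of_nat e" and \<chi>1: "\<chi> \<one> = \<psi> \<one>" if \<chi>: "\<chi> \<in> S" for \<chi>
  proof -
    obtain g where g: "g \<in> carrier H" "\<chi> = \<psi>' g" using orbit[OF \<chi>] ..
    show "a \<chi> = of_nat e" "\<chi> \<one> = \<psi> \<one>" unfolding g(2) by (rule mult_conj[OF g(1)], rule \<psi>'1[OF g(1)])
  qed
  show ?thesis
  proof (rule that)
    have "\<phi> \<one> = (\<Sum>\<chi>\<in>S. of_nat e * \<psi> \<one>)"
      unfolding dec[OF subgroup.one_closed[OF sub]] by (intro sum.cong refl) (simp add: a_e \<chi>1)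
    then show "\<phi> \<one> = of_nat (e * card S) * \<psi> \<one>" by (simp add: mult_ac)
    have "(\<Sum>k\<in>M. \<phi> k * \<phi> (inv k)) = (\<Sum>k\<in>M. \<Sum>\<theta>\<in>S. a \<theta> * (\<phi> k * \<theta> (inv k)))"
      by (intro sum.cong refl) (simp add: dec[OF M_inv] sum_distrib_left mult_ac)
    also have "\<dots> = (\<Sum>\<theta>\<in>S. \<Sum>k\<in>M. a \<theta> * (\<phi> k * \<theta> (inv k)))" by (rule sum.swap)
    also have "\<dots> = (\<Sum>\<theta>\<in>S. a \<theta> * (of_nat (card M) * a \<theta>))"
      by (intro sum.cong refl) (simp add: sum_distrib_left[symmetric] inner S(2))
    also have "\<dots> = (\<Sum>\<theta>\<in>S. of_nat (card M * e\<^sup>2))"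
      by (intro sum.cong refl) (simp add: a_e power2_eq_square)
    finally show "(\<Sum>k\<in>M. \<phi> k * \<phi> (inv k)) = of_nat (card M * (e\<^sup>2 * card S))" by (simp add: mult_ac)
  qed
qed

end

section \<open>Twisting by linear characters\<close>

text \<open>A set of roots of unity that is closed under multiplication is a subgroup, to which Lagrange's theorem
  applies.\<close>

lemma card_roots_of_unity_dvd:
  fixes A :: "complex set"
  assumes m: "0 < m" and A: "A \<subseteq> {z. z ^ m = 1}" and one: "1 \<in> A"
    and closed: "\<And>x y. x \<in> A \<Longrightarrow> y \<in> A \<Longrightarrow> x * y \<in> A"
  shows "card A dvd m"
proof -
  define U :: "complex monoid" where "U = \<lparr>carrier = {z. z ^ m = 1}, monoid.mult = (*), one = 1\<rparr>"
  have U: "group U"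
  proof (rule groupI)
    show "\<exists>y\<in>carrier U. y \<otimes>\<^bsub>U\<^esub> x = \<one>\<^bsub>U\<^esub>" if "x \<in> carrier U" for x
    proof (intro bexI[of _ "inverse x"])
      have "x \<noteq> 0" using that m by (auto simp: U_def power_0_left)
      then show "inverse x \<otimes>\<^bsub>U\<^esub> x = \<one>\<^bsub>U\<^esub>" by (simp add: U_def)
      show "inverse x \<in> carrier U" using that by (simp add: U_def power_inverse)
    qed
  qed (auto simp: U_def power_mult_distrib)
  interpret U: group U by (rule U)
  have fin: "finite (carrier U)" using finite_roots_unity[of m, where 'a = complex] m by (simp add: U_def)
  have pow: "x [^]\<^bsub>U\<^esub> (k :: nat) = x ^ k" for x k by (induction k) (auto simp: U_def)
  have "subgroup A U"
  proof (rule U.subgroupI)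
    show "inv\<^bsub>U\<^esub> x \<in> A" if x: "x \<in> A" for x
    proof -
      have "x ^ k \<in> A" for k using one closed x by (induction k) auto
      moreover have "inv\<^bsub>U\<^esub> x = x ^ (m - 1)"
      proof (rule U.inv_equality)
        have "x ^ (m - 1) * x = x ^ m" using m by (metis Suc_diff_1 power_Suc2)
        then show "x ^ (m - 1) \<otimes>\<^bsub>U\<^esub> x = \<one>\<^bsub>U\<^esub>" using x A by (auto simp: U_def)
        show "x \<in> carrier U" using x A by (auto simp: U_def)
        then have "x ^ m = 1" by (simp add: U_def)
        then show "x ^ (m - 1) \<in> carrier U"
          by (simp add: U_def power_mult[symmetric] mult.commute[of _ m]) (simp add: power_mult)
      qed
      ultimately show ?thesis by simp
    qed
  qed (use A one closed in \<open>auto simp: U_def\<close>)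
  then have "card A dvd Coset.order U" using U.lagrange by (metis dvd_triv_right)
  then show ?thesis using card_roots_unity_eq[OF m] by (simp add: U_def Coset.order_def)
qed

text \<open>Only an exponent \<open>m\<close> of the linear character is recorded, because it is inherited by subgroups, unlike the
  exact order.\<close>

locale linear_char = fin_group H for H (structure) +
  fixes \<nu> :: "'a \<Rightarrow> complex" and m :: nat
  assumes m: "0 < m"
    and lin_mult: "\<And>g h. g \<in> carrier H \<Longrightarrow> h \<in> carrier H \<Longrightarrow> \<nu> (g \<otimes> h) = \<nu> g * \<nu> h"
    and lin_pow: "\<And>g. g \<in> carrier H \<Longrightarrow> \<nu> g ^ m = 1"
begin

definition lin_ker where "lin_ker = {g \<in> carrier H. \<nu> g = 1}"

lemma lin_nz: "g \<in> carrier H \<Longrightarrow> \<nu> g \<noteq> 0"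
  using lin_pow m by (metis power_0_left less_irrefl zero_neq_one)

lemma lin_one: "\<nu> \<one> = 1"
  using lin_mult[of \<one> \<one>] lin_nz[of \<one>] by simp

lemma lin_inv: "g \<in> carrier H \<Longrightarrow> \<nu> (inv g) * \<nu> g = 1"
  using lin_mult[of "inv g" g] lin_one by simp

lemma order_eq_image_times_ker: "Coset.order H = card (\<nu> ` carrier H) * card lin_ker"
proof -
  have fiber: "card {g \<in> carrier H. \<nu> g = v} = card lin_ker" if v: "v \<in> \<nu> ` carrier H" for v
  proof -
    obtain x where x: "x \<in> carrier H" "\<nu> x = v" using v by (elim imageE) simp
    have "bij_betw (\<lambda>g. x \<otimes> g) lin_ker {g \<in> carrier H. \<nu> g = v}"
    proof (rule bij_betw_byWitness[of _ "\<lambda>g. inv x \<otimes> g"])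
      show "\<forall>g\<in>lin_ker. inv x \<otimes> (x \<otimes> g) = g"
        using x by (auto simp: lin_ker_def m_assoc[symmetric])
      show "\<forall>g\<in>{g \<in> carrier H. \<nu> g = v}. x \<otimes> (inv x \<otimes> g) = g"
        using x by (auto simp: m_assoc[symmetric])
      show "(\<lambda>g. x \<otimes> g) ` lin_ker \<subseteq> {g \<in> carrier H. \<nu> g = v}"
        using x by (auto simp: lin_ker_def lin_mult)
      show "(\<lambda>g. inv x \<otimes> g) ` {g \<in> carrier H. \<nu> g = v} \<subseteq> lin_ker"
        using x lin_inv[OF x(1)] by (auto simp: lin_ker_def lin_mult)
    qed
    then show ?thesis by (rule bij_betw_same_card[symmetric])
  qed
  have "Coset.order H = (\<Sum>g\<in>carrier H. 1)" by (simp add: Coset.order_def)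
  also have "\<dots> = (\<Sum>v\<in>\<nu> ` carrier H. \<Sum>g | g \<in> carrier H \<and> \<nu> g = v. 1)"
    using fin by (intro sum.group[symmetric]) auto
  also have "\<dots> = (\<Sum>v\<in>\<nu> ` carrier H. card lin_ker)"
    using fiber by (intro sum.cong refl) simp
  finally show ?thesis by simp
qed

lemma card_image_dvd: "card (\<nu> ` carrier H) dvd m"
proof (rule card_roots_of_unity_dvd[OF m])
  show "\<nu> ` carrier H \<subseteq> {z. z ^ m = 1}" by (rule image_subsetI) (simp add: lin_pow)
  show "1 \<in> \<nu> ` carrier H" by (rule image_eqI[of _ _ "\<one>"]) (simp_all add: lin_one)
  show "x * y \<in> \<nu> ` carrier H" if "x \<in> \<nu> ` carrier H" "y \<in> \<nu> ` carrier H" for x y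
  proof -
    obtain g where g: "x = \<nu> g" "g \<in> carrier H" using \<open>x \<in> \<nu> ` carrier H\<close> by (rule imageE)
    obtain h where h: "y = \<nu> h" "h \<in> carrier H" using \<open>y \<in> \<nu> ` carrier H\<close> by (rule imageE)
    show ?thesis using g h by (intro image_eqI[of _ _ "g \<otimes> h"]) (simp_all add: lin_mult)
  qed
qed

lemma twist_Irr:
  assumes \<phi>: "\<phi> \<in> Irr H"
  shows "restrict (\<lambda>g. \<nu> g ^ j * \<phi> g) (carrier H) \<in> Irr H"
proof -
  obtain d \<rho> where \<rho>: "irreducible_rep H d \<rho>" "\<And>g. g \<in> carrier H \<Longrightarrow> \<phi> g = mat_trace (\<rho> g)"
    using IrrE[OF \<phi>] by metis
  note \<rho>r = irreducible_repD(1)[OF \<rho>(1)]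
  define \<tau> where "\<tau> g = \<nu> g ^ j \<cdot>\<^sub>m \<rho> g" for g
  have "representation H d \<tau>"
    unfolding representation_def
  proof (intro conjI ballI)
    show "\<tau> g \<in> carrier_mat d d" if "g \<in> carrier H" for g
      using representationD(1)[OF \<rho>r that] by (simp add: \<tau>_def)
    fix g h assume g: "g \<in> carrier H" and h: "h \<in> carrier H"
    note \<rho>g = representationD(1)[OF \<rho>r g] and \<rho>h = representationD(1)[OF \<rho>r h]
    have "\<tau> g * \<tau> h = \<nu> g ^ j \<cdot>\<^sub>m (\<nu> h ^ j \<cdot>\<^sub>m (\<rho> g * \<rho> h))"
      unfolding \<tau>_def using mult_smult_assoc_mat[OF \<rho>g smult_carrier_mat[OF \<rho>h]] mult_smult_distrib[OF \<rho>g \<rho>h]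
      by metis
    also have "\<dots> = \<tau> (g \<otimes> h)"
      unfolding \<tau>_def lin_mult[OF g h] representationD(2)[OF \<rho>r g h]
      by (rule eq_matI) (auto simp: power_mult_distrib)
    finally show "\<tau> (g \<otimes> h) = \<tau> g * \<tau> h" ..
  next
    show "\<tau> \<one> = 1\<^sub>m d" unfolding \<tau>_def lin_one representationD(3)[OF \<rho>r] by (intro eq_matI) auto
  qed
  moreover have "W = {0\<^sub>v d} \<or> W = carrier_vec d" if W: "linear_subspace d W" "rep_invariant H \<tau> W" for W
  proof (rule irreducible_repD(3)[OF \<rho>(1) W(1)])
    show "rep_invariant H \<rho> W"
      unfolding rep_invariant_def
    proof (intro ballI)
      fix g w assume g: "g \<in> carrier H" and w: "w \<in> W"
      note \<rho>g = representationD(1)[OF \<rho>r g]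
      have wc: "w \<in> carrier_vec d" using W(1) w by (auto simp: linear_subspace_def)
      have "inverse (\<nu> g ^ j) \<cdot>\<^sub>v (\<tau> g *\<^sub>v w) \<in> W"
        using W g w by (auto simp: linear_subspace_def rep_invariant_def)
      moreover have "inverse (\<nu> g ^ j) \<cdot>\<^sub>v (\<tau> g *\<^sub>v w) = \<rho> g *\<^sub>v w"
        using \<rho>g wc lin_nz[OF g]
        by (intro eq_vecI) (auto simp: \<tau>_def scalar_prod_def sum_distrib_left field_simps)
      ultimately show "\<rho> g *\<^sub>v w \<in> W" by simp
    qed
  qed
  ultimately have "irreducible_rep H d \<tau>"
    using irreducible_repD(2)[OF \<rho>(1)] by (simp add: irreducible_rep_iff[OF group_axioms])
  moreover have "restrict (\<lambda>g. \<nu> g ^ j * \<phi> g) (carrier H) = restrict (\<lambda>g. mat_trace (\<tau> g)) (carrier H)"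
    using \<rho>(2) by (intro restrict_ext) (simp add: \<tau>_def mat_trace_smult[OF representationD(1)[OF \<rho>r]])
  ultimately show ?thesis unfolding Irr_def by blast
qed

text \<open>The indicator function of the kernel is the average of the powers of \<open>\<nu>\<close>, so the norm of \<open>\<phi>\<close> on the kernel
  is an average of the inner products of \<open>\<phi>\<close> with its twists \<open>\<nu>\<^sup>j \<phi>\<close>. The number \<open>b\<close> of exponents \<open>j < m\<close> whose
  twist fixes \<open>\<phi>\<close> divides \<open>m\<close>, since these exponents are the multiples of a divisor of \<open>m\<close>.\<close>

theorem norm_on_lin_ker:
  assumes \<phi>: "\<phi> \<in> Irr H"
  obtains b where "b dvd m"
    "of_nat m * (\<Sum>g\<in>lin_ker. \<phi> g * \<phi> (inv g)) = (of_nat (Coset.order H * b) :: complex)"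
proof -
  define J where "J = {j. \<forall>g\<in>carrier H. \<nu> g ^ j * \<phi> g = \<phi> g}"
  define b where "b = card {j. j < m \<and> j \<in> J}"
  have J0: "0 \<in> J" and Jm: "m \<in> J" using lin_pow by (auto simp: J_def)
  have Jadd: "i + j \<in> J \<longleftrightarrow> i \<in> J" if "j \<in> J" for i j
  proof -
    have eq: "\<nu> g ^ (i + j) * \<phi> g = \<nu> g ^ i * \<phi> g" if "g \<in> carrier H" for g
      using \<open>j \<in> J\<close> that by (simp add: J_def power_add mult.assoc)
    show ?thesis unfolding J_def mem_Collect_eq by (intro ball_cong refl) (simp only: eq)
  qed
  define s where "s = (LEAST j. 0 < j \<and> j \<in> J)"
  have s: "0 < s" "s \<in> J" using LeastI[of "\<lambda>j. 0 < j \<and> j \<in> J" m] Jm m by (auto simp: s_def)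
  have s_least: "s \<le> k" if "0 < k" "k \<in> J" for k
    unfolding s_def by (rule Least_le) (simp add: that)
  have smult: "s * i \<in> J" for i
    using Jadd[OF s(2)] by (induction i) (simp_all add: J0 add.commute[of s])
  have Jiff: "j \<in> J \<longleftrightarrow> s dvd j" for j
  proof
    assume "j \<in> J"
    then have "j mod s \<in> J" using Jadd[OF smult[of "j div s"], of "j mod s"] by simp
    moreover have "j mod s < s" using s by simp
    ultimately have "\<not> 0 < j mod s" using s_least[of "j mod s"] by linarith
    then show "s dvd j" by (simp add: mod_eq_0_iff_dvd)
  qed (auto simp: smult)
  have sm: "s dvd m" using Jm Jiff by simp
  have "bij_betw (\<lambda>i. s * i) {..<m div s} {j. j < m \<and> j \<in> J}"
  proof (rule bij_betw_byWitness[of _ "\<lambda>j. j div s"])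
    show "(\<lambda>i. s * i) ` {..<m div s} \<subseteq> {j. j < m \<and> j \<in> J}"
      using s sm by (auto simp: Jiff less_mult_imp_div_less elim!: dvdE)
    show "(\<lambda>j. j div s) ` {j. j < m \<and> j \<in> J} \<subseteq> {..<m div s}"
      using s sm by (auto simp: Jiff elim!: dvdE)
  qed (use s in \<open>auto simp: Jiff\<close>)
  then have "b = m div s" unfolding b_def using bij_betw_same_card by fastforce
  then have bm: "b dvd m" using sm by (metis dvd_mult_div_cancel dvd_triv_right)
  have geo: "(\<Sum>j<m. \<nu> g ^ j) = (if \<nu> g = 1 then of_nat m else 0)" if g: "g \<in> carrier H" for g
    using geometric_sum[of "\<nu> g" m] lin_pow[OF g] by simp
  have "of_nat m * (\<Sum>g\<in>lin_ker. \<phi> g * \<phi> (inv g)) = (\<Sum>g\<in>carrier H. if \<nu> g = 1 then of_nat m * (\<phi> g * \<phi> (inv g)) else 0)"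
    unfolding lin_ker_def sum_distrib_left using fin by (rule sum.inter_filter)
  also have "\<dots> = (\<Sum>g\<in>carrier H. \<Sum>j<m. \<nu> g ^ j * \<phi> g * \<phi> (inv g))"
  proof (rule sum.cong[OF refl])
    fix g assume g: "g \<in> carrier H"
    have "(\<Sum>j<m. \<nu> g ^ j * \<phi> g * \<phi> (inv g)) = (\<Sum>j<m. \<nu> g ^ j) * (\<phi> g * \<phi> (inv g))"
      by (simp add: sum_distrib_right mult.assoc)
    then show "(if \<nu> g = 1 then of_nat m * (\<phi> g * \<phi> (inv g)) else 0) = (\<Sum>j<m. \<nu> g ^ j * \<phi> g * \<phi> (inv g))"
      unfolding geo[OF g] by simp
  qed
  also have "\<dots> = (\<Sum>j<m. \<Sum>g\<in>carrier H. \<nu> g ^ j * \<phi> g * \<phi> (inv g))" by (rule sum.swap)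
  also have "\<dots> = (\<Sum>j<m. if j \<in> J then of_nat (Coset.order H) else 0)"
  proof (rule sum.cong[OF refl])
    fix j
    define \<chi> where "\<chi> = restrict (\<lambda>g. \<nu> g ^ j * \<phi> g) (carrier H)"
    have \<chi>: "\<chi> \<in> Irr H" unfolding \<chi>_def by (rule twist_Irr[OF \<phi>])
    have "\<chi> = \<phi> \<longleftrightarrow> j \<in> J"
    proof
      show "j \<in> J" if "\<chi> = \<phi>"
      proof -
        have "\<nu> g ^ j * \<phi> g = \<phi> g" if "g \<in> carrier H" for g
          using fun_cong[OF \<open>\<chi> = \<phi>\<close>, of g] that by (simp add: \<chi>_def)
        then show ?thesis by (simp add: J_def)
      qed
      show "\<chi> = \<phi>" if "j \<in> J"
        by (rule Irr_eqI[OF \<chi> \<phi>]) (use that in \<open>simp add: \<chi>_def J_def\<close>)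
    qed
    moreover have "(\<Sum>g\<in>carrier H. \<nu> g ^ j * \<phi> g * \<phi> (inv g)) = (\<Sum>g\<in>carrier H. \<chi> g * \<phi> (inv g))"
      by (intro sum.cong refl) (simp add: \<chi>_def)
    ultimately show "(\<Sum>g\<in>carrier H. \<nu> g ^ j * \<phi> g * \<phi> (inv g)) = (if j \<in> J then of_nat (Coset.order H) else 0)"
      using Irr_orthonormal[OF \<chi> \<phi>] by simp
  qed
  also have "\<dots> = (\<Sum>j\<in>{j \<in> {..<m}. j \<in> J}. of_nat (Coset.order H))" by (rule sum.inter_filter[symmetric]) simp
  also have "\<dots> = of_nat (Coset.order H * b)" by (simp add: b_def)
  finally show ?thesis using bm that by blast
qed

text \<open>Write \<open>c = e t d\<close> by Clifford's theorem. On the kernel \<open>M \<times> Z\<close> of \<open>\<nu>\<close>, the sum of \<open>|\<phi>|\<^sup>2\<close> is \<open>|M| |Z| e\<^sup>2 t\<close>, as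
  \<open>\<phi>\<close> is trivial on \<open>Z\<close>. Comparison with \<open>norm_on_lin_ker\<close> gives \<open>m e\<^sup>2 t = w b\<close>, where \<open>w = |H : M Z|\<close> and \<open>b\<close> divide \<open>m\<close>
  and so are prime to \<open>l\<close>. Hence \<open>l\<close> does not divide \<open>e t\<close>.\<close>

theorem multiplicity_degree_eq:
  fixes l :: nat
  assumes nM: "M \<lhd> H" and Z: "subgroup Z H" and disj: "M \<inter> Z = {\<one>}"
    and ker: "lin_ker = M <#> Z"
    and l: "prime l" "\<not> l dvd m"
    and \<phi>: "\<phi> \<in> Irr H" and triv: "\<And>g z. g \<in> carrier H \<Longrightarrow> z \<in> Z \<Longrightarrow> \<phi> (g \<otimes> z) = \<phi> g"
    and \<psi>: "\<psi> \<in> Irr (H\<lparr>carrier := M\<rparr>)" and over: "(\<Sum>k\<in>M. \<phi> k * \<psi> (inv k)) \<noteq> 0"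
    and c: "\<phi> \<one> = of_nat c" and d: "\<psi> \<one> = of_nat d"
  shows "multiplicity l c = multiplicity l d"
    "multiplicity l (Coset.order H) = multiplicity l (card M * card Z)"
proof -
  interpret N: fin_normal H M
    using fin_group_axioms nM by (intro fin_normal.intro fin_normal_axioms.intro)
  have Zc: "z \<in> carrier H" if "z \<in> Z" for z by (rule subgroup.mem_carrier[OF Z that])
  have finZ: "finite Z" by (rule finite_subset[OF subgroup.subset[OF Z] fin])
  have inj: "inj_on (\<lambda>(k, z). k \<otimes> z) (M \<times> Z)"
  proof (rule inj_onI, clarify)
    fix k z k' z' assume k: "k \<in> M" "k' \<in> M" and z: "z \<in> Z" "z' \<in> Z" and eq: "k \<otimes> z = k' \<otimes> z'"
    note kc = N.subM[OF k(1)] N.subM[OF k(2)] and zc = Zc[OF z(1)] Zc[OF z(2)]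
    have "inv k' \<otimes> k = inv k' \<otimes> (k \<otimes> z) \<otimes> inv z" using kc zc by (simp add: m_assoc)
    also have "\<dots> = z' \<otimes> inv z" unfolding eq using kc zc by (simp add: m_assoc[symmetric])
    finally have x: "inv k' \<otimes> k = z' \<otimes> inv z" .
    have "inv k' \<otimes> k \<in> M" using k N.M_inv subgroup.m_closed[OF N.sub] by blast
    moreover have "z' \<otimes> inv z \<in> Z" using z subgroup.m_inv_closed[OF Z] subgroup.m_closed[OF Z] by blast
    ultimately have "inv k' \<otimes> k = \<one>" "z' \<otimes> inv z = \<one>" using disj x by auto
    then have "k = k'" "z' = z"
      using kc zc inv_equality inv_inv inv_closed by (metis, metis)
    then show "k = k' \<and> z = z'" by simp
  qed
  have img: "M <#> Z = (\<lambda>(k, z). k \<otimes> z) ` (M \<times> Z)" by (auto simp: set_mult_def)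
  have cardMZ: "card (M <#> Z) = card M * card Z"
    unfolding img card_image[OF inj] by (simp add: card_cartesian_product)
  define w where "w = card (\<nu> ` carrier H)"
  have ord: "Coset.order H = w * (card M * card Z)"
    using order_eq_image_times_ker unfolding ker cardMZ w_def .
  have lw: "\<not> l dvd w" using dvd_trans[OF _ card_image_dvd, of l] l(2) unfolding w_def by metis
  have w0: "w \<noteq> 0" using lw by (intro notI) simp
  have pos: "card M \<noteq> 0" "card Z \<noteq> 0" using ord order_pos by (auto intro!: Nat.gr0I)
  have mw: "multiplicity l w = 0" using lw by (simp add: not_dvd_imp_multiplicity_0)
  have lp: "prime_elem l" using l(1) by simp
  show "multiplicity l (Coset.order H) = multiplicity l (card M * card Z)"
    unfolding ord using prime_elem_multiplicity_mult_distrib[OF lp w0, of "card M * card Z"] pos mw by simp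
  obtain b where b: "b dvd m"
    "of_nat m * (\<Sum>g\<in>lin_ker. \<phi> g * \<phi> (inv g)) = (of_nat (Coset.order H * b) :: complex)"
    by (rule norm_on_lin_ker[OF \<phi>])
  obtain e t where et: "\<phi> \<one> = of_nat (e * t) * \<psi> \<one>" "(\<Sum>k\<in>M. \<phi> k * \<phi> (inv k)) = of_nat (card M * (e\<^sup>2 * t))"
    by (rule N.clifford[OF \<phi> \<psi> over])
  have "(\<Sum>g\<in>lin_ker. \<phi> g * \<phi> (inv g)) = (\<Sum>p\<in>M \<times> Z. \<phi> (fst p \<otimes> snd p) * \<phi> (inv (fst p \<otimes> snd p)))"
    unfolding ker img by (subst sum.reindex[OF inj]) (simp add: case_prod_unfold)
  also have "\<dots> = (\<Sum>p\<in>M \<times> Z. \<phi> (fst p) * \<phi> (inv (fst p)))"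
  proof (rule sum.cong[OF refl])
    fix p assume "p \<in> M \<times> Z"
    then have p: "fst p \<in> carrier H" "snd p \<in> Z" using N.subM by auto
    show "\<phi> (fst p \<otimes> snd p) * \<phi> (inv (fst p \<otimes> snd p)) = \<phi> (fst p) * \<phi> (inv (fst p))"
      using Irr_inv[OF \<phi> m_closed[OF p(1) Zc[OF p(2)]]] Irr_inv[OF \<phi> p(1)] triv[OF p] by simp
  qed
  also have "\<dots> = of_nat (card Z) * (\<Sum>k\<in>M. \<phi> k * \<phi> (inv k))"
    using sum.cartesian_product[of "\<lambda>k z. \<phi> k * \<phi> (inv k)" Z M, symmetric]
    by (simp add: case_prod_unfold sum_distrib_left)
  finally have "(of_nat (m * (card Z * (card M * (e\<^sup>2 * t)))) :: complex) = of_nat (w * (card M * card Z) * b)"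
    using b(2) unfolding et(2) ord by (simp add: mult_ac)
  then have "m * (card Z * (card M * (e\<^sup>2 * t))) = w * (card M * card Z) * b" by (simp only: of_nat_eq_iff)
  then have eq: "m * (e\<^sup>2 * t) = w * b" using pos by (simp add: mult_ac)
  have lb: "\<not> l dvd b" using dvd_trans[OF _ b(1), of l] l(2) by metis
  have "\<not> l dvd m * (e\<^sup>2 * t)" unfolding eq prime_dvd_mult_iff[OF l(1)] using lw lb by simp
  then have "\<not> l dvd e * t" unfolding prime_dvd_mult_iff[OF l(1)] power2_eq_square by blast
  moreover have "c = e * t * d"
  proof -
    have "(of_nat c :: complex) = of_nat (e * t * d)" using et(1) unfolding c d by simp
    then show ?thesis by (simp only: of_nat_eq_iff)
  qed
  moreover have "c \<noteq> 0" using Irr_one_nonzero[OF \<phi>] c by auto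
  ultimately show "multiplicity l c = multiplicity l d"
    using prime_elem_multiplicity_mult_distrib[OF lp, of "e * t" d] by (auto simp: not_dvd_imp_multiplicity_0)
qed

end

section \<open>Weights\<close>

subsection \<open>Subgroups\<close>

context group
begin

lemma subgroup_mult_central:
  assumes R: "subgroup R G" and Z: "subgroup Z G"
    and comm: "\<And>r z. r \<in> R \<Longrightarrow> z \<in> Z \<Longrightarrow> z \<otimes> r = r \<otimes> z"
  shows "subgroup (R <#> Z) G"
proof -
  note Rc = subgroup.mem_carrier[OF R] and Zc = subgroup.mem_carrier[OF Z]
  have mem: "y \<in> R <#> Z \<longleftrightarrow> (\<exists>r\<in>R. \<exists>z\<in>Z. y = r \<otimes> z)" for y by (auto simp: set_mult_def)
  show ?thesis
  proof (rule subgroupI)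
    show "R <#> Z \<subseteq> carrier G" using Rc Zc by (auto simp: set_mult_def)
    have "\<one> = \<one> \<otimes> \<one>" by simp
    then have "\<one> \<in> R <#> Z" unfolding mem using subgroup.one_closed[OF R] subgroup.one_closed[OF Z] by metis
    then show "R <#> Z \<noteq> {}" by auto
    fix a assume "a \<in> R <#> Z"
    then obtain r z where a: "r \<in> R" "z \<in> Z" "a = r \<otimes> z" unfolding mem by (elim bexE)
    have "inv a = inv r \<otimes> inv z"
      using a comm[OF subgroup.m_inv_closed[OF R a(1)] subgroup.m_inv_closed[OF Z a(2)]] Rc Zc
      by (simp add: inv_mult_group)
    then show "inv a \<in> R <#> Z"
      unfolding mem using subgroup.m_inv_closed[OF R a(1)] subgroup.m_inv_closed[OF Z a(2)] by metis
    fix b assume "b \<in> R <#> Z"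
    then obtain s y where b: "s \<in> R" "y \<in> Z" "b = s \<otimes> y" unfolding mem by (elim bexE)
    have "a \<otimes> b = r \<otimes> (z \<otimes> s) \<otimes> y" using a b Rc Zc by (simp add: m_assoc)
    also have "\<dots> = (r \<otimes> s) \<otimes> (z \<otimes> y)" unfolding comm[OF b(1) a(2)] using a b Rc Zc by (simp add: m_assoc)
    finally show "a \<otimes> b \<in> R <#> Z"
      unfolding mem using subgroup.m_closed[OF R a(1) b(1)] subgroup.m_closed[OF Z a(2) b(2)] by metis
  qed
qed

lemma card_mult_subgroups:
  assumes R: "subgroup R G" and Z: "subgroup Z G" and fin: "finite R" "finite Z"
  shows "card R * card Z = card (R <#> Z) * card (R \<inter> Z)"
proof -
  note Rc = subgroup.mem_carrier[OF R] and Zc = subgroup.mem_carrier[OF Z]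
  define f where "f = (\<lambda>(r, z). r \<otimes> z)"
  have f: "f p = fst p \<otimes> snd p" for p by (simp add: f_def case_prod_unfold)
  have img: "R <#> Z = f ` (R \<times> Z)" unfolding f_def by (auto simp: set_mult_def)
  have fiber: "card {p \<in> R \<times> Z. f p = y} = card (R \<inter> Z)" if "y \<in> f ` (R \<times> Z)" for y
  proof -
    obtain p where p: "y = f p" "p \<in> R \<times> Z" using \<open>y \<in> f ` (R \<times> Z)\<close> by (rule imageE)
    define r z where "r = fst p" and "z = snd p"
    have rz: "r \<in> R" "z \<in> Z" "y = r \<otimes> z" using p by (auto simp: r_def z_def f)
    note rc = Rc[OF rz(1)] and zc = Zc[OF rz(2)]
    have "bij_betw (\<lambda>t. (r \<otimes> t, inv t \<otimes> z)) (R \<inter> Z) {p \<in> R \<times> Z. f p = y}"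
    proof (rule bij_betw_byWitness[of _ "\<lambda>p. inv r \<otimes> fst p"])
      show "\<forall>t\<in>R \<inter> Z. inv r \<otimes> fst (r \<otimes> t, inv t \<otimes> z) = t"
        using rc Rc by (simp add: m_assoc[symmetric])
      show "\<forall>p\<in>{p \<in> R \<times> Z. f p = y}. (r \<otimes> (inv r \<otimes> fst p), inv (inv r \<otimes> fst p) \<otimes> z) = p"
      proof
        fix p assume p: "p \<in> {p \<in> R \<times> Z. f p = y}"
        define r' z' where "r' = fst p" and "z' = snd p"
        have r': "r' \<in> R" "z' \<in> Z" "r' \<otimes> z' = y" using p by (auto simp: f r'_def z'_def)
        note r'c = Rc[OF r'(1)] and z'c = Zc[OF r'(2)]
        have "inv (inv r \<otimes> r') \<otimes> z = inv r' \<otimes> (r \<otimes> z)"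
          using rc zc r'c by (simp add: inv_mult_group m_assoc)
        also have "\<dots> = inv r' \<otimes> (r' \<otimes> z')" using rz(3) r'(3) by simp
        also have "\<dots> = z'" using r'c z'c by (simp add: m_assoc[symmetric])
        finally have "inv (inv r \<otimes> r') \<otimes> z = z'" .
        moreover have "r \<otimes> (inv r \<otimes> r') = r'" using rc r'c by (simp add: m_assoc[symmetric])
        ultimately show "(r \<otimes> (inv r \<otimes> fst p), inv (inv r \<otimes> fst p) \<otimes> z) = p"
          by (simp add: prod_eq_iff r'_def z'_def)
      qed
      show "(\<lambda>t. (r \<otimes> t, inv t \<otimes> z)) ` (R \<inter> Z) \<subseteq> {p \<in> R \<times> Z. f p = y}"
      proof (rule image_subsetI)
        fix t assume t: "t \<in> R \<inter> Z"
        then have tc: "t \<in> carrier G" using Rc by blast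
        have "t \<otimes> (inv t \<otimes> z) = z" using tc zc by (simp add: m_assoc[symmetric])
        then have "r \<otimes> t \<otimes> (inv t \<otimes> z) = y" using rz(3) rc zc tc by (simp add: m_assoc)
        then show "(r \<otimes> t, inv t \<otimes> z) \<in> {p \<in> R \<times> Z. f p = y}"
          using t rz subgroup.m_closed[OF R] subgroup.m_closed[OF Z] subgroup.m_inv_closed[OF Z]
          by (simp add: f)
      qed
      show "(\<lambda>p. inv r \<otimes> fst p) ` {p \<in> R \<times> Z. f p = y} \<subseteq> R \<inter> Z"
      proof (rule image_subsetI)
        fix p assume "p \<in> {p \<in> R \<times> Z. f p = y}"
        then have p: "fst p \<in> R" "snd p \<in> Z" "fst p \<otimes> snd p = r \<otimes> z" using rz by (auto simp: f)
        have "inv r \<otimes> fst p = inv r \<otimes> (fst p \<otimes> snd p) \<otimes> inv (snd p)"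
          using rc Rc[OF p(1)] Zc[OF p(2)] by (simp add: m_assoc)
        also have "\<dots> = z \<otimes> inv (snd p)" unfolding p(3) using rc zc Zc[OF p(2)] by (simp add: m_assoc[symmetric])
        finally have eq: "inv r \<otimes> fst p = z \<otimes> inv (snd p)" .
        show "inv r \<otimes> fst p \<in> R \<inter> Z"
        proof (rule IntI)
          show "inv r \<otimes> fst p \<in> R"
            by (rule subgroup.m_closed[OF R subgroup.m_inv_closed[OF R rz(1)] p(1)])
          show "inv r \<otimes> fst p \<in> Z"
            unfolding eq by (rule subgroup.m_closed[OF Z rz(2) subgroup.m_inv_closed[OF Z p(2)]])
        qed
      qed
    qed
    then show ?thesis by (rule bij_betw_same_card[symmetric])
  qed
  have "card R * card Z = (\<Sum>p\<in>R \<times> Z. 1)" by (simp add: card_cartesian_product)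
  also have "\<dots> = (\<Sum>y\<in>f ` (R \<times> Z). \<Sum>p | p \<in> R \<times> Z \<and> f p = y. 1)"
    using fin by (intro sum.group[symmetric]) auto
  also have "\<dots> = (\<Sum>y\<in>f ` (R \<times> Z). card (R \<inter> Z))"
    using fiber by (intro sum.cong refl) simp
  finally show ?thesis unfolding img by simp
qed

text \<open>For finite \<open>S\<close> the inclusion \<open>g S g\<inverse> \<subseteq> S\<close> is an equality by counting.\<close>

lemma mem_normalizer_iff:
  assumes S: "subgroup S G" and fin: "finite S"
  shows "g \<in> normalizer G S \<longleftrightarrow> g \<in> carrier G \<and> (\<forall>s\<in>S. g \<otimes> s \<otimes> inv g \<in> S)"
proof -
  note Sc = subgroup.mem_carrier[OF S]
  have conj: "g <# S #> inv g = (\<lambda>s. g \<otimes> s \<otimes> inv g) ` S" for g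
    by (auto simp: l_coset_def r_coset_def)
  have 1: "(\<lambda>s. g \<otimes> s \<otimes> inv g) ` S = S" if g: "g \<in> carrier G" and sub: "\<forall>s\<in>S. g \<otimes> s \<otimes> inv g \<in> S"
  proof (rule card_subset_eq[OF fin])
    show "(\<lambda>s. g \<otimes> s \<otimes> inv g) ` S \<subseteq> S" using sub by (intro image_subsetI) simp
    have "inj_on (\<lambda>s. g \<otimes> s \<otimes> inv g) S" using g Sc by (intro inj_onI) simp
    then show "card ((\<lambda>s. g \<otimes> s \<otimes> inv g) ` S) = card S" by (rule card_image)
  qed
  have 2: "g \<otimes> s \<otimes> inv g \<in> S" if "(\<lambda>s. g \<otimes> s \<otimes> inv g) ` S = S" "s \<in> S" for s
    using imageI[OF that(2), of "\<lambda>s. g \<otimes> s \<otimes> inv g"] unfolding that(1) .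
  have "g \<in> normalizer G S \<longleftrightarrow> g \<in> carrier G \<and> (\<lambda>s. g \<otimes> s \<otimes> inv g) ` S = S"
    using subgroup.subset[OF S] unfolding normalizer_def stabilizer_def by (simp add: conj)
  then show ?thesis using 1 2 by metis
qed

end

subsection \<open>Inflation and deflation\<close>

lemma (in fin_group) character_kernel_acts_trivially:
  assumes \<rho>: "irreducible_rep H d \<rho>" and \<chi>: "\<And>g. g \<in> carrier H \<Longrightarrow> \<chi> g = mat_trace (\<rho> g)"
    and R: "subgroup R H" and ker: "\<And>r. r \<in> R \<Longrightarrow> \<chi> r = \<chi> \<one>" and r: "r \<in> R"
  shows "\<rho> r = 1\<^sub>m d"
proof (rule representation_trivial_on_subgroup[OF irreducible_repD(1)[OF \<rho>] R _ r])
  fix x assume "x \<in> R"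
  show "mat_trace (\<rho> x) = of_nat d"
    using \<chi>[OF subgroup.mem_carrier[OF R \<open>x \<in> R\<close>]] ker[OF \<open>x \<in> R\<close>] \<chi>[OF one_closed]
      representationD(3)[OF irreducible_repD(1)[OF \<rho>]] mat_trace_one by metis
qed

context fin_normal
begin

lemma mem_Irr_below_iff:
  "\<psi> \<in> Irr_below K \<phi> \<longleftrightarrow> \<psi> \<in> Irr K \<and> (\<Sum>k\<in>M. \<phi> k * \<psi> (inv k)) \<noteq> 0"
proof -
  interpret K: fin_group K by (rule fin_group_K)
  have "char_inner K (restrict \<phi> (carrier K)) \<psi> = (\<Sum>k\<in>M. \<phi> k * \<psi> (inv k)) / of_nat (Coset.order K)" if "\<psi> \<in> Irr K"
  proof -
    have "(\<Sum>k\<in>M. restrict \<phi> M k * cnj (\<psi> k)) = (\<Sum>k\<in>M. \<phi> k * \<psi> (inv k))"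
      using K.Irr_inv[OF that] by (intro sum.cong refl) (simp add: invK)
    then show ?thesis by (simp add: char_inner_def)
  qed
  then show ?thesis using K.order_pos by (auto simp: Irr_below_def)
qed

lemma deflate_coset:
  assumes inv: "\<And>r. r \<in> M \<Longrightarrow> \<chi> (r \<otimes> g) = \<chi> g" and g: "g \<in> carrier H"
  shows "deflate H M \<chi> (M #> g) = \<chi> g"
proof -
  have "M #> g \<in> carrier (H Mod M)"
    using g subgroup.subset[OF sub] by (auto simp: FactGroup_def intro: rcosetsI)
  moreover have "\<chi> ` (M #> g) = {\<chi> g}"
  proof
    show "\<chi> ` (M #> g) \<subseteq> {\<chi> g}" using inv by (auto simp: r_coset_def)
    show "{\<chi> g} \<subseteq> \<chi> ` (M #> g)" using rcos_self[OF g sub] by auto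
  qed
  ultimately show ?thesis by (simp add: deflate_def)
qed

lemma deflate_one:
  assumes "M \<subseteq> char_ker H \<chi>"
  shows "deflate H M \<chi> \<one>\<^bsub>H Mod M\<^esub> = \<chi> \<one>"
proof -
  have "deflate H M \<chi> (M #> \<one>) = \<chi> \<one>"
    using assms subM by (intro deflate_coset) (auto simp: char_ker_def)
  moreover have "M #> \<one> = M" using subgroup.subset[OF sub] by (rule coset_mult_one)
  ultimately show ?thesis by (simp add: FactGroup_def)
qed

lemma order_Mod: "Coset.order (H Mod M) * card M = Coset.order H"
  using lagrange[OF sub] by (simp add: Coset.order_def FactGroup_def)

text \<open>A representation with \<open>M\<close> in the kernel of its character is trivial on \<open>M\<close>, so it factors through the quotient,
  and the invariant subspaces stay the same.\<close>

lemma deflate_Irr: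
  assumes \<chi>: "\<chi> \<in> Irr H" and ker: "M \<subseteq> char_ker H \<chi>"
  shows "deflate H M \<chi> \<in> Irr (H Mod M)"
proof -
  interpret N: normal M H by (rule normal)
  interpret Q: group "H Mod M" by (rule N.factorgroup_is_group)
  obtain d \<rho> where \<rho>: "irreducible_rep H d \<rho>" "\<And>g. g \<in> carrier H \<Longrightarrow> \<chi> g = mat_trace (\<rho> g)"
    using IrrE[OF \<chi>] by metis
  note \<rho>r = irreducible_repD(1)[OF \<rho>(1)]
  note \<rho>c = representationD(1)[OF \<rho>r] and \<rho>m = representationD(2)[OF \<rho>r]
  have ker1: "\<chi> r = \<chi> \<one>" if "r \<in> M" for r using subsetD[OF ker that] by (simp add: char_ker_def)
  have \<rho>1: "\<rho> r = 1\<^sub>m d" if "r \<in> M" for r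
    by (rule character_kernel_acts_trivially[OF \<rho> sub ker1 that])
  have triv: "\<rho> (r \<otimes> g) = \<rho> g" if "r \<in> M" "g \<in> carrier H" for r g
    using \<rho>m[OF subM[OF that(1)] that(2)] \<rho>1[OF that(1)] left_mult_one_mat[OF \<rho>c[OF that(2)]] by metis
  have carr: "carrier (H Mod M) = rcosets M" by (simp add: FactGroup_def)
  have rep: "\<exists>g\<in>carrier H. C = M #> g" if "C \<in> rcosets M" for C
    using that unfolding RCOSETS_def by (elim UN_E) auto
  have coset: "M #> g \<in> rcosets M" if "g \<in> carrier H" for g
    using that subgroup.subset[OF sub] by (rule rcosetsI[rotated])
  define \<tau> where "\<tau> C = \<rho> (SOME x. x \<in> C)" for C
  have \<tau>: "\<tau> (M #> g) = \<rho> g" if g: "g \<in> carrier H" for g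
  proof -
    have "(SOME x. x \<in> M #> g) \<in> M #> g" using rcos_self[OF g sub] by (rule someI)
    then obtain r where "r \<in> M" "(SOME x. x \<in> M #> g) = r \<otimes> g" unfolding r_coset_def by auto
    then show ?thesis unfolding \<tau>_def using triv[OF _ g] by simp
  qed
  have "representation (H Mod M) d \<tau>"
    unfolding representation_def carr
  proof (intro conjI ballI)
    fix C assume "C \<in> rcosets M"
    then obtain g where g: "g \<in> carrier H" "C = M #> g" using rep by auto
    show "\<tau> C \<in> carrier_mat d d" unfolding g(2) \<tau>[OF g(1)] by (rule \<rho>c[OF g(1)])
    fix D assume "D \<in> rcosets M"
    then obtain h where h: "h \<in> carrier H" "D = M #> h" using rep by auto
    have "C \<otimes>\<^bsub>H Mod M\<^esub> D = M #> (g \<otimes> h)"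
      unfolding g(2) h(2) using N.rcos_sum[OF g(1) h(1)] by (simp add: FactGroup_def)
    then show "\<tau> (C \<otimes>\<^bsub>H Mod M\<^esub> D) = \<tau> C * \<tau> D"
      unfolding g(2) h(2) using \<tau> g(1) h(1) \<rho>m by simp
  next
    have "\<one>\<^bsub>H Mod M\<^esub> = M #> \<one>" using coset_mult_one[OF subgroup.subset[OF sub]] by (simp add: FactGroup_def)
    then show "\<tau> \<one>\<^bsub>H Mod M\<^esub> = 1\<^sub>m d" using \<tau>[OF one_closed] representationD(3)[OF \<rho>r] by simp
  qed
  moreover have "W = {0\<^sub>v d} \<or> W = carrier_vec d" if W: "linear_subspace d W" "rep_invariant (H Mod M) \<tau> W" for W
  proof (rule irreducible_repD(3)[OF \<rho>(1) W(1)])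
    show "rep_invariant H \<rho> W"
      unfolding rep_invariant_def
    proof (intro ballI)
      fix g w assume g: "g \<in> carrier H" and w: "w \<in> W"
      have "\<tau> (M #> g) *\<^sub>v w \<in> W" using W(2) coset[OF g] w unfolding rep_invariant_def carr by simp
      then show "\<rho> g *\<^sub>v w \<in> W" unfolding \<tau>[OF g] .
    qed
  qed
  ultimately have "irreducible_rep (H Mod M) d \<tau>"
    using irreducible_repD(2)[OF \<rho>(1)] by (simp add: irreducible_rep_iff[OF Q.group_axioms])
  moreover have "deflate H M \<chi> = restrict (\<lambda>C. mat_trace (\<tau> C)) (carrier (H Mod M))"
  proof
    fix C
    show "deflate H M \<chi> C = restrict (\<lambda>C. mat_trace (\<tau> C)) (carrier (H Mod M)) C"
    proof (cases "C \<in> rcosets M")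
      case True
      then obtain g where g: "g \<in> carrier H" "C = M #> g" using rep by auto
      have "deflate H M \<chi> C = \<chi> g"
        unfolding g(2) using g(1) triv \<rho>(2) subM by (intro deflate_coset) simp_all
      then show ?thesis using True \<tau>[OF g(1)] \<rho>(2)[OF g(1)] g(2) by (simp add: carr)
    qed (simp add: deflate_def carr)
  qed
  ultimately show ?thesis unfolding Irr_def by blast
qed

end

context fin_group
begin

lemma finite_subgroup: "subgroup R H \<Longrightarrow> finite R"
  by (rule finite_subset[OF subgroup.subset fin])

lemma fin_group_subgroup: "subgroup N H \<Longrightarrow> fin_group (H\<lparr>carrier := N\<rparr>)"
  unfolding fin_group_def fin_group_axioms_def
  using subgroup.subgroup_is_group[OF _ is_group] finite_subgroup by simp

lemma normalizer_subgroup: "subgroup R H \<Longrightarrow> subgroup (normalizer H R) H"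
  by (rule normalizer_imp_subgroup[OF subgroup.subset])

lemma fin_normal_normalizer:
  assumes R: "subgroup R H"
  shows "fin_normal (H\<lparr>carrier := normalizer H R\<rparr>) R"
  using fin_group_subgroup[OF normalizer_subgroup[OF R]] subgroup_in_normalizer[OF R]
  by (intro fin_normal.intro fin_normal_axioms.intro)

text \<open>Weights without quotient groups: defect zero of the deflated character compares the degree with the
  index of \<open>R\<close> in its normaliser.\<close>

theorem l_weight_iff:
  assumes R: "subgroup R H"
  shows "l_weight l H R \<phi> \<longleftrightarrow> (\<exists>k. card R = l ^ k) \<and> \<phi> \<in> Irr (normalizer_group H R) \<and>
    (\<forall>r\<in>R. \<phi> r = \<phi> \<one>) \<and>
    (\<exists>d. \<phi> \<one> = of_nat d \<and> multiplicity l d = multiplicity l (card (normalizer H R) div card R))"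
proof -
  interpret N: fin_normal "normalizer_group H R" R by (rule fin_normal_normalizer[OF R])
  have "R \<subseteq> normalizer H R" using N.subM by auto
  define P where "P \<longleftrightarrow> (\<forall>r\<in>R. \<phi> r = \<phi> \<one>)"
  have ker: "R \<subseteq> char_ker (normalizer_group H R) \<phi> \<longleftrightarrow> P"
    using \<open>R \<subseteq> normalizer H R\<close> unfolding P_def by (auto simp: char_ker_def)
  have "card R \<noteq> 0" using subgroup.one_closed[OF R] finite_subgroup[OF R] by auto
  have "Coset.order (normalizer_group H R Mod R) * card R = card (normalizer H R)"
    using N.order_Mod unfolding Coset.order_def[of "normalizer_group H R"] by simp
  then have ord: "Coset.order (normalizer_group H R Mod R) = card (normalizer H R) div card R"
    using \<open>card R \<noteq> 0\<close> by (metis nonzero_mult_div_cancel_right)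
  have "defect_zero l (normalizer_group H R Mod R) (deflate (normalizer_group H R) R \<phi>) \<longleftrightarrow>
      (\<exists>d. \<phi> \<one> = of_nat d \<and> multiplicity l d = multiplicity l (card (normalizer H R) div card R))"
    if \<phi>: "\<phi> \<in> Irr (normalizer_group H R)" and P
  proof -
    have kr: "R \<subseteq> char_ker (normalizer_group H R) \<phi>" unfolding ker by (rule \<open>P\<close>)
    show ?thesis using N.deflate_Irr[OF \<phi> kr] N.deflate_one[OF kr] unfolding defect_zero_def ord by simp
  qed
  then show ?thesis
    unfolding l_weight_def prime_power_subgroup_def ker P_def[symmetric] by (simp add: R cong: conj_cong)
qed

end

section \<open>Transfer of weights\<close>

lemma dvd_prime_power_imp_power:
  fixes n l k :: nat
  assumes "prime l" "n dvd l ^ k"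
  shows "\<exists>j. n = l ^ j"
  using assms divides_primepow_nat by blast

lemma power_power_commute: "(x ^ a) ^ b = (x ^ b) ^ a" for x :: "'a::monoid_mult"
  unfolding power_mult[symmetric] mult.commute[of a b] ..

lemma power_eq_one_coprime:
  fixes x :: "'a::monoid_mult"
  assumes a: "x ^ a = 1" and b: "x ^ b = 1" and "coprime a b" "a \<noteq> 0"
  shows "x = 1"
proof -
  obtain u v where uv: "a * u = b * v + 1" using bezout_nat[of a b] assms(3,4) by auto
  have "x = x ^ (b * v + 1)" using b by (simp add: power_mult)
  also have "\<dots> = (x ^ a) ^ u" unfolding uv[symmetric] by (simp add: power_mult)
  finally show ?thesis using a by simp
qed

lemma mem_set_mult_iff: "y \<in> A <#>\<^bsub>G\<^esub> B \<longleftrightarrow> (\<exists>a\<in>A. \<exists>b\<in>B. y = a \<otimes>\<^bsub>G\<^esub> b)"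
  by (auto simp: set_mult_def)

lemma set_multI: "a \<in> A \<Longrightarrow> b \<in> B \<Longrightarrow> a \<otimes>\<^bsub>G\<^esub> b \<in> A <#>\<^bsub>G\<^esub> B"
  by (auto simp: set_mult_def)

lemma set_multE:
  assumes "y \<in> A <#>\<^bsub>G\<^esub> B"
  obtains a b where "a \<in> A" "b \<in> B" "y = a \<otimes>\<^bsub>G\<^esub> b"
  using assms unfolding mem_set_mult_iff by (elim bexE) (rule that)

context fin_group
begin

lemma central_acts_by_scalar:
  assumes \<rho>: "irreducible_rep H d \<rho>" and z: "z \<in> carrier H"
    and comm: "\<And>g. g \<in> carrier H \<Longrightarrow> z \<otimes> g = g \<otimes> z"
  shows "\<exists>c. \<rho> z = c \<cdot>\<^sub>m 1\<^sub>m d"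
proof -
  note \<rho>r = irreducible_repD(1)[OF \<rho>]
  have "\<rho> g * \<rho> z = \<rho> z * \<rho> g" if "g \<in> carrier H" for g
    using representationD(2)[OF \<rho>r that z] representationD(2)[OF \<rho>r z that] comm[OF that] by simp
  then show ?thesis using schur_scalar[OF \<rho> representationD(1)[OF \<rho>r z]] by metis
qed

text \<open>Otherwise \<open>R Z\<close> would be an \<open>l\<close>-group larger than \<open>R\<close> that acts by scalars, and by \<open>degree_dvd_index\<close> the
  \<open>l\<close>-part of \<open>\<phi>(1)\<close> would be smaller than that of the index of \<open>R\<close>.\<close>

lemma central_l_subgroup_subset:
  fixes l :: nat
  assumes \<phi>: "\<phi> \<in> Irr H" and R: "subgroup R H" and ker: "\<And>r. r \<in> R \<Longrightarrow> \<phi> r = \<phi> \<one>"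
    and Z: "subgroup Z H" and comm: "\<And>z g. z \<in> Z \<Longrightarrow> g \<in> carrier H \<Longrightarrow> z \<otimes> g = g \<otimes> z"
    and l: "prime l" and cards: "card R = l ^ a" "card Z = l ^ b"
    and d: "\<phi> \<one> = of_nat d" "multiplicity l d = multiplicity l (card (carrier H) div card R)"
  shows "Z \<subseteq> R"
proof -
  note Rc = subgroup.mem_carrier[OF R] and Zc = subgroup.mem_carrier[OF Z]
  obtain e \<rho> where \<rho>: "irreducible_rep H e \<rho>" "\<And>g. g \<in> carrier H \<Longrightarrow> \<phi> g = mat_trace (\<rho> g)"
    "\<phi> \<one> = of_nat e" using IrrE[OF \<phi>] by metis
  have e: "e = d" using \<rho>(3) d(1) by simp
  note \<rho>r = irreducible_repD(1)[OF \<rho>(1)]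
  define Y where "Y = R <#> Z"
  have Y: "subgroup Y H" unfolding Y_def by (rule subgroup_mult_central[OF R Z comm[OF _ Rc]])
  have finY: "finite Y" by (rule finite_subgroup[OF Y])
  have scal: "\<exists>c. \<rho> y = c \<cdot>\<^sub>m 1\<^sub>m e" if "y \<in> Y" for y
  proof -
    obtain r z where y: "r \<in> R" "z \<in> Z" "y = r \<otimes> z"
      using \<open>y \<in> Y\<close> unfolding Y_def by (rule set_multE)
    have r1: "\<rho> r = 1\<^sub>m e"
      by (rule character_kernel_acts_trivially[OF \<rho>(1,2) R ker y(1)])
    have "\<rho> y = \<rho> z"
      unfolding y(3) representationD(2)[OF \<rho>r Rc[OF y(1)] Zc[OF y(2)]] r1
      by (rule left_mult_one_mat[OF representationD(1)[OF \<rho>r Zc[OF y(2)]]])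
    then show ?thesis using central_acts_by_scalar[OF \<rho>(1) Zc[OF y(2)] comm[OF y(2)]] by simp
  qed
  define n where "n = card (rcosets Y)"
  have dn: "d dvd n" unfolding n_def e[symmetric] by (rule degree_dvd_index[OF \<rho>(1) Y scal])
  have ord: "n * card Y = card (carrier H)" unfolding n_def using lagrange[OF Y] by (simp add: Coset.order_def)
  have n0: "n \<noteq> 0"
  proof
    assume "n = 0"
    then show False using ord order_pos by (simp add: Coset.order_def)
  qed
  have "card Y dvd l ^ (a + b)"
    using card_mult_subgroups[OF R Z finite_subgroup[OF R] finite_subgroup[OF Z]]
    unfolding cards Y_def power_add by simp
  then obtain j where j: "card Y = l ^ j" using dvd_prime_power_imp_power[OF l] by auto
  have RY: "R \<subseteq> Y" and ZY: "Z \<subseteq> Y"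
  proof -
    show "R \<subseteq> Y"
    proof
      fix r assume "r \<in> R"
      then show "r \<in> Y" unfolding Y_def using set_multI[of r R \<one> Z H] subgroup.one_closed[OF Z] Rc by simp
    qed
    show "Z \<subseteq> Y"
    proof
      fix z assume "z \<in> Z"
      then show "z \<in> Y" unfolding Y_def using set_multI[of \<one> R z Z H] subgroup.one_closed[OF R] Zc by simp
    qed
  qed
  have l1: "1 < l" using l by (rule prime_gt_1_nat)
  have aj: "a \<le> j"
    using card_mono[OF finY RY] l1 unfolding cards j by simp
  have "card (carrier H) div card R = n * l ^ (j - a)"
    unfolding ord[symmetric] j cards using aj l1
    by (metis div_mult_swap le_imp_power_dvd power_diff not_one_less_zero le_zero_eq not_less)
  then have "multiplicity l d = multiplicity l n + (j - a)"
    using d(2) n0 l l1 by (simp add: prime_elem_multiplicity_mult_distrib multiplicity_prime_elem_times_other)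
  moreover have "multiplicity l d \<le> multiplicity l n" using dn n0 by (intro dvd_imp_multiplicity_le)
  ultimately have "j = a" using aj by linarith
  then have "card R = card Y" unfolding cards j by simp
  then have "R = Y" using RY finY by (intro card_subset_eq)
  then show ?thesis using ZY by simp
qed

end

text \<open>\<open>X \<times> Z\<close> is the kernel of a linear character of order prime to \<open>l\<close>, with \<open>Z\<close> a central \<open>l\<close>-subgroup. All that
  is used of \<open>GL\<^sub>n(\<epsilon>q)\<close>, \<open>SL\<^sub>n(\<epsilon>q)\<close> and \<open>O\<^sub>l(Z(GL\<^sub>n(\<epsilon>q)))\<close> is collected here.\<close>

locale central_l_extension = linear_char H \<nu> m for H (structure) and \<nu> m +
  fixes X Z l
  assumes X: "X \<lhd> H" and Z: "subgroup Z H"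
    and central: "\<And>z g. z \<in> Z \<Longrightarrow> g \<in> carrier H \<Longrightarrow> z \<otimes> g = g \<otimes> z"
    and l: "prime (l :: nat)" "\<not> l dvd m" and cardZ: "\<exists>b. card Z = l ^ b"
    and disj: "X \<inter> Z = {\<one>}" and ker: "lin_ker = X <#> Z"
begin

lemma Xsub: "subgroup X H" by (rule normal_imp_subgroup[OF X])

lemma Xc: "x \<in> X \<Longrightarrow> x \<in> carrier H" by (rule subgroup.mem_carrier[OF Xsub])

lemma Zc: "z \<in> Z \<Longrightarrow> z \<in> carrier H" by (rule subgroup.mem_carrier[OF Z])

lemma product_in_X:
  assumes "x \<in> X" "z \<in> Z" "x \<otimes> z \<in> X"
  shows "z = \<one>"
proof -
  have "z = inv x \<otimes> (x \<otimes> z)" using Xc[OF assms(1)] Zc[OF assms(2)] by (simp add: m_assoc[symmetric])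
  also have "\<dots> \<in> X" by (rule subgroup.m_closed[OF Xsub subgroup.m_inv_closed[OF Xsub assms(1)] assms(3)])
  finally show ?thesis using assms(2) disj by auto
qed

lemma product_Int:
  assumes SX: "S \<subseteq> X" and S: "subgroup S H"
  shows "(S <#> Z) \<inter> X = S"
proof
  show "(S <#> Z) \<inter> X \<subseteq> S"
  proof
    fix y assume "y \<in> (S <#> Z) \<inter> X"
    then have "y \<in> S <#> Z" and yX: "y \<in> X" by simp_all
    from \<open>y \<in> S <#> Z\<close> obtain s z where y: "s \<in> S" "z \<in> Z" "y = s \<otimes> z" by (rule set_multE)
    have "z = \<one>" by (rule product_in_X[OF subsetD[OF SX y(1)] y(2) yX[unfolded y(3)]])
    then show "y \<in> S" using y subgroup.mem_carrier[OF S y(1)] by simp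
  qed
  show "S \<subseteq> (S <#> Z) \<inter> X"
  proof
    fix s assume s: "s \<in> S"
    show "s \<in> (S <#> Z) \<inter> X"
      using set_multI[OF s subgroup.one_closed[OF Z], of H] subgroup.mem_carrier[OF S s] subsetD[OF SX s] by simp
  qed
qed

lemma product_subgroup:
  assumes S: "subgroup S H"
  shows "subgroup (S <#> Z) H"
  by (rule subgroup_mult_central[OF S Z central[OF _ subgroup.mem_carrier[OF S]]])

lemma card_product:
  assumes SX: "S \<subseteq> X" and S: "subgroup S H"
  shows "card (S <#> Z) = card S * card Z"
proof -
  have "S \<inter> Z = {\<one>}"
    using SX disj subgroup.one_closed[OF S] subgroup.one_closed[OF Z] by blast
  then show ?thesis using card_mult_subgroups[OF S Z finite_subgroup[OF S] finite_subgroup[OF Z]] by simp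
qed

text \<open>\<open>S\<close> and \<open>S Z\<close> determine each other: \<open>Z\<close> is central, and \<open>S = S Z \<inter> X\<close> with \<open>X\<close> normal.\<close>

lemma normalizer_product:
  assumes SX: "S \<subseteq> X" and S: "subgroup S H"
  shows "normalizer H (S <#> Z) = normalizer H S"
proof -
  note Sc = subgroup.mem_carrier[OF S]
  define R where "R = S <#> Z"
  have R: "subgroup R H" unfolding R_def by (rule product_subgroup[OF S])
  have RX: "R \<inter> X = S" unfolding R_def by (rule product_Int[OF SX S])
  have "(\<forall>r\<in>R. g \<otimes> r \<otimes> inv g \<in> R) \<longleftrightarrow> (\<forall>s\<in>S. g \<otimes> s \<otimes> inv g \<in> S)" if g: "g \<in> carrier H" for g
  proof
    assume *: "\<forall>r\<in>R. g \<otimes> r \<otimes> inv g \<in> R"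
    show "\<forall>s\<in>S. g \<otimes> s \<otimes> inv g \<in> S"
    proof
      fix s assume s: "s \<in> S"
      then have "s \<in> R" "s \<in> X" using RX by auto
      then have "g \<otimes> s \<otimes> inv g \<in> R \<inter> X" using * normal.inv_op_closed2[OF X g] by simp
      then show "g \<otimes> s \<otimes> inv g \<in> S" unfolding RX .
    qed
  next
    assume *: "\<forall>s\<in>S. g \<otimes> s \<otimes> inv g \<in> S"
    show "\<forall>r\<in>R. g \<otimes> r \<otimes> inv g \<in> R"
    proof
      fix r assume "r \<in> R"
      then obtain s z where r: "s \<in> S" "z \<in> Z" "r = s \<otimes> z" unfolding R_def by (rule set_multE)
      note sc = Sc[OF r(1)] and zc = Zc[OF r(2)]
      have "g \<otimes> r \<otimes> inv g = g \<otimes> s \<otimes> (z \<otimes> inv g)" unfolding r(3) using g sc zc by (simp add: m_assoc)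
      also have "\<dots> = (g \<otimes> s \<otimes> inv g) \<otimes> z"
        unfolding central[OF r(2) inv_closed[OF g]] using g sc zc by (simp add: m_assoc)
      finally show "g \<otimes> r \<otimes> inv g \<in> R" unfolding R_def using set_multI[OF bspec[OF * r(1)] r(2), of H] by simp
    qed
  qed
  then show ?thesis
    unfolding R_def[symmetric] set_eq_iff mem_normalizer_iff[OF R finite_subgroup[OF R]]
      mem_normalizer_iff[OF S finite_subgroup[OF S]] by metis
qed

lemma subgroup_of_X:
  assumes "subgroup S (H\<lparr>carrier := X\<rparr>)"
  shows "subgroup S H" "S \<subseteq> X"
  using incl_subgroup[OF Xsub assms] subgroup.subset[OF assms] by auto

lemma normalizer_in_X:
  assumes SX: "S \<subseteq> X" and S: "subgroup S H"
  shows "normalizer (H\<lparr>carrier := X\<rparr>) S = normalizer H S \<inter> X"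
proof -
  interpret XG: fin_group "H\<lparr>carrier := X\<rparr>" by (rule fin_group_subgroup[OF Xsub])
  have S': "subgroup S (H\<lparr>carrier := X\<rparr>)" by (rule subgroup_incl[OF S Xsub SX])
  have "x \<in> normalizer (H\<lparr>carrier := X\<rparr>) S \<longleftrightarrow> x \<in> normalizer H S \<inter> X" for x
    using XG.mem_normalizer_iff[OF S' finite_subgroup[OF S], of x]
      mem_normalizer_iff[OF S finite_subgroup[OF S], of x] Xc[of x] m_inv_consistent[OF Xsub, of x]
    by (cases "x \<in> X") auto
  then show ?thesis by blast
qed

lemma Z_normalizes:
  assumes S: "subgroup S H"
  shows "Z \<subseteq> normalizer H S"
proof
  fix z assume z: "z \<in> Z"
  have "z \<otimes> s \<otimes> inv z = s" if "s \<in> S" for s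
    unfolding central[OF z subgroup.mem_carrier[OF S that]]
    using Zc[OF z] subgroup.mem_carrier[OF S that] by (simp add: m_assoc)
  then show "z \<in> normalizer H S" using Zc[OF z] by (simp add: mem_normalizer_iff[OF S finite_subgroup[OF S]])
qed

end

text \<open>The situation of \<open>central_l_extension\<close> descends to the normaliser \<open>N\<close> of \<open>S\<close>, with \<open>M = N \<inter> X\<close> in place of \<open>X\<close>.\<close>

locale weight_transfer = central_l_extension H \<nu> m X Z l for H (structure) and \<nu> m X Z l +
  fixes S
  assumes S: "subgroup S H" and SX: "S \<subseteq> X"
begin

abbreviation N where "N \<equiv> normalizer H S"
abbreviation M where "M \<equiv> normalizer H S \<inter> X"

lemma Nsub: "subgroup N H" by (rule normalizer_subgroup[OF S])

lemma Nc: "g \<in> N \<Longrightarrow> g \<in> carrier H" by (rule subgroup.mem_carrier[OF Nsub])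

lemma NG: "fin_group (H\<lparr>carrier := N\<rparr>)" by (rule fin_group_subgroup[OF Nsub])

lemma ZN: "Z \<subseteq> N" by (rule Z_normalizes[OF S])

lemma SN: "S \<subseteq> N"
  using subgroup.m_closed[OF S] subgroup.m_inv_closed[OF S] subgroup.mem_carrier[OF S]
  by (auto simp: mem_normalizer_iff[OF S finite_subgroup[OF S]])

lemma invN: "g \<in> N \<Longrightarrow> inv\<^bsub>H\<lparr>carrier := N\<rparr>\<^esub> g = inv g" by (rule m_inv_consistent[OF Nsub])

lemma Msub: "subgroup M H" by (rule subgroups_Inter_pair[OF Nsub Xsub])

lemma M_normal: "M \<lhd> H\<lparr>carrier := N\<rparr>"
proof (rule group.normal_invI)
  show "Group.group (H\<lparr>carrier := N\<rparr>)" using NG by (rule fin_group.axioms(1))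
  show "subgroup M (H\<lparr>carrier := N\<rparr>)" by (rule subgroup_incl[OF Msub Nsub]) simp
  fix g k assume "g \<in> carrier (H\<lparr>carrier := N\<rparr>)" and k: "k \<in> M"
  then have g: "g \<in> N" by simp
  have "g \<otimes> k \<otimes> inv g \<in> N"
    using g k subgroup.m_closed[OF Nsub] subgroup.m_inv_closed[OF Nsub] by simp
  moreover have "g \<otimes> k \<otimes> inv g \<in> X" using k by (intro normal.inv_op_closed2[OF X Nc[OF g]]) simp
  ultimately show "g \<otimes>\<^bsub>H\<lparr>carrier := N\<rparr>\<^esub> k \<otimes>\<^bsub>H\<lparr>carrier := N\<rparr>\<^esub> inv\<^bsub>H\<lparr>carrier := N\<rparr>\<^esub> g \<in> M"
    by (simp add: invN[OF g])
qed

lemma lin_N: "linear_char (H\<lparr>carrier := N\<rparr>) \<nu> m"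
  using NG m lin_mult[OF Nc Nc] lin_pow[OF Nc]
  by (intro linear_char.intro linear_char_axioms.intro) simp_all

lemma lin_ker_N: "linear_char.lin_ker (H\<lparr>carrier := N\<rparr>) \<nu> = M <#> Z"
proof -
  have "linear_char.lin_ker (H\<lparr>carrier := N\<rparr>) \<nu> = N \<inter> lin_ker"
    unfolding linear_char.lin_ker_def[OF lin_N] lin_ker_def using Nc by auto
  also have "\<dots> = M <#> Z"
    unfolding ker
  proof
    show "N \<inter> (X <#> Z) \<subseteq> M <#> Z"
    proof
      fix y assume "y \<in> N \<inter> (X <#> Z)"
      then have yN: "y \<in> N" and "y \<in> X <#> Z" by simp_all
      from \<open>y \<in> X <#> Z\<close> obtain x z where y: "x \<in> X" "z \<in> Z" "y = x \<otimes> z" by (rule set_multE)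
      have "x = y \<otimes> inv z" using y Xc Zc by (simp add: m_assoc)
      also have "\<dots> \<in> N"
        by (rule subgroup.m_closed[OF Nsub yN subsetD[OF ZN subgroup.m_inv_closed[OF Z y(2)]]])
      finally have "x \<in> M" using y(1) by simp
      then show "y \<in> M <#> Z" unfolding y(3) using y(2) by (rule set_multI)
    qed
    show "M <#> Z \<subseteq> N \<inter> (X <#> Z)"
    proof
      fix y assume "y \<in> M <#> Z"
      then obtain x z where y: "x \<in> M" "z \<in> Z" "y = x \<otimes> z" by (rule set_multE)
      have "y \<in> N" unfolding y(3) using subgroup.m_closed[OF Nsub IntD1[OF y(1)] subsetD[OF ZN y(2)]] .
      moreover have "y \<in> X <#> Z" unfolding y(3) by (rule set_multI[OF IntD2[OF y(1)] y(2)])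
      ultimately show "y \<in> N \<inter> (X <#> Z)" by simp
    qed
  qed
  finally show ?thesis .
qed

lemma fin_normal_N: "fin_normal (H\<lparr>carrier := N\<rparr>) M"
  using NG M_normal by (intro fin_normal.intro fin_normal_axioms.intro)

lemma multiplicity_transfer:
  assumes \<phi>: "\<phi> \<in> Irr (H\<lparr>carrier := N\<rparr>)" and triv: "\<And>g z. g \<in> N \<Longrightarrow> z \<in> Z \<Longrightarrow> \<phi> (g \<otimes> z) = \<phi> g"
    and \<psi>: "\<psi> \<in> Irr (H\<lparr>carrier := M\<rparr>)" and over: "(\<Sum>k\<in>M. \<phi> k * \<psi> (inv k)) \<noteq> 0"
    and c: "\<phi> \<one> = of_nat c" and d: "\<psi> \<one> = of_nat d"
  shows "multiplicity l c = multiplicity l d"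
    "multiplicity l (card N div card (S <#> Z)) = multiplicity l (card M div card S)"
proof -
  have Z': "subgroup Z (H\<lparr>carrier := N\<rparr>)" by (rule subgroup_incl[OF Z Nsub ZN])
  have MZ: "M \<inter> Z = {\<one>\<^bsub>H\<lparr>carrier := N\<rparr>\<^esub>}"
    using disj subgroup.one_closed[OF Msub] subgroup.one_closed[OF Z] by auto
  have kerN: "linear_char.lin_ker (H\<lparr>carrier := N\<rparr>) \<nu> = M <#>\<^bsub>H\<lparr>carrier := N\<rparr>\<^esub> Z"
    unfolding lin_ker_N by (simp add: set_mult_def)
  have over': "(\<Sum>k\<in>M. \<phi> k * \<psi> (inv\<^bsub>H\<lparr>carrier := N\<rparr>\<^esub> k)) \<noteq> 0"
    using over by (simp add: invN)
  note * = linear_char.multiplicity_degree_eq[OF lin_N M_normal Z' MZ kerN l \<phi> _ _ over', of c d]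
  show "multiplicity l c = multiplicity l d"
    by (rule *(1)) (use triv \<psi> c d in simp_all)
  have "multiplicity l (Coset.order (H\<lparr>carrier := N\<rparr>)) = multiplicity l (card M * card Z)"
    by (rule *(2)) (use triv \<psi> c d in simp_all)
  then have mN: "multiplicity l (card N) = multiplicity l (card M * card Z)"
    by (simp add: Coset.order_def)
  have pe: "prime_elem l" using l(1) by simp
  have pos: "card A \<noteq> 0" if "subgroup A H" for A
    using subgroup.one_closed[OF that] finite_subgroup[OF that] by auto
  have R: "subgroup (S <#> Z) H" by (rule product_subgroup[OF S])
  have RN: "S <#> Z \<subseteq> N"
    by (rule subsetI, erule set_multE) (use SN ZN subgroup.m_closed[OF Nsub] in blast)
  have "card (S <#> Z) dvd card N"
    using group.lagrange[OF fin_group.axioms(1)[OF NG] subgroup_incl[OF R Nsub RN]]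
    by (simp add: Coset.order_def) (metis dvd_triv_right)
  then obtain n1 where n1: "card N = card (S <#> Z) * n1" ..
  have SM: "S \<subseteq> M" using SN SX by simp
  have "card S dvd card M"
    using group.lagrange[OF fin_group.axioms(1)[OF fin_group_subgroup[OF Msub]] subgroup_incl[OF S Msub SM]]
    by (simp add: Coset.order_def) (metis dvd_triv_right)
  then obtain n2 where n2: "card M = card S * n2" ..
  have cp: "card (S <#> Z) = card S * card Z" by (rule card_product[OF SX S])
  have n10: "n1 \<noteq> 0" and n20: "n2 \<noteq> 0" using pos[OF Nsub] pos[OF Msub] n1 n2 by auto
  have "multiplicity l (card (S <#> Z) * n1) = multiplicity l (card (S <#> Z) * n2)"
    using mN unfolding n1 n2 cp by (simp add: mult_ac)
  then have "multiplicity l n1 = multiplicity l n2"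
    using prime_elem_multiplicity_mult_distrib[OF pe pos[OF R] n10]
      prime_elem_multiplicity_mult_distrib[OF pe pos[OF R] n20] by simp
  then show "multiplicity l (card N div card (S <#> Z)) = multiplicity l (card M div card S)"
    unfolding n1 n2 using pos[OF R] pos[OF S] by simp
qed

end

context central_l_extension
begin

lemma l_power_in_lin_ker:
  assumes g: "g \<in> carrier H" and p: "\<nu> g ^ (l ^ k) = 1"
  shows "\<nu> g = 1"
  by (rule power_eq_one_coprime[OF p lin_pow[OF g]])
    (use l prime_gt_0_nat[OF l(1)] in \<open>simp_all add: prime_imp_coprime\<close>)

lemma nu_power: "g \<in> carrier H \<Longrightarrow> \<nu> (g [^] (k :: nat)) = \<nu> g ^ k"
  by (induction k) (simp_all add: lin_one lin_mult mult.commute)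

text \<open>As \<open>R\<close> is an \<open>l\<close>-group, it lies in the kernel of \<open>\<nu>\<close>; together with \<open>Z \<subseteq> R\<close> this gives \<open>R = S Z\<close>. Then
  \<open>multiplicity_transfer\<close> carries defect zero from \<open>\<phi>\<close> to \<open>\<psi>\<close>.\<close>

theorem weight_restricts:
  assumes w: "l_weight l H R \<phi>" and S_def: "S = R \<inter> X"
    and \<psi>: "\<psi> \<in> Irr_below (normalizer_group (H\<lparr>carrier := X\<rparr>) S) \<phi>"
  shows "l_weight l (H\<lparr>carrier := X\<rparr>) S \<psi>"
proof -
  have R: "subgroup R H" using w by (simp add: l_weight_def prime_power_subgroup_def)
  obtain a where a: "card R = l ^ a" using w by (auto simp: l_weight_def prime_power_subgroup_def)
  note w' = w[unfolded l_weight_iff[OF R]]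
  have \<phi>0: "\<phi> \<in> Irr (normalizer_group H R)" using w' by simp
  have kerR: "\<phi> r = \<phi> \<one>" if "r \<in> R" for r using w' that by blast
  obtain c where c: "\<phi> \<one> = of_nat c" "multiplicity l c = multiplicity l (card (normalizer H R) div card R)"
    using w' by blast
  obtain b where b: "card Z = l ^ b" using cardZ by blast
  interpret N0: fin_group "normalizer_group H R" by (rule fin_group_subgroup[OF normalizer_subgroup[OF R]])
  note N0sub = normalizer_subgroup[OF R]
  have RN: "subgroup R (normalizer_group H R)"
    using fin_normal.sub[OF fin_normal_normalizer[OF R]] .
  have ZN0: "subgroup Z (normalizer_group H R)"
    by (rule subgroup_incl[OF Z N0sub Z_normalizes[OF R]])
  have ZR: "Z \<subseteq> R"
  proof (rule N0.central_l_subgroup_subset[OF \<phi>0 RN _ ZN0 _ l(1) a b])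
    show "\<phi> r = \<phi> \<one>\<^bsub>normalizer_group H R\<^esub>" if "r \<in> R" for r using kerR[OF that] by simp
    show "z \<otimes>\<^bsub>normalizer_group H R\<^esub> g = g \<otimes>\<^bsub>normalizer_group H R\<^esub> z"
      if "z \<in> Z" "g \<in> carrier (normalizer_group H R)" for z g
      using central[OF that(1) subgroup.mem_carrier[OF N0sub]] that(2) by simp
    show "\<phi> \<one>\<^bsub>normalizer_group H R\<^esub> = of_nat c" using c(1) by simp
    show "multiplicity l c = multiplicity l (card (carrier (normalizer_group H R)) div card R)" using c(2) by simp
  qed
  have S: "subgroup S H" unfolding S_def by (rule subgroups_Inter_pair[OF R Xsub])
  have SX: "S \<subseteq> X" by (simp add: S_def)
  have RS: "R = S <#> Z"
  proof
    show "R \<subseteq> S <#> Z"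
    proof
      fix r assume r: "r \<in> R"
      note rc = subgroup.mem_carrier[OF R r]
      have "r [^] card R = \<one>"
      proof -
        interpret RG: group "H\<lparr>carrier := R\<rparr>" by (rule subgroup.subgroup_is_group[OF R is_group])
        have "r [^]\<^bsub>H\<lparr>carrier := R\<rparr>\<^esub> Coset.order (H\<lparr>carrier := R\<rparr>) = \<one>"
          using RG.pow_order_eq_1[of r] r by simp
        then show ?thesis by (simp add: Coset.order_def nat_pow_consistent[symmetric])
      qed
      then have "\<nu> r ^ (l ^ a) = 1" using nu_power[OF rc, of "card R"] lin_one a by simp
      then have "r \<in> lin_ker" using l_power_in_lin_ker[OF rc] rc by (simp add: lin_ker_def)
      then obtain x z where y: "x \<in> X" "z \<in> Z" "r = x \<otimes> z" unfolding ker by (rule set_multE)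
      have "x = r \<otimes> inv z" unfolding y(3) using Xc[OF y(1)] Zc[OF y(2)] by (simp add: m_assoc)
      also have "\<dots> \<in> R"
        by (rule subgroup.m_closed[OF R r subgroup.m_inv_closed[OF R subsetD[OF ZR y(2)]]])
      finally have "x \<in> S" using y(1) by (simp add: S_def)
      then show "r \<in> S <#> Z" unfolding y(3) using y(2) by (rule set_multI)
    qed
    show "S <#> Z \<subseteq> R"
    proof (rule subsetI, erule set_multE)
      fix y s z assume "s \<in> S" "z \<in> Z" "y = s \<otimes> z"
      then show "y \<in> R" using subgroup.m_closed[OF R _ subsetD[OF ZR]] by (simp add: S_def)
    qed
  qed
  interpret T: weight_transfer H \<nu> m X Z l S
    using central_l_extension_axioms S SX by (intro weight_transfer.intro weight_transfer_axioms.intro)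
  have NR: "normalizer H R = normalizer H S" unfolding RS by (rule normalizer_product[OF SX S])
  have NX: "normalizer (H\<lparr>carrier := X\<rparr>) S = normalizer H S \<inter> X" by (rule normalizer_in_X[OF SX S])
  have \<phi>: "\<phi> \<in> Irr (H\<lparr>carrier := T.N\<rparr>)" using \<phi>0 unfolding NR .
  interpret NM: fin_normal "H\<lparr>carrier := T.N\<rparr>" T.M by (rule T.fin_normal_N)
  have \<psi>0: "\<psi> \<in> Irr_below (H\<lparr>carrier := T.N, carrier := T.M\<rparr>) \<phi>" using \<psi> unfolding NX by simp
  then have \<psi>1: "\<psi> \<in> Irr (H\<lparr>carrier := T.M\<rparr>)" and over': "(\<Sum>k\<in>T.M. \<phi> k * \<psi> (inv\<^bsub>H\<lparr>carrier := T.N\<rparr>\<^esub> k)) \<noteq> 0"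
    unfolding NM.mem_Irr_below_iff by simp_all
  then have over: "(\<Sum>k\<in>T.M. \<phi> k * \<psi> (inv k)) \<noteq> 0" by (simp add: T.invN)
  obtain e \<rho> where \<rho>: "irreducible_rep (H\<lparr>carrier := T.N\<rparr>) e \<rho>"
    "\<And>g. g \<in> carrier (H\<lparr>carrier := T.N\<rparr>) \<Longrightarrow> \<phi> g = mat_trace (\<rho> g)"
    using NM.IrrE[OF \<phi>] by metis
  note \<rho>r = NM.irreducible_repD(1)[OF \<rho>(1)]
  have RN': "subgroup R (H\<lparr>carrier := T.N\<rparr>)" using RN unfolding NR .
  have RinN: "r \<in> T.N" if "r \<in> R" for r using subgroup.mem_carrier[OF RN' that] by simp
  have \<rho>R: "\<rho> r = 1\<^sub>m e" if "r \<in> R" for r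
    by (rule NM.character_kernel_acts_trivially[OF \<rho> RN' _ that]) (simp_all add: kerR)
  have triv: "\<phi> (g \<otimes> r) = \<phi> g" if g: "g \<in> T.N" and r: "r \<in> R" for g r
  proof -
    have "\<rho> (g \<otimes> r) = \<rho> g"
      using representationD(2)[OF \<rho>r, of g r] representationD(1)[OF \<rho>r, of g] g RinN[OF r] \<rho>R[OF r] by simp
    then show ?thesis using \<rho>(2)[of g] \<rho>(2)[of "g \<otimes> r"] g subgroup.m_closed[OF T.Nsub g RinN[OF r]] by simp
  qed
  interpret MG: fin_group "H\<lparr>carrier := T.M\<rparr>" by (rule fin_group_subgroup[OF T.Msub])
  obtain d where d: "\<psi> \<one> = of_nat d" using MG.IrrE[OF \<psi>1] by auto
  have kerS: "\<psi> s = \<psi> \<one>" if s: "s \<in> S" for s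
  proof -
    have sM: "s \<in> T.M" using s T.SN SX by auto
    \<comment> \<open>Since \<open>\<phi>\<close> is trivial on \<open>S\<close>, its convolution with \<open>\<psi>\<close> takes the same value at \<open>s\<close> and at \<open>\<one>\<close>.\<close>
    have "(\<Sum>k\<in>T.M. \<psi> (inv k) * \<phi> (k \<otimes> s)) = (\<Sum>k\<in>T.M. \<phi> k * \<psi> (inv k))"
      using s by (intro sum.cong refl) (simp add: triv S_def mult.commute)
    then have "(\<Sum>k\<in>T.M. \<phi> k * \<psi> (inv k)) * \<psi> \<one> = (\<Sum>k\<in>T.M. \<phi> k * \<psi> (inv k)) * \<psi> s"
      using NM.restriction_convolution[OF \<phi> _ sM, of \<psi>] \<psi>1 by (simp add: T.invN)
    then show ?thesis using over by simp
  qed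
  have mult: "multiplicity l c = multiplicity l d"
    "multiplicity l (card T.N div card (S <#> Z)) = multiplicity l (card T.M div card S)"
    using T.multiplicity_transfer[OF \<phi> triv \<psi>1 over c(1) d] ZR by blast+
  have "card S dvd card R" unfolding RS card_product[OF SX S] by simp
  then have "\<exists>k. card S = l ^ k" unfolding a by (rule dvd_prime_power_imp_power[OF l(1)])
  moreover have "multiplicity l d = multiplicity l (card T.M div card S)"
    using mult c(2)[unfolded NR, unfolded RS] by simp
  moreover have S': "subgroup S (H\<lparr>carrier := X\<rparr>)" by (rule subgroup_incl[OF S Xsub SX])
  ultimately show ?thesis
    unfolding fin_group.l_weight_iff[OF fin_group_subgroup[OF Xsub] S'] NX
    using \<psi>1 d kerS by simp
qed

text \<open>A character \<open>\<phi>\<close> that is not orthogonal to \<open>k z \<mapsto> \<psi>(k\<inverse>)\<close> on \<open>M Z\<close> is as required. As \<open>Z\<close> acts by scalars, the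
  inner product is the product of the sum of these scalars over \<open>Z\<close>, which vanishes unless \<open>Z\<close> acts
  trivially, and of the multiplicity of \<open>\<psi>\<close> in \<open>\<phi>\<close>. Finally \<open>\<phi>\<close> is trivial on \<open>S\<close> because all conjugates of
  \<open>\<psi>\<close> are.\<close>

theorem weight_extends:
  assumes w: "l_weight l (H\<lparr>carrier := X\<rparr>) S \<psi>" and R_def: "R = S <#> Z"
  shows "\<exists>\<phi> \<in> Irr_over (normalizer_group H R) (normalizer_group (H\<lparr>carrier := X\<rparr>) S) \<psi>. l_weight l H R \<phi>"
proof -
  have S': "subgroup S (H\<lparr>carrier := X\<rparr>)" using w by (simp add: l_weight_def prime_power_subgroup_def)
  note S = subgroup_of_X(1)[OF S'] and SX = subgroup_of_X(2)[OF S']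
  note w' = w[unfolded fin_group.l_weight_iff[OF fin_group_subgroup[OF Xsub] S']]
  interpret T: weight_transfer H \<nu> m X Z l S
    using central_l_extension_axioms S SX by (intro weight_transfer.intro weight_transfer_axioms.intro)
  have NX: "normalizer (H\<lparr>carrier := X\<rparr>) S = normalizer H S \<inter> X" by (rule normalizer_in_X[OF SX S])
  have NR: "normalizer H R = normalizer H S" unfolding R_def by (rule normalizer_product[OF SX S])
  have R: "subgroup R H" unfolding R_def by (rule product_subgroup[OF S])
  interpret NM: fin_normal "H\<lparr>carrier := T.N\<rparr>" T.M by (rule T.fin_normal_N)
  interpret MG: fin_group "H\<lparr>carrier := T.M\<rparr>" by (rule fin_group_subgroup[OF T.Msub])
  have \<psi>: "\<psi> \<in> Irr (H\<lparr>carrier := T.M\<rparr>)" using w' unfolding NX by simp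
  obtain a where a: "card S = l ^ a" using w' by blast
  obtain b where b: "card Z = l ^ b" using cardZ by blast
  have kerS: "\<psi> s = \<psi> \<one>" if "s \<in> S" for s using w' that by simp
  obtain d where d: "\<psi> \<one> = of_nat d" "multiplicity l d = multiplicity l (card T.M div card S)"
    using w' unfolding NX by auto
  have \<psi>0: "\<psi> \<one> \<noteq> 0" using MG.Irr_one_nonzero[OF \<psi>] by simp
  have finM: "finite T.M" and finZ: "finite Z" by (rule finite_subgroup[OF T.Msub], rule finite_subgroup[OF Z])
  have Mc: "k \<in> carrier H" if "k \<in> T.M" for k by (rule subgroup.mem_carrier[OF T.Msub that])
  \<comment> \<open>\<open>u\<close> is the function \<open>k z \<mapsto> \<psi>(k\<inverse>)\<close>, extended by \<open>0\<close>: the set \<open>A g\<close> is empty for \<open>g\<close> outside \<open>M Z\<close> and a singleton on \<open>M Z\<close>.\<close>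
  define f where "f p = \<psi> (inv (fst p))" for p :: "'a \<times> 'a"
  define A where "A g = {p \<in> T.M \<times> Z. fst p \<otimes> snd p = g}" for g
  define u where "u g = (\<Sum>p\<in>A g. f p)" for g
  have "A \<one> = {(\<one>, \<one>)}"
  proof
    show "A \<one> \<subseteq> {(\<one>, \<one>)}"
    proof
      fix p assume "p \<in> A \<one>"
      then have p: "fst p \<in> T.M" "snd p \<in> Z" "fst p \<otimes> snd p = \<one>" by (auto simp: A_def)
      have "snd p = \<one>"
        using product_in_X[OF _ p(2), of "fst p"] p(1,3) subgroup.one_closed[OF Xsub] by simp
      then show "p \<in> {(\<one>, \<one>)}" using p Mc by (simp add: prod_eq_iff)
    qed
    show "{(\<one>, \<one>)} \<subseteq> A \<one>"
      using subgroup.one_closed[OF T.Msub] subgroup.one_closed[OF Z] by (simp add: A_def)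
  qed
  then have "u \<one> \<noteq> 0" using \<psi>0 by (simp add: u_def f_def)
  then obtain \<phi> where \<phi>: "\<phi> \<in> Irr (H\<lparr>carrier := T.N\<rparr>)" and sum: "(\<Sum>g\<in>T.N. u g * \<phi> g) \<noteq> 0"
    using NM.exists_Irr_sum_nonzero[of u] by auto
  have MN: "k \<in> T.N" if "k \<in> T.M" for k using that by simp
  have ZN: "z \<in> T.N" if "z \<in> Z" for z using that T.ZN by auto
  have "(\<Sum>g\<in>T.N. u g * \<phi> g) = (\<Sum>g\<in>T.N. \<Sum>p\<in>A g. f p * \<phi> (fst p \<otimes> snd p))"
    unfolding u_def sum_distrib_right by (intro sum.cong refl) (simp add: A_def)
  also have "\<dots> = (\<Sum>p\<in>T.M \<times> Z. f p * \<phi> (fst p \<otimes> snd p))"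
    unfolding A_def
  proof (rule sum.group)
    show "finite (T.M \<times> Z)" using finM finZ by simp
    show "finite T.N" by (rule finite_subgroup[OF T.Nsub])
    show "(\<lambda>p. fst p \<otimes> snd p) ` (T.M \<times> Z) \<subseteq> T.N"
      using subgroup.m_closed[OF T.Nsub MN ZN] by (intro image_subsetI) auto
  qed
  also have "\<dots> = (\<Sum>k\<in>T.M. \<Sum>z\<in>Z. \<psi> (inv k) * \<phi> (k \<otimes> z))"
    unfolding sum.cartesian_product by (simp add: f_def case_prod_unfold)
  finally have nz: "(\<Sum>k\<in>T.M. \<Sum>z\<in>Z. \<psi> (inv k) * \<phi> (k \<otimes> z)) \<noteq> 0" using sum by simp
  obtain e \<rho> where \<rho>: "irreducible_rep (H\<lparr>carrier := T.N\<rparr>) e \<rho>"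
    "\<And>g. g \<in> carrier (H\<lparr>carrier := T.N\<rparr>) \<Longrightarrow> \<phi> g = mat_trace (\<rho> g)" "\<phi> \<one>\<^bsub>H\<lparr>carrier := T.N\<rparr>\<^esub> = of_nat e"
    using NM.IrrE[OF \<phi>] by metis
  note \<rho>r = NM.irreducible_repD(1)[OF \<rho>(1)]
  have "\<exists>\<mu>. \<forall>g\<in>T.N. \<phi> (g \<otimes> z) = \<mu> * \<phi> g" if z: "z \<in> Z" for z
  proof -
    have zN: "z \<in> carrier (H\<lparr>carrier := T.N\<rparr>)" using ZN[OF z] by simp
    have "\<exists>c. \<rho> z = c \<cdot>\<^sub>m 1\<^sub>m e"
      by (rule NM.central_acts_by_scalar[OF \<rho>(1) zN]) (simp add: central[OF z T.Nc])
    then obtain \<mu> where \<mu>: "\<rho> z = \<mu> \<cdot>\<^sub>m 1\<^sub>m e" ..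
    have "\<phi> (g \<otimes> z) = \<mu> * \<phi> g" if g: "g \<in> T.N" for g
    proof -
      have gN: "g \<in> carrier (H\<lparr>carrier := T.N\<rparr>)" using g by simp
      note \<rho>g = representationD(1)[OF \<rho>r gN]
      have "\<rho> (g \<otimes> z) = \<rho> g * \<rho> z" using representationD(2)[OF \<rho>r gN zN] by simp
      also have "\<dots> = \<mu> \<cdot>\<^sub>m \<rho> g"
        unfolding \<mu> using mult_smult_distrib[OF \<rho>g one_carrier_mat] right_mult_one_mat[OF \<rho>g] by metis
      finally show ?thesis
        using \<rho>(2)[of "g \<otimes> z"] \<rho>(2)[OF gN] subgroup.m_closed[OF T.Nsub g ZN[OF z]] by (simp add: mat_trace_smult[OF \<rho>g])
    qed
    then show ?thesis by blast
  qed
  then obtain \<mu> where \<mu>: "\<phi> (g \<otimes> z) = \<mu> z * \<phi> g" if "z \<in> Z" "g \<in> T.N" for z g by metis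
  have "(\<Sum>k\<in>T.M. \<Sum>z\<in>Z. \<psi> (inv k) * \<phi> (k \<otimes> z)) = (\<Sum>z\<in>Z. \<mu> z) * (\<Sum>k\<in>T.M. \<phi> k * \<psi> (inv k))"
    by (simp add: \<mu> MN sum_distrib_left sum_distrib_right mult_ac)
  then have s\<mu>: "(\<Sum>z\<in>Z. \<mu> z) \<noteq> 0" and over: "(\<Sum>k\<in>T.M. \<phi> k * \<psi> (inv k)) \<noteq> 0" using nz by auto
  have \<phi>1: "\<phi> \<one> \<noteq> 0" using NM.Irr_one_nonzero[OF \<phi>] by simp
  have oneN: "\<one> \<in> T.N" by (rule subgroup.one_closed[OF T.Nsub])
  have \<mu>1: "\<mu> y = 1" if y: "y \<in> Z" for y
  proof -
    have "bij_betw (\<lambda>z. z \<otimes> y) Z Z"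
      using y Zc subgroup.m_closed[OF Z] subgroup.m_inv_closed[OF Z]
      by (intro bij_betw_byWitness[of _ "\<lambda>z. z \<otimes> inv y"]) (auto simp: m_assoc)
    then have "(\<Sum>z\<in>Z. \<mu> z) = (\<Sum>z\<in>Z. \<mu> (z \<otimes> y))" by (rule sum.reindex_bij_betw[symmetric])
    also have "\<dots> = (\<Sum>z\<in>Z. \<mu> z * \<mu> y)"
    proof (rule sum.cong[OF refl])
      fix z assume z: "z \<in> Z"
      have "\<mu> (z \<otimes> y) * \<phi> \<one> = \<phi> (\<one> \<otimes> (z \<otimes> y))" using \<mu>[OF subgroup.m_closed[OF Z z y] oneN] by simp
      also have "\<one> \<otimes> (z \<otimes> y) = \<one> \<otimes> z \<otimes> y" using Zc[OF z] Zc[OF y] by simp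
      also have "\<phi> (\<one> \<otimes> z \<otimes> y) = \<mu> y * (\<mu> z * \<phi> \<one>)"
        using \<mu>[OF y, of "\<one> \<otimes> z"] \<mu>[OF z oneN] subgroup.m_closed[OF T.Nsub oneN ZN[OF z]] by simp
      finally show "\<mu> (z \<otimes> y) = \<mu> z * \<mu> y" using \<phi>1 by simp
    qed
    also have "\<dots> = (\<Sum>z\<in>Z. \<mu> z) * \<mu> y" by (simp add: sum_distrib_right)
    finally show ?thesis using s\<mu> by simp
  qed
  have triv: "\<phi> (g \<otimes> z) = \<phi> g" if "g \<in> T.N" "z \<in> Z" for g z using \<mu>[OF that(2,1)] \<mu>1[OF that(2)] by simp
  have kerS': "\<phi> s = \<phi> \<one>" if s: "s \<in> S" for s
  proof -
    have sM: "s \<in> T.M" using s T.SN SX by auto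
    have over': "(\<Sum>k\<in>T.M. \<phi> k * \<psi> (inv\<^bsub>H\<lparr>carrier := T.N\<rparr>\<^esub> k)) \<noteq> 0" using over by (simp add: T.invN)
    have "of_nat (Coset.order (H\<lparr>carrier := T.N\<rparr>)) * \<psi> \<one> * \<phi> s = \<phi> \<one> * (\<Sum>g\<in>T.N. \<psi> (g \<otimes> s \<otimes> inv g))"
      using NM.clifford_average[OF \<phi> _ over' sM] \<psi> by (simp add: T.invN)
    also have "(\<Sum>g\<in>T.N. \<psi> (g \<otimes> s \<otimes> inv g)) = (\<Sum>g\<in>T.N. \<psi> \<one>)"
      using s by (intro sum.cong refl kerS) (simp add: mem_normalizer_iff[OF S finite_subgroup[OF S]])
    also have "\<dots> = of_nat (Coset.order (H\<lparr>carrier := T.N\<rparr>)) * \<psi> \<one>" by (simp add: Coset.order_def)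
    finally show ?thesis using \<psi>0 NM.order_pos by simp
  qed
  have kerR: "\<phi> r = \<phi> \<one>" if "r \<in> R" for r
  proof -
    obtain s z where r: "s \<in> S" "z \<in> Z" "r = s \<otimes> z" using \<open>r \<in> R\<close> unfolding R_def by (rule set_multE)
    show ?thesis unfolding r(3) using triv[OF subsetD[OF T.SN r(1)] r(2)] kerS'[OF r(1)] by simp
  qed
  have e: "\<phi> \<one> = of_nat e" using \<rho>(3) by simp
  have mult: "multiplicity l e = multiplicity l d"
    "multiplicity l (card T.N div card (S <#> Z)) = multiplicity l (card T.M div card S)"
    by (rule T.multiplicity_transfer[OF \<phi> triv \<psi> over e d(1)]; assumption)+
  have "card R = l ^ (a + b)" unfolding R_def card_product[OF SX S] a b power_add ..
  moreover have "multiplicity l e = multiplicity l (card T.N div card R)" using mult d(2) unfolding R_def by simp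
  ultimately have "l_weight l H R \<phi>"
    unfolding l_weight_iff[OF R] NR using \<phi> kerR e by auto
  moreover have "\<psi> \<in> Irr_below (H\<lparr>carrier := T.N, carrier := T.M\<rparr>) \<phi>"
    unfolding NM.mem_Irr_below_iff using \<psi> over by (simp add: T.invN)
  then have "\<phi> \<in> Irr_over (normalizer_group H R) (normalizer_group (H\<lparr>carrier := X\<rparr>) S) \<psi>"
    unfolding Irr_over_def NR NX using \<phi> by simp
  ultimately show ?thesis by blast
qed

end

section \<open>Linear and unitary groups\<close>

subsection \<open>Finite fields\<close>

lemma finite_field_power_card_minus_one:
  fixes x :: "'a::{finite, field}"
  assumes "x \<noteq> 0"
  shows "x ^ (card (UNIV :: 'a set) - 1) = 1"
proof -
  define U :: "'a set" where "U = UNIV - {0}"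
  have bij: "bij_betw (\<lambda>y. x * y) U U"
    using assms by (intro bij_betw_byWitness[of _ "\<lambda>y. y / x"]) (auto simp: U_def)
  have "(\<Prod>y\<in>U. y) = (\<Prod>y\<in>U. x * y)" by (rule prod.reindex_bij_betw[OF bij, symmetric])
  also have "\<dots> = x ^ card U * (\<Prod>y\<in>U. y)" by (simp add: prod.distrib)
  finally have "x ^ card U * (\<Prod>y\<in>U. y) = 1 * (\<Prod>y\<in>U. y)" by simp
  moreover have "(\<Prod>y\<in>U. y) \<noteq> 0" by (simp add: U_def)
  moreover have "card U = card (UNIV :: 'a set) - 1" by (simp add: U_def)
  ultimately show ?thesis by simp
qed

text \<open>The multiplicative group is cyclic; send a generator to a primitive root of unity of the same order.\<close>

lemma exists_faithful_linear_character:
  "\<exists>\<theta> :: 'a::{finite, field} \<Rightarrow> complex. (\<forall>x y. x \<noteq> 0 \<longrightarrow> y \<noteq> 0 \<longrightarrow> \<theta> (x * y) = \<theta> x * \<theta> y) \<and>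
    (\<forall>x. x \<noteq> 0 \<longrightarrow> (\<theta> x = 1 \<longleftrightarrow> x = 1))"
proof -
  define n where "n = card (UNIV :: 'a set) - 1"
  define U :: "'a set" where "U = UNIV - {0}"
  have cU: "card U = n" by (simp add: U_def n_def)
  have "1 \<in> U" by (simp add: U_def)
  then have n: "0 < n" unfolding cU[symmetric] by (intro card_gt_0_iff[THEN iffD2]) auto
  have pow: "x [^]\<^bsub>class_ring\<^esub> (i :: nat) = x ^ i" for x :: 'a and i by (induction i) auto
  obtain w :: 'a where w: "w \<noteq> 0" "UNIV - {0} = {w ^ i | i :: nat. i \<in> UNIV}"
    using field.finite_field_mult_group_has_gen[OF class_field[where 'a = 'a]]
    by (auto simp: pow mult_of_def)
  have wex: "\<exists>i. x = w ^ i" if "x \<noteq> 0" for x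
  proof -
    have "x \<in> UNIV - {0}" using that by simp
    then have "x \<in> {w ^ i | i :: nat. i \<in> UNIV}" unfolding w(2) .
    then show ?thesis by simp
  qed
  have wn: "w ^ n = 1" unfolding n_def by (rule finite_field_power_card_minus_one[OF w(1)])
  have wmod: "w ^ i = w ^ (i mod n)" for i
  proof -
    have "w ^ i = w ^ (n * (i div n) + i mod n)" by simp
    also have "\<dots> = w ^ (i mod n)" unfolding power_add power_mult wn by simp
    finally show ?thesis .
  qed
  have img: "(\<lambda>i. w ^ i) ` {..<n} = U"
  proof
    show "(\<lambda>i. w ^ i) ` {..<n} \<subseteq> U" using w(1) by (auto simp: U_def)
    show "U \<subseteq> (\<lambda>i. w ^ i) ` {..<n}"
    proof
      fix x assume "x \<in> U"
      then have "x \<noteq> 0" by (simp add: U_def)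
      then obtain i where "x = w ^ i" by (rule exE[OF wex])
      then show "x \<in> (\<lambda>i. w ^ i) ` {..<n}" using wmod[of i] n by (intro image_eqI[of _ _ "i mod n"]) simp_all
    qed
  qed
  have inj: "inj_on (\<lambda>i. w ^ i) {..<n}" by (rule eq_card_imp_inj_on) (simp_all add: img cU)
  define \<zeta> where "\<zeta> = cis (2 * pi / real n)"
  have \<zeta>k: "\<zeta> ^ k = cis (2 * pi * real k / real n)" for k by (simp add: \<zeta>_def DeMoivre mult_ac)
  have \<zeta>n: "\<zeta> ^ n = 1" using n by (simp add: \<zeta>k complex_eq_iff)
  have \<zeta>mod: "\<zeta> ^ i = \<zeta> ^ (i mod n)" for i
  proof -
    have "\<zeta> ^ i = \<zeta> ^ (n * (i div n) + i mod n)" by simp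
    also have "\<dots> = \<zeta> ^ (i mod n)" unfolding power_add power_mult \<zeta>n by simp
    finally show ?thesis .
  qed
  have \<zeta>inj: "inj_on (\<lambda>k. \<zeta> ^ k) {..<n}"
    using bij_betw_roots_unity[OF n] unfolding bij_betw_def \<zeta>k by simp
  have transfer: "\<zeta> ^ i = \<zeta> ^ j \<longleftrightarrow> w ^ i = w ^ j" for i j
    using inj_on_eq_iff[OF \<zeta>inj, of "i mod n" "j mod n"] inj_on_eq_iff[OF inj, of "i mod n" "j mod n"] n
      \<zeta>mod[of i] \<zeta>mod[of j] wmod[of i] wmod[of j] by simp
  define lg where "lg x = (SOME i. w ^ i = x)" for x
  have lg: "w ^ lg x = x" if "x \<noteq> 0" for x
  proof -
    have "\<exists>i. w ^ i = x" using wex[OF that] by (simp only: eq_commute)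
    then show ?thesis unfolding lg_def by (rule someI_ex)
  qed
  show ?thesis
  proof (intro exI[of _ "\<lambda>x. \<zeta> ^ lg x"] conjI allI impI)
    show "\<zeta> ^ lg (x * y) = \<zeta> ^ lg x * \<zeta> ^ lg y" if "x \<noteq> 0" "y \<noteq> 0" for x y
      unfolding power_add[symmetric] transfer using that by (simp add: power_add lg)
    show "\<zeta> ^ lg x = 1 \<longleftrightarrow> x = 1" if "x \<noteq> 0" for x
      using transfer[of "lg x" 0] lg[OF that] by simp
  qed
qed

lemma CHAR_of_prime_power_card:
  assumes p: "prime p" and "card (UNIV :: 'a::{finite, field} set) = p ^ k"
  shows "CHAR('a) = p"
proof -
  have "CHAR('a) dvd p ^ k" using CHAR_dvd_CARD[where 'a = 'a] assms(2) by simp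
  moreover have "prime CHAR('a)" by (rule prime_CHAR_semidom) (rule finite_imp_CHAR_pos, simp)
  ultimately have "CHAR('a) dvd p" by (metis prime_dvd_power)
  then show ?thesis using primes_dvd_imp_eq[OF \<open>prime CHAR('a)\<close> p] by simp
qed

lemma frobenius_comm_ring_hom:
  assumes p: "prime p" and card: "card (UNIV :: 'a::{finite, field} set) = p ^ k" and q: "q = p ^ f"
  shows "comm_ring_hom (\<lambda>x :: 'a. x ^ q)"
proof
  have C: "CHAR('a) = p" by (rule CHAR_of_prime_power_card[OF p card])
  have q0: "0 < q" using q prime_gt_0_nat[OF p] by simp
  show "(x + y) ^ q = x ^ q + y ^ q" for x y :: 'a
    by (rule freshmans_dream'[where n = f]) (simp_all add: C p q)
  show "(0 :: 'a) ^ q = 0" using q0 by simp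
qed (simp_all add: power_mult_distrib)

subsection \<open>Matrix groups\<close>

lemma finite_carrier_mat: "finite (carrier_mat m n :: 'a::finite mat set)"
proof -
  have "finite (PiE ({0..<m} \<times> {0..<n}) (\<lambda>_. UNIV :: 'a set))" by (intro finite_PiE) auto
  moreover have "carrier_mat m n \<subseteq> (\<lambda>f. mat m n f) ` PiE ({0..<m} \<times> {0..<n}) (\<lambda>_. UNIV :: 'a set)"
  proof
    fix A :: "'a mat" assume A: "A \<in> carrier_mat m n"
    show "A \<in> (\<lambda>f. mat m n f) ` PiE ({0..<m} \<times> {0..<n}) (\<lambda>_. UNIV)"
      by (rule image_eqI[of _ _ "restrict (\<lambda>ij. A $$ ij) ({0..<m} \<times> {0..<n})"])
        (use A in \<open>auto intro!: eq_matI\<close>)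
  qed
  ultimately show ?thesis by (rule finite_surj)
qed

lemma mem_GL_iff: "A \<in> carrier (GL TYPE('a::field) n) \<longleftrightarrow> A \<in> carrier_mat n n \<and> det A \<noteq> 0"
proof
  assume "A \<in> carrier (GL TYPE('a) n)"
  then obtain B where A: "A \<in> carrier_mat n n" and B: "B \<in> carrier_mat n n" "B * A = 1\<^sub>m n" by (auto simp: GL_simps)
  have "det B * det A = 1" using det_mult[OF B(1) A] B(2) by simp
  then show "A \<in> carrier_mat n n \<and> det A \<noteq> 0" using A by auto
next
  assume A: "A \<in> carrier_mat n n \<and> det A \<noteq> 0"
  then have "A \<in> Units (ring_mat TYPE('a) n ())" by (intro det_non_zero_imp_unit) auto
  then show "A \<in> carrier (GL TYPE('a) n)" by (simp add: GL_def units_of_def)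
qed

text \<open>The common features of \<open>GL\<^sub>n(q)\<close> and \<open>GU\<^sub>n(q)\<close> that matter, with \<open>e = q - 1\<close> and \<open>e = q + 1\<close> respectively: the
  scalars in the group are those of order dividing \<open>e\<close>, and they form the centre.\<close>

locale scalar_centre_group =
  fixes G :: "'a::{finite, field} mat monoid" and n e :: nat
  assumes n: "0 < n" and e: "0 < e"
    and G: "G = (GL TYPE('a) n)\<lparr>carrier := carrier G\<rparr>"
    and sub: "subgroup (carrier G) (GL TYPE('a) n)"
    and scalar_mem: "\<And>c. c \<cdot>\<^sub>m 1\<^sub>m n \<in> carrier G \<longleftrightarrow> c ^ e = 1"
    and det_power: "\<And>A. A \<in> carrier G \<Longrightarrow> det A ^ e = 1"
    and central_scalar: "\<And>A. A \<in> center G \<Longrightarrow> \<exists>c. A = c \<cdot>\<^sub>m 1\<^sub>m n"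
begin

lemma mult_G: "A \<otimes>\<^bsub>G\<^esub> B = A * B" by (subst G) (simp add: GL_simps)

lemma one_G: "\<one>\<^bsub>G\<^esub> = 1\<^sub>m n" by (subst G) (simp add: GL_simps)

lemma mat_G: "A \<in> carrier G \<Longrightarrow> A \<in> carrier_mat n n"
  using subgroup.mem_carrier[OF sub, of A] by (simp add: mem_GL_iff)

lemma det_G: "A \<in> carrier G \<Longrightarrow> det A \<noteq> 0"
  using subgroup.mem_carrier[OF sub, of A] by (simp add: mem_GL_iff)

sublocale fin_group G
proof -
  have "Group.group G" by (subst G) (rule subgroup.subgroup_is_group[OF sub group_GL])
  moreover have "finite (carrier G)" by (rule finite_subset[OF _ finite_carrier_mat]) (auto intro: mat_G)
  ultimately show "fin_group G" by (simp add: fin_group_def fin_group_axioms_def)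
qed

lemma det_mult_G: "A \<in> carrier G \<Longrightarrow> B \<in> carrier G \<Longrightarrow> det (A \<otimes>\<^bsub>G\<^esub> B) = det A * det B"
  unfolding mult_G by (rule det_mult[OF mat_G mat_G])

definition scal :: "'a \<Rightarrow> 'a mat" where "scal c = c \<cdot>\<^sub>m 1\<^sub>m n"

lemma scal_mem: "scal c \<in> carrier G \<longleftrightarrow> c ^ e = 1" unfolding scal_def by (rule scalar_mem)

lemma scal_mult: "scal c * scal d = scal (c * d)"
proof -
  have "scal c * scal d = c \<cdot>\<^sub>m (1\<^sub>m n * scal d)"
    unfolding scal_def by (rule mult_smult_assoc_mat[of _ n n _ n]) auto
  also have "\<dots> = scal (c * d)" unfolding scal_def by (intro eq_matI) auto
  finally show ?thesis .
qed

lemma scal_one: "scal 1 = 1\<^sub>m n" unfolding scal_def by (intro eq_matI) auto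

lemma scal_inj: "scal c = scal d \<longleftrightarrow> c = d"
proof
  assume "scal c = scal d"
  then have "scal c $$ (0, 0) = scal d $$ (0, 0)" by simp
  then show "c = d" using n by (simp add: scal_def)
qed simp

lemma det_scal: "det (scal c) = c ^ n" by (simp add: scal_def)

lemma scal_commutes:
  assumes "A \<in> carrier G"
  shows "scal c * A = A * scal c"
proof -
  note A = mat_G[OF assms]
  have "scal c * A = c \<cdot>\<^sub>m A" unfolding scal_def using mult_smult_assoc_mat[OF one_carrier_mat A] A by simp
  moreover have "A * scal c = c \<cdot>\<^sub>m A" unfolding scal_def using mult_smult_distrib[OF A one_carrier_mat] A by simp
  ultimately show ?thesis by simp
qed

lemma center_eq: "center G = scal ` {c. c ^ e = 1}"
proof
  show "center G \<subseteq> scal ` {c. c ^ e = 1}"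
  proof
    fix A assume A: "A \<in> center G"
    obtain c where c: "A = scal c" using central_scalar[OF A] unfolding scal_def by (elim exE)
    have "scal c \<in> carrier G" using A unfolding c by (simp add: center_def)
    then show "A \<in> scal ` {c. c ^ e = 1}" unfolding c scal_mem by (intro imageI CollectI)
  qed
  show "scal ` {c. c ^ e = 1} \<subseteq> center G"
    by (intro image_subsetI) (simp add: center_def scal_mem mult_G scal_commutes)
qed

lemma center_subgroup: "subgroup (center G) G"
proof (rule subgroupI)
  show "center G \<subseteq> carrier G" by (auto simp: center_def)
  show "center G \<noteq> {}" using one_closed by (auto simp: center_def)
  show "inv\<^bsub>G\<^esub> z \<in> center G" if z: "z \<in> center G" for z
  proof -
    have zc: "z \<in> carrier G" and zg: "z \<otimes>\<^bsub>G\<^esub> g = g \<otimes>\<^bsub>G\<^esub> z" if "g \<in> carrier G" for g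
      using z that by (auto simp: center_def)
    have "inv\<^bsub>G\<^esub> z \<otimes>\<^bsub>G\<^esub> g = g \<otimes>\<^bsub>G\<^esub> inv\<^bsub>G\<^esub> z" if g: "g \<in> carrier G" for g
      using zg[OF g] zc[OF g] g by (simp add: inv_solve_left inv_solve_right m_assoc)
    then show ?thesis using zc[OF one_closed] by (simp add: center_def)
  qed
  show "y \<otimes>\<^bsub>G\<^esub> z \<in> center G" if "y \<in> center G" "z \<in> center G" for y z
  proof -
    have yz: "y \<in> carrier G" "z \<in> carrier G" using that by (simp_all add: center_def)
    have "y \<otimes>\<^bsub>G\<^esub> z \<otimes>\<^bsub>G\<^esub> g = g \<otimes>\<^bsub>G\<^esub> (y \<otimes>\<^bsub>G\<^esub> z)" if g: "g \<in> carrier G" for g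
    proof -
      have yg: "y \<otimes>\<^bsub>G\<^esub> g = g \<otimes>\<^bsub>G\<^esub> y" and zg: "z \<otimes>\<^bsub>G\<^esub> g = g \<otimes>\<^bsub>G\<^esub> z"
        using g \<open>y \<in> center G\<close> \<open>z \<in> center G\<close> by (simp_all add: center_def)
      have "y \<otimes>\<^bsub>G\<^esub> z \<otimes>\<^bsub>G\<^esub> g = y \<otimes>\<^bsub>G\<^esub> (z \<otimes>\<^bsub>G\<^esub> g)" by (rule m_assoc[OF yz g])
      also have "\<dots> = y \<otimes>\<^bsub>G\<^esub> g \<otimes>\<^bsub>G\<^esub> z" unfolding zg by (rule m_assoc[OF yz(1) g yz(2), symmetric])
      also have "\<dots> = g \<otimes>\<^bsub>G\<^esub> (y \<otimes>\<^bsub>G\<^esub> z)" unfolding yg by (rule m_assoc[OF g yz])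
      finally show ?thesis .
    qed
    then show ?thesis using yz by (simp add: center_def)
  qed
qed

definition SL where "SL = {A \<in> carrier G. det A = 1}"

lemma SL_normal: "SL \<lhd> G"
proof (rule normal_invI)
  have inv: "det (inv\<^bsub>G\<^esub> A) * det A = 1" if "A \<in> carrier G" for A
    using det_mult_G[OF inv_closed[OF that] that] that by (simp add: one_G)
  show "subgroup SL G"
  proof (rule subgroupI)
    show "SL \<noteq> {}" using one_closed by (auto simp: SL_def one_G)
    show "inv\<^bsub>G\<^esub> A \<in> SL" if "A \<in> SL" for A using that inv[of A] by (simp add: SL_def)
  qed (auto simp: SL_def det_mult_G)
  show "A \<otimes>\<^bsub>G\<^esub> B \<otimes>\<^bsub>G\<^esub> inv\<^bsub>G\<^esub> A \<in> SL" if "A \<in> carrier G" "B \<in> SL" for A B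
    using that inv[of A] by (simp add: SL_def det_mult_G mult.commute)
qed

lemma scalars_subgroup:
  "subgroup (scal ` {c. c ^ e = 1 \<and> c ^ k = 1}) G"
proof (rule subgroupI)
  show "scal ` {c. c ^ e = 1 \<and> c ^ k = 1} \<subseteq> carrier G" by (intro image_subsetI) (simp add: scal_mem)
  have "scal 1 \<in> scal ` {c. c ^ e = 1 \<and> c ^ k = 1}" by (intro imageI) simp
  then show "scal ` {c. c ^ e = 1 \<and> c ^ k = 1} \<noteq> {}" by (rule ex_in_conv[THEN iffD1, OF exI])
  fix A assume "A \<in> scal ` {c. c ^ e = 1 \<and> c ^ k = 1}"
  then obtain c where c: "A = scal c" "c ^ e = 1" "c ^ k = 1" by (elim imageE) simp
  have c0: "c \<noteq> 0" using c(2) e by (auto simp: power_0_left)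
  have i: "scal (inverse c) \<in> carrier G" using c(2) by (simp add: scal_mem power_inverse)
  have "inv\<^bsub>G\<^esub> A = scal (inverse c)"
  proof (rule inv_equality)
    show "scal (inverse c) \<otimes>\<^bsub>G\<^esub> A = \<one>\<^bsub>G\<^esub>" unfolding c(1) mult_G scal_mult one_G using c0 by (simp add: scal_one)
    show "A \<in> carrier G" using c by (simp add: scal_mem)
  qed (rule i)
  then show "inv\<^bsub>G\<^esub> A \<in> scal ` {c. c ^ e = 1 \<and> c ^ k = 1}"
    using c(2,3) by (simp add: power_inverse)
  fix B assume "B \<in> scal ` {c. c ^ e = 1 \<and> c ^ k = 1}"
  then obtain d where d: "B = scal d" "d ^ e = 1" "d ^ k = 1" by (elim imageE) simp
  show "A \<otimes>\<^bsub>G\<^esub> B \<in> scal ` {c. c ^ e = 1 \<and> c ^ k = 1}"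
    unfolding c(1) d(1) mult_G scal_mult
    using c(2,3) d(2,3) by (intro imageI) (simp add: power_mult_distrib)
qed

lemma pow_scal: "c ^ e = 1 \<Longrightarrow> scal c [^]\<^bsub>G\<^esub> (k :: nat) = scal (c ^ k)"
  by (induction k) (simp_all add: one_G scal_one mult_G scal_mult mult.commute)

text \<open>Let \<open>l\<^sup>a\<close> be the \<open>l\<close>-part and \<open>m\<close> the \<open>l'\<close>-part of the order of the multiplicative group of the field. Then
  \<open>\<nu> A = \<theta> (det A ^ l\<^sup>a)\<close>, with \<open>\<theta>\<close> faithful, has exponent \<open>m\<close> and its kernel consists of the matrices whose
  determinant has \<open>l\<close>-power order. Such a determinant is the \<open>n\<close>-th power of an element \<open>c\<close> of \<open>l\<close>-power order
  with \<open>c\<^sup>e = 1\<close>: if \<open>l\<close> divides \<open>n\<close>, it does not divide \<open>e\<close>, and the determinant is \<open>1\<close>; otherwise taking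
  \<open>n\<close>-th powers is invertible on elements of \<open>l\<close>-power order. Dividing by \<open>c I\<close> leaves an element of \<open>SL\<close>.\<close>

theorem central_l_extension_SL:
  fixes l :: nat
  assumes l: "prime l" and ndvd: "\<not> l dvd gcd n e"
  obtains \<nu> m where "central_l_extension G \<nu> m SL (l_core l (G\<lparr>carrier := center G\<rparr>)) l"
proof -
  obtain \<theta> :: "'a \<Rightarrow> complex" where "(\<forall>x y. x \<noteq> 0 \<longrightarrow> y \<noteq> 0 \<longrightarrow> \<theta> (x * y) = \<theta> x * \<theta> y) \<and>
      (\<forall>x. x \<noteq> 0 \<longrightarrow> (\<theta> x = 1 \<longleftrightarrow> x = 1))"
    using exists_faithful_linear_character ..
  then have \<theta>: "\<And>x y. x \<noteq> 0 \<Longrightarrow> y \<noteq> 0 \<Longrightarrow> \<theta> (x * y) = \<theta> x * \<theta> y"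
    "\<And>x. x \<noteq> 0 \<Longrightarrow> \<theta> x = 1 \<longleftrightarrow> x = 1" by simp_all
  define s where "s = card (UNIV :: 'a set) - 1"
  have "card {0 :: 'a, 1} \<le> card (UNIV :: 'a set)" by (rule card_mono) auto
  then have s0: "s \<noteq> 0" by (simp add: s_def)
  have ps: "x ^ s = 1" if "x \<noteq> 0" for x :: 'a
    unfolding s_def by (rule finite_field_power_card_minus_one[OF that])
  define a where "a = multiplicity l s"
  obtain m where m: "s = l ^ a * m" "\<not> l dvd m"
    using multiplicity_decompose'[of s l] s0 l unfolding a_def by (metis not_prime_unit)
  have m0: "0 < m" using m(1) s0 by (cases m) auto
  have la: "l ^ k \<noteq> 0" for k using prime_gt_0_nat[OF l] by simp
  have cop: "coprime (l ^ k) j" if "\<not> l dvd j" for k j using l that by (simp add: prime_imp_coprime)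
  define \<nu> where "\<nu> A = \<theta> (det A ^ (l ^ a))" for A
  have \<nu>1: "\<nu> A = 1 \<longleftrightarrow> det A ^ (l ^ a) = 1" if "A \<in> carrier G" for A
    unfolding \<nu>_def using det_G[OF that] by (intro \<theta>(2)) simp
  have \<theta>pow: "\<theta> (x ^ k) = \<theta> x ^ k" if "x \<noteq> 0" for x k
    using that \<theta>(2)[of 1] by (induction k) (simp_all add: \<theta>(1))
  have lin: "linear_char G \<nu> m"
  proof (intro linear_char.intro linear_char_axioms.intro fin_group_axioms m0)
    show "\<nu> (A \<otimes>\<^bsub>G\<^esub> B) = \<nu> A * \<nu> B" if "A \<in> carrier G" "B \<in> carrier G" for A B
      unfolding \<nu>_def det_mult_G[OF that] power_mult_distrib
      using det_G[OF that(1)] det_G[OF that(2)] by (intro \<theta>(1)) simp_all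
    show "\<nu> A ^ m = 1" if "A \<in> carrier G" for A
    proof -
      have "\<nu> A ^ m = \<theta> (det A ^ s)"
        unfolding \<nu>_def m(1) power_mult using det_G[OF that] by (simp add: \<theta>pow)
      then show ?thesis using ps[OF det_G[OF that]] \<theta>(2)[of 1] by simp
    qed
  qed
  \<comment> \<open>All elements of \<open>l\<close>-power order in the field have order dividing \<open>l\<^sup>a\<close>, so this is the largest \<open>l\<close>-subgroup of the centre.\<close>
  define Z where "Z = scal ` {c. c ^ e = 1 \<and> c ^ (l ^ a) = 1}"
  have Zsub: "subgroup Z G" unfolding Z_def by (rule scalars_subgroup)
  have Zcen: "Z \<subseteq> center G" unfolding Z_def center_eq by (rule image_mono) (rule Collect_mono, simp)
  define CG where "CG = G\<lparr>carrier := center G\<rparr>"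
  interpret CG: fin_group CG unfolding CG_def by (rule fin_group_subgroup[OF center_subgroup])
  have Zsub': "subgroup Z CG" unfolding CG_def by (rule subgroup_incl[OF Zsub center_subgroup Zcen])
  have cardZ: "\<exists>b. card Z = l ^ b"
  proof -
    define E where "E = {c :: 'a. c ^ e = 1 \<and> c ^ (l ^ a) = 1}"
    have E0: "c \<noteq> 0" if "c \<in> E" for c using that e by (auto simp: E_def power_0_left)
    \<comment> \<open>\<open>\<theta>\<close> embeds the group of these scalars into the \<open>l\<^sup>a\<close>-th roots of unity, so its order divides \<open>l\<^sup>a\<close>.\<close>
    have "card Z = card (scal ` E)" unfolding Z_def E_def ..
    also have "\<dots> = card E" by (rule card_image) (simp add: inj_on_def scal_inj)
    also have "\<dots> = card (\<theta> ` E)"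
    proof (rule card_image[symmetric], rule inj_onI)
      fix c d assume c: "c \<in> E" and d: "d \<in> E" and eq: "\<theta> c = \<theta> d"
      have "\<theta> (c / d) * \<theta> d = \<theta> d" using \<theta>(1)[of "c / d" d] E0[OF c] E0[OF d] eq by simp
      moreover have "\<theta> d \<noteq> 0"
        using \<theta>pow[OF E0[OF d], of s] ps[OF E0[OF d]] \<theta>(2)[of 1] s0 by (auto simp: power_0_left)
      ultimately have "c / d = 1" using \<theta>(2)[of "c / d"] E0[OF c] E0[OF d] by simp
      then show "c = d" using E0[OF d] by simp
    qed
    finally have cZ: "card Z = card (\<theta> ` E)" .
    have "card (\<theta> ` E) dvd l ^ a"
    proof (rule card_roots_of_unity_dvd)
      show "0 < l ^ a" using la[of a] by simp
      show "\<theta> ` E \<subseteq> {z. z ^ (l ^ a) = 1}"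
      proof (rule image_subsetI)
        fix c assume c: "c \<in> E"
        then show "\<theta> c \<in> {z. z ^ (l ^ a) = 1}" using \<theta>pow[OF E0[OF c], of "l ^ a"] \<theta>(2)[of 1] by (simp add: E_def)
      qed
      show "1 \<in> \<theta> ` E" by (rule image_eqI[of _ _ 1]) (simp_all add: E_def \<theta>(2))
      fix x y assume "x \<in> \<theta> ` E" "y \<in> \<theta> ` E"
      from \<open>x \<in> \<theta> ` E\<close> obtain c where c: "x = \<theta> c" "c \<in> E" by (rule imageE)
      from \<open>y \<in> \<theta> ` E\<close> obtain d where d: "y = \<theta> d" "d \<in> E" by (rule imageE)
      show "x * y \<in> \<theta> ` E"
        using c d E0[OF c(2)] E0[OF d(2)]
        by (intro image_eqI[of _ _ "c * d"]) (simp_all add: \<theta>(1) E_def power_mult_distrib)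
    qed
    then show ?thesis unfolding cZ by (rule dvd_prime_power_imp_power[OF l])
  qed
  have core: "l_core l CG = Z"
  proof
    show "l_core l CG \<subseteq> Z"
      unfolding l_core_def
    proof (rule CG.generate_subgroup_incl[OF _ Zsub'])
      show "\<Union>{N. N \<lhd> CG \<and> prime_power_subgroup l CG N} \<subseteq> Z"
      proof (rule Union_least)
        fix N assume "N \<in> {N. N \<lhd> CG \<and> prime_power_subgroup l CG N}"
        then have N: "subgroup N CG" and "\<exists>k. card N = l ^ k" by (simp_all add: prime_power_subgroup_def)
        then obtain k where k: "card N = l ^ k" by (elim exE)
        show "N \<subseteq> Z"
        proof
          fix A assume A: "A \<in> N"
          have "A \<in> center G" using subgroup.mem_carrier[OF N A] by (simp add: CG_def)
          then obtain c where c: "A = scal c" "c ^ e = 1" unfolding center_eq by (elim imageE) simp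
          have c0: "c \<noteq> 0" using c(2) e by (auto simp: power_0_left)
          have NG: "subgroup N G" using incl_subgroup[OF center_subgroup N[unfolded CG_def]] .
          have "A [^]\<^bsub>G\<^esub> card N = \<one>\<^bsub>G\<^esub>"
          proof -
            interpret NG: group "G\<lparr>carrier := N\<rparr>" by (rule subgroup.subgroup_is_group[OF NG is_group])
            have "A [^]\<^bsub>G\<lparr>carrier := N\<rparr>\<^esub> Coset.order (G\<lparr>carrier := N\<rparr>) = \<one>\<^bsub>G\<^esub>"
              using NG.pow_order_eq_1[of A] A by simp
            then show ?thesis by (simp add: Coset.order_def nat_pow_consistent[symmetric])
          qed
          then have ck: "c ^ (l ^ k) = 1" unfolding c(1) pow_scal[OF c(2)] k one_G scal_one[symmetric] scal_inj .
          have "c ^ (l ^ a) = 1"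
          proof (rule power_eq_one_coprime[OF _ _ cop[OF m(2)] la])
            show "(c ^ (l ^ a)) ^ (l ^ k) = 1"
              unfolding power_power_commute[of _ "l ^ a"] ck by simp
            show "(c ^ (l ^ a)) ^ m = 1" using ps[OF c0] by (simp add: power_mult[symmetric] m(1))
          qed
          then show "A \<in> Z" unfolding Z_def c(1) using c(2) by (intro imageI) simp
        qed
      qed
    qed
    have "Z \<lhd> CG"
    proof (rule CG.normal_invI[OF Zsub'])
      fix A B assume A: "A \<in> carrier CG" and B: "B \<in> Z"
      have Ac: "A \<in> carrier G" and Bc: "B \<in> carrier G" and AB: "A \<otimes>\<^bsub>G\<^esub> B = B \<otimes>\<^bsub>G\<^esub> A"
        using A subgroup.mem_carrier[OF Zsub B] by (auto simp: CG_def center_def)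
      note Bg = subgroup.mem_carrier[OF Zsub' B]
      have AB': "A \<otimes>\<^bsub>CG\<^esub> B = B \<otimes>\<^bsub>CG\<^esub> A" using AB by (simp add: CG_def)
      have "A \<otimes>\<^bsub>CG\<^esub> B \<otimes>\<^bsub>CG\<^esub> inv\<^bsub>CG\<^esub> A = B \<otimes>\<^bsub>CG\<^esub> (A \<otimes>\<^bsub>CG\<^esub> inv\<^bsub>CG\<^esub> A)"
        unfolding AB' by (rule CG.m_assoc[OF Bg A CG.inv_closed[OF A]])
      also have "\<dots> = B" unfolding CG.r_inv[OF A] by (rule CG.r_one[OF Bg])
      finally show "A \<otimes>\<^bsub>CG\<^esub> B \<otimes>\<^bsub>CG\<^esub> inv\<^bsub>CG\<^esub> A \<in> Z" using B by (simp only:)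
    qed
    then have "Z \<in> {N. N \<lhd> CG \<and> prime_power_subgroup l CG N}"
      using Zsub' cardZ by (simp add: prime_power_subgroup_def)
    then show "Z \<subseteq> l_core l CG"
      unfolding l_core_def by (intro subsetI generate.incl UnionI)
  qed
  have "central_l_extension G \<nu> m SL Z l"
  proof (intro central_l_extension.intro central_l_extension_axioms.intro lin SL_normal Zsub l m(2) cardZ)
    show "z \<otimes>\<^bsub>G\<^esub> g = g \<otimes>\<^bsub>G\<^esub> z" if "z \<in> Z" "g \<in> carrier G" for z g
      using subsetD[OF Zcen that(1)] that(2) by (simp add: center_def)
    have c1: "c = 1" if "c ^ n = 1" "c ^ e = 1" "c ^ (l ^ a) = 1" for c :: 'a
    proof (cases "l dvd n")
      case True
      then have "\<not> l dvd e" using ndvd by simp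
      then show ?thesis using power_eq_one_coprime[OF that(3,2) cop la] by simp
    next
      case False
      then show ?thesis using power_eq_one_coprime[OF that(3,1) cop la] by simp
    qed
    show "SL \<inter> Z = {\<one>\<^bsub>G\<^esub>}"
    proof
      show "SL \<inter> Z \<subseteq> {\<one>\<^bsub>G\<^esub>}"
      proof
        fix A assume "A \<in> SL \<inter> Z"
        then have "det A = 1" and "A \<in> Z" by (simp_all add: SL_def)
        from \<open>A \<in> Z\<close> obtain c where c: "A = scal c" "c ^ e = 1" "c ^ (l ^ a) = 1"
          unfolding Z_def by (elim imageE) simp
        have "c = 1" using c1[OF _ c(2,3)] \<open>det A = 1\<close> unfolding c(1) det_scal by simp
        then show "A \<in> {\<one>\<^bsub>G\<^esub>}" unfolding c(1) by (simp add: one_G scal_one)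
      qed
      show "{\<one>\<^bsub>G\<^esub>} \<subseteq> SL \<inter> Z"
        using subgroup.one_closed[OF normal_imp_subgroup[OF SL_normal]] subgroup.one_closed[OF Zsub] by simp
    qed
    show "linear_char.lin_ker G \<nu> = SL <#>\<^bsub>G\<^esub> Z"
      unfolding linear_char.lin_ker_def[OF lin]
    proof
      show "{g \<in> carrier G. \<nu> g = 1} \<subseteq> SL <#>\<^bsub>G\<^esub> Z"
      proof
        fix A assume "A \<in> {g \<in> carrier G. \<nu> g = 1}"
        then have A: "A \<in> carrier G" "det A ^ (l ^ a) = 1" using \<nu>1 by auto
        have "\<exists>c. c ^ e = 1 \<and> c ^ (l ^ a) = 1 \<and> c ^ n = det A"
        proof (cases "l dvd n")
          case True
          then have "\<not> l dvd e" using ndvd by simp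
          then have "det A = 1" using power_eq_one_coprime[OF A(2) det_power[OF A(1)] cop la] by simp
          then show ?thesis by (intro exI[of _ 1]) simp
        next
          case False
          obtain u v where uv: "n * u = l ^ a * v + 1"
            using bezout_nat[of n "l ^ a"] n coprime_imp_gcd_eq_1[OF coprime_commute[THEN iffD1, OF cop[OF False, of a]]]
            by auto
          have "det A = det A ^ (l ^ a * v + 1)" using A(2) by (simp add: power_mult)
          also have "\<dots> = (det A ^ u) ^ n" unfolding uv[symmetric] by (simp add: power_mult power_power_commute[of _ n])
          finally have 3: "(det A ^ u) ^ n = det A" by (rule sym)
          have 1: "(det A ^ u) ^ e = 1"
            unfolding power_power_commute[of _ u] det_power[OF A(1)] by simp
          have 2: "(det A ^ u) ^ (l ^ a) = 1"
            unfolding power_power_commute[of _ u] A(2) by simp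
          show ?thesis by (rule exI[of _ "det A ^ u"]) (intro conjI 1 2 3)
        qed
        then obtain c where "c ^ e = 1 \<and> c ^ (l ^ a) = 1 \<and> c ^ n = det A" ..
        then have c: "c ^ e = 1" "c ^ (l ^ a) = 1" "c ^ n = det A" by simp_all
        have z: "scal c \<in> Z" unfolding Z_def using c(1,2) by (intro imageI) simp
        note zG = subgroup.mem_carrier[OF Zsub z]
        define x where "x = A \<otimes>\<^bsub>G\<^esub> inv\<^bsub>G\<^esub> scal c"
        have x: "x \<in> carrier G" unfolding x_def using A(1) zG by simp
        have Ax: "A = x \<otimes>\<^bsub>G\<^esub> scal c" unfolding x_def using A(1) zG by (simp add: m_assoc)
        have "det x * det A = det A" using det_mult_G[OF x zG] Ax by (simp add: det_scal c(3))
        then have "x \<in> SL" using det_G[OF A(1)] x by (simp add: SL_def)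
        then show "A \<in> SL <#>\<^bsub>G\<^esub> Z" unfolding Ax using z by (rule set_multI)
      qed
      show "SL <#>\<^bsub>G\<^esub> Z \<subseteq> {g \<in> carrier G. \<nu> g = 1}"
      proof (rule subsetI, erule set_multE)
        fix A x z assume x: "x \<in> SL" and z: "z \<in> Z" and A: "A = x \<otimes>\<^bsub>G\<^esub> z"
        obtain c where c: "z = scal c" "c ^ e = 1" "c ^ (l ^ a) = 1"
          using z unfolding Z_def by (elim imageE) simp
        note zG = subgroup.mem_carrier[OF Zsub z]
        have xG: "x \<in> carrier G" "det x = 1" using x by (simp_all add: SL_def)
        have dA: "det A = c ^ n"
          using det_mult_G[OF xG(1) zG] xG(2) det_scal[of c] unfolding A c(1) by simp
        have "det A ^ (l ^ a) = 1"
          unfolding dA power_power_commute[of _ n] c(3) by simp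
        moreover have "A \<in> carrier G" unfolding A using xG zG by simp
        ultimately show "A \<in> {g \<in> carrier G. \<nu> g = 1}" using \<nu>1 by simp
      qed
    qed
  qed
  then show ?thesis unfolding core[symmetric] CG_def by (rule that)
qed

end

subsection \<open>The general linear and unitary groups\<close>

lemma scalar_matI:
  fixes A :: "'a::comm_ring_1 mat"
  assumes A: "A \<in> carrier_mat n n" and n: "0 < n"
    and off: "\<And>i j. i < n \<Longrightarrow> j < n \<Longrightarrow> i \<noteq> j \<Longrightarrow> A $$ (i, j) = 0"
    and diag: "\<And>i j. i < n \<Longrightarrow> j < n \<Longrightarrow> i \<noteq> j \<Longrightarrow> A $$ (i, i) = A $$ (j, j)"
  shows "\<exists>c. A = c \<cdot>\<^sub>m 1\<^sub>m n"
proof (rule exI[of _ "A $$ (0, 0)"], rule eq_matI)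
  fix i j assume "i < dim_row (A $$ (0, 0) \<cdot>\<^sub>m 1\<^sub>m n)" "j < dim_col (A $$ (0, 0) \<cdot>\<^sub>m 1\<^sub>m n)"
  then have ij: "i < n" "j < n" by simp_all
  have "A $$ (i, i) = A $$ (0, 0)" using diag[OF ij(1) n] by (cases "i = 0") simp_all
  then show "A $$ (i, j) = (A $$ (0, 0) \<cdot>\<^sub>m 1\<^sub>m n) $$ (i, j)"
    using ij off[OF ij] by (cases "i = j") simp_all
qed (use A in simp_all)

lemma commute_addrow_mat:
  fixes A :: "'a::comm_ring_1 mat"
  assumes A: "A \<in> carrier_mat n n" and kl: "k < n" "l < n" "k \<noteq> l"
    and comm: "A * addrow_mat n 1 k l = addrow_mat n 1 k l * A"
  shows "A $$ (l, k) = 0" "A $$ (k, k) = A $$ (l, l)"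
proof -
  have eq: "addcol 1 l k A = addrow 1 k l A"
    unfolding addcol_mat[OF A kl(1)] addrow_mat[OF A kl(2)] by (rule comm)
  have "addcol 1 l k A $$ (k, k) = addrow 1 k l A $$ (k, k)" unfolding eq ..
  then show "A $$ (l, k) = 0" using A kl by simp
  have "addcol 1 l k A $$ (k, l) = addrow 1 k l A $$ (k, l)" unfolding eq ..
  then show "A $$ (k, k) = A $$ (l, l)" using A kl by (simp add: add.commute)
qed

lemma commute_multrow_mat:
  fixes A :: "'a::field mat"
  assumes A: "A \<in> carrier_mat n n" and kl: "k < n" "l < n" "k \<noteq> l" and a: "a \<noteq> 1"
    and comm: "A * multrow_mat n k a = multrow_mat n k a * A"
  shows "A $$ (k, l) = 0"
proof -
  have eq: "multcol k a A = multrow k a A"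
    unfolding multcol_mat[OF A] multrow_mat[OF A] by (rule comm)
  have "multcol k a A $$ (k, l) = multrow k a A $$ (k, l)" unfolding eq ..
  then have "(a - 1) * A $$ (k, l) = 0" using A kl by (simp add: left_diff_distrib)
  then show ?thesis using a by simp
qed

lemma commute_swaprows_mat:
  fixes A :: "'a::comm_ring_1 mat"
  assumes A: "A \<in> carrier_mat n n" and kl: "k < n" "l < n" "k \<noteq> l"
    and comm: "A * swaprows_mat n k l = swaprows_mat n k l * A"
  shows "A $$ (k, k) = A $$ (l, l)"
proof -
  have eq: "swapcols k l A = swaprows k l A"
    unfolding swapcols_mat[OF A kl(1,2)] swaprows_mat[OF A kl(1,2)] by (rule comm)
  have "swapcols k l A $$ (k, l) = swaprows k l A $$ (k, l)" unfolding eq ..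
  then show ?thesis using A kl by simp
qed

text \<open>The transvections lie in \<open>GL\<^sub>n(q)\<close>, and only scalar matrices commute with all of them.\<close>

lemma GL_scalar_centre_group:
  fixes n :: nat
  assumes n: "0 < n" and card: "card (UNIV :: 'a::{finite, field} set) = q"
  shows "scalar_centre_group (GL TYPE('a) n) n (q - 1)"
proof (intro scalar_centre_group.intro)
  have "card {0 :: 'a, 1} \<le> card (UNIV :: 'a set)" by (rule card_mono) auto
  then show q: "0 < q - 1" using card by simp
  show "0 < n" by (rule n)
  show "GL TYPE('a) n = (GL TYPE('a) n)\<lparr>carrier := carrier (GL TYPE('a) n)\<rparr>" by simp
  show "subgroup (carrier (GL TYPE('a) n)) (GL TYPE('a) n)" by (rule group.subgroup_self[OF group_GL])
  show "c \<cdot>\<^sub>m 1\<^sub>m n \<in> carrier (GL TYPE('a) n) \<longleftrightarrow> c ^ (q - 1) = 1" for c :: 'a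
  proof -
    have "c \<cdot>\<^sub>m 1\<^sub>m n \<in> carrier (GL TYPE('a) n) \<longleftrightarrow> c \<noteq> 0" using n by (simp add: mem_GL_iff)
    moreover have "c ^ (q - 1) = 1" if "c \<noteq> 0"
      using finite_field_power_card_minus_one[OF that] card by simp
    moreover have "c \<noteq> 0" if "c ^ (q - 1) = 1" using that q by (auto simp: power_0_left)
    ultimately show ?thesis by metis
  qed
  show "det A ^ (q - 1) = 1" if "A \<in> carrier (GL TYPE('a) n)" for A
    using finite_field_power_card_minus_one[of "det A"] that card by (simp add: mem_GL_iff)
  show "\<exists>c. A = c \<cdot>\<^sub>m 1\<^sub>m n" if A: "A \<in> center (GL TYPE('a) n)" for A
  proof -
    have Ac: "A \<in> carrier_mat n n" using A by (simp add: center_def mem_GL_iff)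
    have comm: "A * addrow_mat n 1 k l = addrow_mat n 1 k l * A" if "k \<noteq> l" for k l
    proof -
      have "addrow_mat n 1 k l \<in> carrier (GL TYPE('a) n)" by (simp add: mem_GL_iff det_addrow_mat[OF that])
      then show ?thesis using A by (simp add: center_def GL_simps(2))
    qed
    show ?thesis
    proof (rule scalar_matI[OF Ac n])
      show "A $$ (i, j) = 0" if "i < n" "j < n" "i \<noteq> j" for i j
        using commute_addrow_mat(1)[OF Ac that(2,1) not_sym[OF that(3)] comm] that(3) by simp
      show "A $$ (i, i) = A $$ (j, j)" if "i < n" "j < n" "i \<noteq> j" for i j
        by (rule commute_addrow_mat(2)[OF Ac that comm[OF that(3)]])
    qed
  qed
qed

text \<open>For \<open>x \<noteq> 0\<close> the element \<open>a = x ^ (q - 1)\<close> satisfies the equation, and it is \<open>1\<close> only if \<open>x ^ q = x\<close>, which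
  has at most \<open>q\<close> solutions.\<close>

lemma exists_norm_one_element:
  assumes card: "card (UNIV :: 'a::{finite, field} set) = q ^ 2"
  shows "\<exists>a :: 'a. a \<noteq> 1 \<and> a ^ (q + 1) = 1"
proof -
  have "card {0 :: 'a, 1} \<le> card (UNIV :: 'a set)" by (rule card_mono) auto
  then have q: "1 < q" unfolding card by (cases "q \<le> 1") (auto simp: le_Suc_eq)
  define P :: "'a poly" where "P = Polynomial.monom 1 q - Polynomial.monom 1 1"
  have "Polynomial.coeff P q = 1" using q by (simp add: P_def)
  then have P: "P \<noteq> 0" by auto
  have "Polynomial.degree P \<le> q" unfolding P_def using q by (intro degree_diff_le) (simp_all add: degree_monom_eq)
  then have "card {x. poly P x = 0} \<le> q" using card_poly_roots_bound[OF P] by simp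
  moreover have "q < q ^ 2" using q by (simp add: power2_eq_square)
  ultimately have "{x. poly P x = 0} \<noteq> UNIV" using card by auto
  then obtain x :: 'a where x: "x ^ q \<noteq> x" by (auto simp: P_def poly_monom)
  have x0: "x \<noteq> 0" using x q by auto
  have "x ^ (q - 1) \<noteq> 1"
  proof
    assume "x ^ (q - 1) = 1"
    moreover have "x ^ q = x ^ (q - 1) * x" using power_Suc2[of x "q - 1"] q by simp
    ultimately show False using x by simp
  qed
  moreover have "(x ^ (q - 1)) ^ (q + 1) = 1"
  proof -
    have "(q - 1) * (q + 1) = q ^ 2 - 1" using q by (cases q) (simp_all add: power2_eq_square)
    then show ?thesis
      using finite_field_power_card_minus_one[OF x0] by (simp only: power_mult[symmetric] card)
  qed
  ultimately show ?thesis by (intro exI[of _ "x ^ (q - 1)"] conjI)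
qed

text \<open>Commuting with the diagonal unitary matrices that have a single entry \<open>a \<noteq> 1\<close> makes a matrix diagonal, and commuting
  with permutation matrices makes its diagonal entries equal.\<close>

lemma GU_scalar_centre_group:
  fixes n :: nat
  assumes n: "0 < n" and card: "card (UNIV :: 'a::{finite, field} set) = q ^ 2"
    and frob: "comm_ring_hom (\<lambda>x :: 'a. x ^ q)"
  shows "scalar_centre_group (GU TYPE('a) n q) n (q + 1)"
proof -
  interpret F: comm_ring_hom "\<lambda>x :: 'a. x ^ q" by (rule frob)
  have q: "0 < q" using F.hom_zero by (cases q) simp_all
  define adj :: "'a mat \<Rightarrow> 'a mat" where "adj A = transpose_mat (map_mat (\<lambda>x. x ^ q) A)" for A
  have adj: "adj A \<in> carrier_mat n n" if "A \<in> carrier_mat n n" for A using that by (simp add: adj_def)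
  have adj_mult: "adj (A * B) = adj B * adj A" if "A \<in> carrier_mat n n" "B \<in> carrier_mat n n" for A B
    unfolding adj_def F.mat_hom_mult[OF that] by (rule transpose_mult) (use that in simp_all)
  have adj_one: "adj (1\<^sub>m n) = 1\<^sub>m n" unfolding adj_def F.mat_hom_one by simp
  have det_adj: "det (adj A) = det A ^ q" if "A \<in> carrier_mat n n" for A
    unfolding adj_def using that by (subst det_transpose[of _ n]) simp_all
  define U where "U = {A \<in> carrier (GL TYPE('a) n). adj A * A = 1\<^sub>m n}"
  have G: "GU TYPE('a) n q = (GL TYPE('a) n)\<lparr>carrier := U\<rparr>" by (simp add: GU_def U_def adj_def)
  have det: "det A ^ (q + 1) = 1" if "A \<in> carrier_mat n n" "adj A * A = 1\<^sub>m n" for A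
    using det_mult[OF adj[OF that(1)] that(1)] by (simp add: that(2) det_adj[OF that(1)] mult.commute)
  have memU: "A \<in> U \<longleftrightarrow> A \<in> carrier_mat n n \<and> adj A * A = 1\<^sub>m n" for A
    using det[of A] by (auto simp: U_def mem_GL_iff)
  show ?thesis
    unfolding G
  proof (intro scalar_centre_group.intro)
    show "0 < n" by (rule n)
    show "0 < q + 1" by simp
    show "(GL TYPE('a) n)\<lparr>carrier := U\<rparr> = (GL TYPE('a) n)\<lparr>carrier := carrier ((GL TYPE('a) n)\<lparr>carrier := U\<rparr>)\<rparr>"
      by simp
    have "subgroup U (GL TYPE('a) n)"
    proof (rule group.subgroupI[OF group_GL])
      show "U \<subseteq> carrier (GL TYPE('a) n)" by (auto simp: U_def)
      have "1\<^sub>m n \<in> U" by (simp add: memU adj_one)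
      then show "U \<noteq> {}" by (rule ex_in_conv[THEN iffD1, OF exI])
      show "A \<otimes>\<^bsub>GL TYPE('a) n\<^esub> B \<in> U" if "A \<in> U" "B \<in> U" for A B
      proof -
        have A: "A \<in> carrier_mat n n" "adj A * A = 1\<^sub>m n" and B: "B \<in> carrier_mat n n" "adj B * B = 1\<^sub>m n"
          using that by (simp_all add: memU)
        have "adj (A * B) * (A * B) = adj B * (adj A * (A * B))"
          unfolding adj_mult[OF A(1) B(1)]
          by (rule assoc_mult_mat[OF adj[OF B(1)] adj[OF A(1)] mult_carrier_mat[OF A(1) B(1)]])
        also have "adj A * (A * B) = adj A * A * B" by (rule assoc_mult_mat[OF adj[OF A(1)] A(1) B(1), symmetric])
        also have "\<dots> = B" unfolding A(2) by (rule left_mult_one_mat[OF B(1)])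
        finally show ?thesis using A(1) B by (simp add: memU GL_simps(2))
      qed
      show "inv\<^bsub>GL TYPE('a) n\<^esub> A \<in> U" if "A \<in> U" for A
      proof -
        have A: "A \<in> carrier_mat n n" "adj A * A = 1\<^sub>m n" and AG: "A \<in> carrier (GL TYPE('a) n)"
          using that by (simp_all add: memU U_def mem_GL_iff)
        define B where "B = inv\<^bsub>GL TYPE('a) n\<^esub> A"
        have "B \<in> carrier (GL TYPE('a) n)" unfolding B_def by (rule group.inv_closed[OF group_GL AG])
        then have B: "B \<in> carrier_mat n n" by (simp add: mem_GL_iff)
        have AB: "A * B = 1\<^sub>m n" using group.r_inv[OF group_GL AG] by (simp add: B_def GL_simps(2,3))
        have "adj A = adj A * A * B"
          unfolding assoc_mult_mat[OF adj[OF A(1)] A(1) B] AB by (rule right_mult_one_mat[OF adj[OF A(1)], symmetric])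
        then have adjA: "adj A = B" unfolding A(2) left_mult_one_mat[OF B] .
        have "adj B * B = 1\<^sub>m n" using adj_mult[OF A(1) B] unfolding AB adj_one adjA by (rule sym)
        then show ?thesis unfolding B_def[symmetric] memU using B by (intro conjI)
      qed
    qed
    then show "subgroup (carrier ((GL TYPE('a) n)\<lparr>carrier := U\<rparr>)) (GL TYPE('a) n)" by simp
    show "c \<cdot>\<^sub>m 1\<^sub>m n \<in> carrier ((GL TYPE('a) n)\<lparr>carrier := U\<rparr>) \<longleftrightarrow> c ^ (q + 1) = 1" for c :: 'a
    proof -
      have 1: "adj (c \<cdot>\<^sub>m 1\<^sub>m n) = c ^ q \<cdot>\<^sub>m 1\<^sub>m n"
        unfolding adj_def using q by (intro eq_matI) (auto simp: power_0_left)
      have "c ^ q \<cdot>\<^sub>m 1\<^sub>m n * (c \<cdot>\<^sub>m 1\<^sub>m n) = c ^ q \<cdot>\<^sub>m (1\<^sub>m n * (c \<cdot>\<^sub>m 1\<^sub>m n))"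
        by (rule mult_smult_assoc_mat[of _ n n _ n]) auto
      also have "\<dots> = c ^ (q + 1) \<cdot>\<^sub>m 1\<^sub>m n" by (intro eq_matI) auto
      finally have 2: "adj (c \<cdot>\<^sub>m 1\<^sub>m n) * (c \<cdot>\<^sub>m 1\<^sub>m n) = c ^ (q + 1) \<cdot>\<^sub>m 1\<^sub>m n" unfolding 1 .
      have "c ^ (q + 1) = 1" if "c ^ (q + 1) \<cdot>\<^sub>m 1\<^sub>m n = (1\<^sub>m n :: 'a mat)"
      proof -
        have "(c ^ (q + 1) \<cdot>\<^sub>m 1\<^sub>m n) $$ (0, 0) = (1\<^sub>m n :: 'a mat) $$ (0, 0)" unfolding that ..
        then show ?thesis using n by simp
      qed
      moreover have "c ^ (q + 1) \<cdot>\<^sub>m 1\<^sub>m n = (1\<^sub>m n :: 'a mat)" if "c ^ (q + 1) = 1"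
        unfolding that by (intro eq_matI) auto
      ultimately have "c ^ (q + 1) \<cdot>\<^sub>m 1\<^sub>m n = (1\<^sub>m n :: 'a mat) \<longleftrightarrow> c ^ (q + 1) = 1" by (rule iffI)
      moreover have "c \<cdot>\<^sub>m 1\<^sub>m n \<in> carrier_mat n n" by simp
      moreover have "carrier ((GL TYPE('a) n)\<lparr>carrier := U\<rparr>) = U" by simp
      ultimately show ?thesis by (simp only: memU 2 simp_thms)
    qed
    show "det A ^ (q + 1) = 1" if "A \<in> carrier ((GL TYPE('a) n)\<lparr>carrier := U\<rparr>)" for A
      using det[of A] that by (simp add: memU)
    show "\<exists>c. A = c \<cdot>\<^sub>m 1\<^sub>m n" if A: "A \<in> center ((GL TYPE('a) n)\<lparr>carrier := U\<rparr>)" for A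
    proof -
      have Ac: "A \<in> carrier_mat n n" using A by (simp add: center_def memU)
      have comm: "A * B = B * A" if "B \<in> U" for B using A that by (simp add: center_def GL_simps(2))
      obtain a :: 'a where a: "a \<noteq> 1" "a ^ (q + 1) = 1" using exists_norm_one_element[OF card] by (elim exE conjE)
      have D: "multrow_mat n k a \<in> U" for k
      proof -
        have "adj (multrow_mat n k a) = multrow_mat n k (a ^ q)"
          unfolding adj_def using q by (intro eq_matI) (auto simp: power_0_left)
        then have "adj (multrow_mat n k a) * multrow_mat n k a = multrow k (a ^ q) (multrow_mat n k a)"
          by (simp only: multrow_mat[OF multrow_mat_carrier])
        also have "\<dots> = 1\<^sub>m n" using a(2) by (intro eq_matI) (auto simp: mult.commute)
        finally show ?thesis by (simp add: memU)
      qed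
      have P: "swaprows_mat n k l \<in> U" if "k < n" "l < n" for k l
      proof -
        have "adj (swaprows_mat n k l) = swaprows_mat n k l"
          unfolding adj_def using q by (intro eq_matI) (auto simp: power_0_left)
        then show ?thesis using swaprows_mat_inv[OF that] by (simp add: memU)
      qed
      show ?thesis
      proof (rule scalar_matI[OF Ac n])
        show "A $$ (i, j) = 0" if "i < n" "j < n" "i \<noteq> j" for i j
          by (rule commute_multrow_mat[OF Ac that a(1) comm[OF D]])
        show "A $$ (i, i) = A $$ (j, j)" if "i < n" "j < n" "i \<noteq> j" for i j
          by (rule commute_swaprows_mat[OF Ac that comm[OF P[OF that(1,2)]]])
      qed
    qed
  qed
qed

lemma GL_eps_scalar_centre_group:
  fixes \<epsilon> :: int
  assumes p: "prime p" and q: "q = p ^ f" and n: "0 < n" and \<epsilon>: "\<epsilon> \<in> {1, -1}"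
    and card: "card (UNIV :: 'a::{finite, field} set) = (if \<epsilon> = 1 then q else q ^ 2)"
  shows "scalar_centre_group (GL_eps TYPE('a) n \<epsilon> q) n (nat (int q - \<epsilon>))"
proof (cases "\<epsilon> = 1")
  case True
  have "nat (int q - \<epsilon>) = q - 1" using True by simp
  then show ?thesis using GL_scalar_centre_group[OF n, where 'a = 'a and q = q] card True by (simp add: GL_eps_def)
next
  case False
  then have \<epsilon>: "\<epsilon> = -1" using \<epsilon> by simp
  have card: "card (UNIV :: 'a set) = q ^ 2" using card False by simp
  have e: "nat (int q - \<epsilon>) = q + 1" unfolding \<epsilon> by simp
  have "card (UNIV :: 'a set) = p ^ (f * 2)" unfolding card q by (simp add: power_mult)
  note frob = frobenius_comm_ring_hom[OF p this q]
  show ?thesis unfolding e GL_eps_def using GU_scalar_centre_group[OF n card frob] False by simp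
qed

theorem proposition5p5:
  fixes p l f q n :: nat and \<epsilon> :: int
    and G X :: "'a::{finite, field} mat monoid"
  assumes "prime p" and "prime l" and "p \<noteq> l"
    and "0 < f" and "q = p ^ f" and "0 < n"
    and "\<epsilon> \<in> {1, -1}"
    and "card (UNIV :: 'a set) = (if \<epsilon> = 1 then q else q ^ 2)"
    and "G = GL_eps TYPE('a) n \<epsilon> q"
    and "X = SL_eps TYPE('a) n \<epsilon> q"
    and "\<not> int l dvd gcd (int n) (int q - \<epsilon>)"
  shows "(\<forall>R \<phi> S. l_weight l G R \<phi> \<and> S = R \<inter> carrier X \<longrightarrow>
            (\<forall>\<psi> \<in> Irr_below (normalizer_group X S) \<phi>. l_weight l X S \<psi>))
       \<and> (\<forall>S \<psi> R. l_weight l X S \<psi> \<and>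
              R = S <#>\<^bsub>G\<^esub> l_core l (G\<lparr>carrier := center G\<rparr>) \<longrightarrow>
            (\<exists>\<phi> \<in> Irr_over (normalizer_group G R) (normalizer_group X S) \<psi>.
               l_weight l G R \<phi>))"
proof -
  interpret G: scalar_centre_group G n "nat (int q - \<epsilon>)"
    unfolding assms(9)
    by (rule GL_eps_scalar_centre_group[OF \<open>prime p\<close> \<open>q = p ^ f\<close> \<open>0 < n\<close> \<open>\<epsilon> \<in> {1, -1}\<close> assms(8)])
  have X: "X = G\<lparr>carrier := G.SL\<rparr>" unfolding G.SL_def using assms(9,10) by (simp only: SL_eps_def)
  have e: "int (nat (int q - \<epsilon>)) = int q - \<epsilon>" using G.e by simp
  have "gcd (int n) (int q - \<epsilon>) = int (gcd n (nat (int q - \<epsilon>)))"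
    using gcd_int_int_eq[of n "nat (int q - \<epsilon>)"] unfolding e .
  then have "\<not> l dvd gcd n (nat (int q - \<epsilon>))" using assms(11) by (simp only: int_dvd_int_iff not_False_eq_True)
  with \<open>prime l\<close> obtain \<nu> m where
    "central_l_extension G \<nu> m G.SL (l_core l (G\<lparr>carrier := center G\<rparr>)) l"
    by (rule G.central_l_extension_SL)
  then interpret E: central_l_extension G \<nu> m G.SL "l_core l (G\<lparr>carrier := center G\<rparr>)" l .
  show ?thesis
    unfolding X
  proof (intro conjI allI impI ballI; elim conjE)
    fix R \<phi> S \<psi>
    assume w: "l_weight l G R \<phi>" and S: "S = R \<inter> carrier (G\<lparr>carrier := G.SL\<rparr>)"
      and \<psi>: "\<psi> \<in> Irr_below (normalizer_group (G\<lparr>carrier := G.SL\<rparr>) S) \<phi>"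
    have "S = R \<inter> G.SL" using S by simp
    then show "l_weight l (G\<lparr>carrier := G.SL\<rparr>) S \<psi>"
      by (rule E.weight_restricts[OF w _ \<psi>])
  next
    fix S \<psi> R
    assume w: "l_weight l (G\<lparr>carrier := G.SL\<rparr>) S \<psi>" and R: "R = S <#>\<^bsub>G\<^esub> l_core l (G\<lparr>carrier := center G\<rparr>)"
    show "\<exists>\<phi>\<in>Irr_over (normalizer_group G R) (normalizer_group (G\<lparr>carrier := G.SL\<rparr>) S) \<psi>. l_weight l G R \<phi>"
      by (rule E.weight_extends[OF w R])
  qed
qed

end
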